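(* (1) For every $C\in\mathbb{R}\setminus\{0,1\}$, $f_C$ has exactly one zero $\tau(C)$ in $F_0$, and $\tau(C)$ lies in the interior of $F_0$. (2) For $C\in\{0,1\}$, $f_C$ has no zeros in $F_0$.
   Context: For $\tau\in\mathbb{H}$, $\zeta(z|\tau)$ is the Weierstrass zeta function of $\mathbb{Z}+\mathbb{Z}\tau$, $\eta_1(\tau)=2\zeta(\frac12|\tau)$, $\eta_2(\tau)=2\zeta(\frac\tau2|\tau)=\tau\eta_1(\tau)-2\pi i$, and $g_2(\tau)=60\sum_{(m,n)\neq(0,0)}(m\tau+n)^{-4}$. For $C\in\mathbb{R}$, $f_C(\tau)=12(C\eta_1(\tau)-\eta_2(\tau))^2-g_2(\tau)(C-\tau)^2$, holomorphic on $\mathbb{H}$. $F_0=\{\tau\in\mathbb{H}:0\le\operatorname{Re}\tau\le1,|\tau-\frac12|\ge\frac12\}$. *)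

theory Defs
  imports "HOL-Complex_Analysis.Complex_Analysis"
begin

definition upper_half_plane :: "complex set" where
  "upper_half_plane = {\<tau>. Im \<tau> > 0}"

text \<open>The point of the lattice $\mathbb{Z} + \mathbb{Z}\tau$ with coordinates \<open>(m, n)\<close>.
  For \<open>\<tau>\<close> in the upper half plane this is injective in the coordinates, so sums over
  nonzero lattice points are written below as sums over coordinates other than \<open>(0, 0)\<close>.
  Both sums converge absolutely.\<close>

definition lattice_pt :: "complex \<Rightarrow> int \<times> int \<Rightarrow> complex" where
  "lattice_pt \<tau> = (\<lambda>(m, n). of_int m * \<tau> + of_int n)"

text \<open>The argument order is \<open>weierstrass_zeta \<tau> z\<close> for $\zeta(z|\tau)$.\<close>

definition weierstrass_zeta :: "complex \<Rightarrow> complex \<Rightarrow> complex" where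
  "weierstrass_zeta \<tau> z =
     1 / z + (\<Sum>\<^sub>\<infinity>p\<in>UNIV - {(0, 0)}.
       1 / (z - lattice_pt \<tau> p) + 1 / lattice_pt \<tau> p + z / lattice_pt \<tau> p ^ 2)"

definition eta1 :: "complex \<Rightarrow> complex" where
  "eta1 \<tau> = 2 * weierstrass_zeta \<tau> (1 / 2)"

definition eta2 :: "complex \<Rightarrow> complex" where
  "eta2 \<tau> = 2 * weierstrass_zeta \<tau> (\<tau> / 2)"

definition g2 :: "complex \<Rightarrow> complex" where
  "g2 \<tau> = 60 * (\<Sum>\<^sub>\<infinity>p\<in>UNIV - {(0, 0)}. 1 / lattice_pt \<tau> p ^ 4)"

definition f_C :: "real \<Rightarrow> complex \<Rightarrow> complex" where
  "f_C C \<tau> = 12 * (of_real C * eta1 \<tau> - eta2 \<tau>) ^ 2 - g2 \<tau> * (of_real C - \<tau>) ^ 2"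

definition F0 :: "complex set" where
  "F0 = {\<tau> \<in> upper_half_plane. 0 \<le> Re \<tau> \<and> Re \<tau> \<le> 1 \<and> norm (\<tau> - 1 / 2) \<ge> 1 / 2}"

end

theory Submission
  imports Defs
begin

text \<open>
  Write $G = g_2/12$ and $A_C = \eta_1 + 2\pi i/(C - \tau)$. By Legendre's relation
  $f_C = 12 (C - \tau)^2 (A_C^2 - G)$. The rotation $R\tau = 1 - 1/\tau$ permutes the cusps
  $0, 1, \infty$ of the ideal triangle $F_0$, and $A_{RC}(R\tau) = \tau^2 A_C(\tau)$,
  $G(R\tau) = \tau^4 G(\tau)$.

  On the imaginary axis $G > 0$ and $\eta_1$ is real, so for $C \neq 0, \infty$ the value $A_C$ is not
  real there; by symmetry $t A_C^2 \neq G$ on all sides of $F_0$ for $0 \le t \le 1$. The same holds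
  near the cusps. Hence $G - t A_C^2$ has as many zeros in $F_0$ for $t = 1$ as for $t = 0$, where the
  only zero is the simple zero $e^{\pi i/3}$ of $G$.

  The cases $C = 0, 1$ are rotated to $C = \infty$, that is, to $\eta_1^2 = G$. The count still gives one
  zero of $G - t \eta_1^2$ for $t < 1$, but on the line $\mathrm{Re}\,\tau = 1/2$ that zero escapes to
  $i\infty$ as $t \to 1$, and by Hurwitz' theorem none is left at $t = 1$.
\<close>

section \<open>Partial fractions\<close>

text \<open>Put P = pi^2/3. High in the strip, A_C = P(V + u) and G = P^2(1 + v), where u and v are
  exponentially small in y = Im \<tau>. For finite C one finds |V|^2 \<le> 1 - 1/(2y), and this
  polynomial gain beats the errors u and v, so zeros of G - t A_C^2 stay away from the cusp. For C =
  \<infinity> there is no gain, since V = 1; only t < 1 keeps the zeros in a compact set, which is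
  why t = 1 has to be reached by a limit.

  On the imaginary axis C = 0 and C = \<infinity> are exceptional too, because A_C is real there.
  The strict inequality A_C^2 < G, obtained by comparing \<tau> with -1/\<tau>, takes the place of
  non-reality.

  Zeros are counted without integrating along the sides of the triangle. Rouche's theorem is applied
  only on small circles around the zeros, which makes the total order locally constant in t, hence
  constant on an interval.

  The Fourier expansions come from summing the lattice row by row; the reflection formulas of the
  polygamma functions give each row in closed form, and Legendre's relation appears as the value of
  a telescoping sum of cotangents.\<close>

lemma sin_pi_nonzero:
  fixes z :: complex
  assumes "z \<notin> \<int>"
  shows "sin (pi * z) \<noteq> 0"
  using assms by (auto simp: sin_eq_0)

text \<open>Differentiate both sides of the reflection formula
  \<open>rGamma z * rGamma (1 - z) = sin (pi * z) / pi\<close> and divide by the value.\<close>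

lemma Digamma_reflection_complex:
  fixes z :: complex
  assumes "z \<notin> \<int>"
  shows "Digamma (1 - z) - Digamma z = pi * cot (pi * z)"
proof -
  have z: "z \<notin> \<int>\<^sub>\<le>\<^sub>0" "1 - z \<notin> \<int>\<^sub>\<le>\<^sub>0"
    using assms nonpos_Ints_Int Ints_diff[of 1 "1 - z"] by auto
  have s: "sin (pi * z) \<noteq> 0" by (rule sin_pi_nonzero[OF assms])
  have "((\<lambda>w. rGamma w * rGamma (1 - w)) has_field_derivative
          rGamma z * rGamma (1 - z) * (Digamma (1 - z) - Digamma z)) (at z)"
    using z by (auto intro!: derivative_eq_intros simp: algebra_simps)
  moreover have "((\<lambda>w. sin (pi * w) / pi) has_field_derivative cos (pi * z)) (at z)"
    by (auto intro!: derivative_eq_intros)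
  ultimately have "rGamma z * rGamma (1 - z) * (Digamma (1 - z) - Digamma z) = cos (pi * z)"
    unfolding rGamma_reflection_complex by (rule DERIV_unique)
  thus ?thesis
    using s by (simp add: rGamma_reflection_complex cot_def field_simps)
qed

lemma exp_2pi_i_neq_1:
  fixes z :: complex
  assumes "z \<notin> \<int>"
  shows "exp (2 * pi * \<i> * z) \<noteq> 1"
proof
  assume "exp (2 * pi * \<i> * z) = 1"
  then obtain n :: int where "2 * pi * \<i> * z = of_int (2 * n) * pi * \<i>"
    by (subst (asm) exp_eq_1) (auto simp: complex_eq_iff)
  hence "z = of_int n" by simp
  thus False using assms by simp
qed

lemma cot_conv_exp:
  fixes z :: complex
  assumes "z \<notin> \<int>"
  defines "X \<equiv> exp (2 * pi * \<i> * z)"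
  shows "cot (pi * z) = -\<i> - 2 * \<i> * (X / (1 - X))"
proof -
  define E where "E = exp (\<i> * (pi * z))"
  have E: "E \<noteq> 0" "X = E * E" "X \<noteq> 1"
    using exp_2pi_i_neq_1[OF assms(1)] by (auto simp: E_def X_def algebra_simps simp flip: exp_add)
  have c: "cot (pi * z) = \<i> * ((E + inverse E) / (E - inverse E))"
  proof -
    have "cos (pi * z) = (E + inverse E) / 2" "sin (pi * z) = (E - inverse E) / (2 * \<i>)"
      by (simp_all add: cos_exp_eq sin_exp_eq E_def exp_minus)
    moreover have "(a / 2) / (b / (2 * \<i>)) = \<i> * (a / b)" for a b :: complex
      by (simp add: divide_simps)
    ultimately show ?thesis by (simp only: cot_def)
  qed
  have "(E + inverse E) / (E - inverse E) = (X + 1) / (X - 1)"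
    using E by (simp add: divide_simps)
  also have "\<dots> = -1 - 2 * (X / (1 - X))"
    using E by (simp add: divide_simps) (simp add: algebra_simps)
  finally have e: "(E + inverse E) / (E - inverse E) = -1 - 2 * (X / (1 - X))" .
  show ?thesis unfolding c e by (simp add: algebra_simps)
qed

text \<open>Inside the unit disc the two functions are the sums of n x^n and n^2 x^n, so
  differentiating and multiplying by x raises the exponent of n. The numerators 1, 1 + x, 1 + 4x +
  x^2 are the Eulerian polynomials.\<close>

lemma DERIV_lambert_rational:
  fixes x :: complex
  assumes "x \<noteq> 1"
  shows "((\<lambda>x. x / (1 - x)^2) has_field_derivative (1 + x) / (1 - x)^3) (at x)"
    and "((\<lambda>x. x * (1 + x) / (1 - x)^3) has_field_derivative (1 + 4 * x + x^2) / (1 - x)^4) (at x)"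
proof -
  define y where "y = 1 - x"
  have y: "y \<noteq> 0" "x = 1 - y" using assms by (auto simp: y_def)
  have "((\<lambda>x. x / (1 - x)^2) has_field_derivative (y^2 + 2 * x * y) / y^4) (at x)"
    using y by (auto intro!: derivative_eq_intros simp: eval_nat_numeral) (simp add: algebra_simps)
  also have "(y^2 + 2 * x * y) / y^4 = (1 + x) / y^3"
    unfolding y(2) using y(1) by (simp add: divide_simps) (simp add: algebra_simps eval_nat_numeral)
  finally show "((\<lambda>x. x / (1 - x)^2) has_field_derivative (1 + x) / (1 - x)^3) (at x)"
    by (simp add: y_def)
  have "((\<lambda>x. x * (1 + x) / (1 - x)^3) has_field_derivative
          ((1 + 2 * x) * y^3 + x * (1 + x) * (3 * y^2)) / y^6) (at x)"
    using y by (auto intro!: derivative_eq_intros simp: eval_nat_numeral)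
  also have "((1 + 2 * x) * y^3 + x * (1 + x) * (3 * y^2)) / y^6 = (1 + 4 * x + x^2) / y^4"
    unfolding y(2) using y(1) by (simp add: divide_simps) (simp add: algebra_simps eval_nat_numeral)
  finally show "((\<lambda>x. x * (1 + x) / (1 - x)^3) has_field_derivative (1 + 4 * x + x^2) / (1 - x)^4) (at x)"
    by (simp add: y_def)
qed

context
  fixes X :: "complex \<Rightarrow> complex"
  defines "X \<equiv> \<lambda>z. exp (2 * pi * \<i> * z)"
begin

text \<open>Differentiates the digamma reflection formula, written in X, once and three times. Since
  X' = 2 pi i X, every derivative in z acts as the operator X d/dX, up to the factor 2 pi i.\<close>

lemma Polygamma_reflection_complex:
  assumes "z \<notin> \<int>"
  shows "Polygamma 1 z + Polygamma 1 (1 - z) = -4 * pi^2 * (X z / (1 - X z)^2)" (is ?P1)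
    and "Polygamma 3 z + Polygamma 3 (1 - z) =
           16 * pi^4 * (X z * (1 + 4 * X z + X z ^ 2) / (1 - X z)^4)" (is ?P3)
proof -
  have op: "open (- \<int> :: complex set)" by (intro open_Compl closed_Ints)
  have X1: "X w \<noteq> 1" if "w \<notin> \<int>" for w
    using exp_2pi_i_neq_1[OF that] by (simp add: X_def)
  have np: "w \<notin> \<int>\<^sub>\<le>\<^sub>0" "1 - w \<notin> \<int>\<^sub>\<le>\<^sub>0" if "w \<notin> \<int>" for w :: complex
    using that nonpos_Ints_Int Ints_diff[of 1 "1 - w"] by auto
  have dX [derivative_intros]: "(X has_field_derivative 2 * pi * \<i> * X w) (at w)" for w
    unfolding X_def by (auto intro!: derivative_eq_intros)
  have P: "((\<lambda>w. Polygamma n (1 - w)) has_field_derivative - Polygamma (Suc n) (1 - w)) (at w)"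
    if "w \<notin> \<int>" for n and w :: complex
    using np[OF that] by (auto intro!: derivative_eq_intros DERIV_chain2[OF has_field_derivative_Polygamma])
  have 0: "Digamma (1 - w) - Digamma w = -pi * \<i> - 2 * pi * \<i> * (X w / (1 - X w))"
    if "w \<notin> \<int>" for w
  proof -
    have c: "cot (pi * w) = -\<i> - 2 * \<i> * (X w / (1 - X w))"
      using cot_conv_exp[OF that] by (simp add: X_def)
    show ?thesis
      unfolding Digamma_reflection_complex[OF that] c by (simp add: algebra_simps)
  qed
  have 1: "Polygamma 1 w + Polygamma 1 (1 - w) = -4 * pi^2 * (X w / (1 - X w)^2)"
    if w: "w \<notin> \<int>" for w
  proof -
    have "((\<lambda>w. Digamma (1 - w) - Digamma w) has_field_derivative
            - Polygamma 1 (1 - w) - Polygamma 1 w) (at w)"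
      using np[OF w] by (auto intro!: derivative_eq_intros P[OF w])
    moreover have "((\<lambda>w. -pi * \<i> - 2 * pi * \<i> * (X w / (1 - X w))) has_field_derivative
            4 * pi^2 * (X w / (1 - X w)^2)) (at w)"
      using X1[OF w] by (auto intro!: derivative_eq_intros)
        (simp add: field_simps power2_eq_square)
    hence "((\<lambda>w. Digamma (1 - w) - Digamma w) has_field_derivative
            4 * pi^2 * (X w / (1 - X w)^2)) (at w)"
      by (rule has_field_derivative_transform_within_open[OF _ op]) (use w 0 in auto)
    ultimately have "- Polygamma 1 (1 - w) - Polygamma 1 w = 4 * pi^2 * (X w / (1 - X w)^2)"
      by (rule DERIV_unique)
    hence "-(- Polygamma 1 (1 - w) - Polygamma 1 w) = -(4 * pi^2 * (X w / (1 - X w)^2))"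
      by (simp only:)
    thus ?thesis by (simp add: add.commute)
  qed
  thus ?P1 using assms by blast
  have 2: "Polygamma 2 w - Polygamma 2 (1 - w) =
             -8 * pi^3 * \<i> * (X w * (1 + X w) / (1 - X w)^3)"
    if w: "w \<notin> \<int>" for w
  proof -
    have "((\<lambda>w. Polygamma 1 w + Polygamma 1 (1 - w)) has_field_derivative
            Polygamma (Suc 1) w - Polygamma (Suc 1) (1 - w)) (at w)"
      using np[OF w] by (auto intro!: derivative_eq_intros P[OF w])
    moreover have "((\<lambda>w. -4 * pi^2 * (X w / (1 - X w)^2)) has_field_derivative
            -8 * pi^3 * \<i> * (X w * (1 + X w) / (1 - X w)^3)) (at w)"
      by (rule DERIV_cong[OF DERIV_cmult[OF
            DERIV_chain2[OF DERIV_lambert_rational(1)[OF X1[OF w]] dX]]])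
         (simp add: eval_nat_numeral)
    hence "((\<lambda>w. Polygamma 1 w + Polygamma 1 (1 - w)) has_field_derivative
            -8 * pi^3 * \<i> * (X w * (1 + X w) / (1 - X w)^3)) (at w)"
      by (rule has_field_derivative_transform_within_open[OF _ op]) (use w 1 in auto)
    ultimately show ?thesis unfolding numeral_2_eq_2 One_nat_def by (rule DERIV_unique)
  qed
  have 3: "Polygamma 3 w + Polygamma 3 (1 - w) =
           16 * pi^4 * (X w * (1 + 4 * X w + X w ^ 2) / (1 - X w)^4)"
    if w: "w \<notin> \<int>" for w
  proof -
    have "((\<lambda>w. Polygamma 2 w - Polygamma 2 (1 - w)) has_field_derivative
            Polygamma (Suc 2) w + Polygamma (Suc 2) (1 - w)) (at w)"
      using np[OF w] by (auto intro!: derivative_eq_intros P[OF w])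
    moreover have "((\<lambda>w. -8 * pi^3 * \<i> * (X w * (1 + X w) / (1 - X w)^3)) has_field_derivative
            16 * pi^4 * (X w * (1 + 4 * X w + X w ^ 2) / (1 - X w)^4)) (at w)"
      by (rule DERIV_cong[OF DERIV_cmult[OF
            DERIV_chain2[OF DERIV_lambert_rational(2)[OF X1[OF w]] dX]]])
         (simp add: eval_nat_numeral mult_ac)
    hence "((\<lambda>w. Polygamma 2 w - Polygamma 2 (1 - w)) has_field_derivative
            16 * pi^4 * (X w * (1 + 4 * X w + X w ^ 2) / (1 - X w)^4)) (at w)"
      by (rule has_field_derivative_transform_within_open[OF _ op]) (use w 2 in auto)
    ultimately have "Polygamma (Suc 2) w + Polygamma (Suc 2) (1 - w) =
        16 * pi^4 * (X w * (1 + 4 * X w + X w ^ 2) / (1 - X w)^4)"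
      by (rule DERIV_unique)
    thus ?thesis by (simp add: eval_nat_numeral)
  qed
  thus ?P3 using assms by blast
qed

end

text \<open>Difference of the digamma series at 1 - z and z + 1: the harmonic terms and Euler's
  constant cancel. Passing from z + 1 back to z produces the term -1/z.\<close>

lemma cot_partial_fractions:
  fixes z :: complex
  assumes "z \<notin> \<int>"
  shows "(\<lambda>n. 1 / (z + of_nat (Suc n)) + 1 / (z - of_nat (Suc n))) sums (pi * cot (pi * z) - 1 / z)"
proof -
  have z: "z \<noteq> 0" "1 - z \<noteq> 0" "z + 1 \<noteq> 0"
    using assms by auto (metis Ints_1 Ints_minus add.inverse_inverse add_eq_0_iff2)
  have s: "(\<lambda>n. inverse (of_nat (Suc n)) - inverse (w + of_nat n)) sums (Digamma w + euler_mascheroni)"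
    if "w \<noteq> 0" for w :: complex
    using summable_Digamma[OF that] by (simp add: Digamma_def summable_sums del: of_nat_Suc)
  have "(\<lambda>n. (inverse (of_nat (Suc n)) - inverse (1 - z + of_nat n)) -
             (inverse (of_nat (Suc n)) - inverse (z + 1 + of_nat n))) sums
          (Digamma (1 - z) + euler_mascheroni - (Digamma (z + 1) + euler_mascheroni))"
    by (intro sums_diff s z)
  also have "Digamma (1 - z) + euler_mascheroni - (Digamma (z + 1) + euler_mascheroni) =
               pi * cot (pi * z) - 1 / z"
    using Digamma_reflection_complex[OF assms] Digamma_plus1[OF z(1)]
    by (simp add: algebra_simps)
  also have "(\<lambda>n. (inverse (of_nat (Suc n)) - inverse (1 - z + of_nat n)) -
             (inverse (of_nat (Suc n)) - inverse (z + 1 + of_nat n))) =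
             (\<lambda>n. 1 / (z + of_nat (Suc n)) + 1 / (z - of_nat (Suc n)))"
  proof
    fix n
    have "inverse (1 - z + of_nat n) = - (1 / (z - of_nat (Suc n)))"
      by (subst minus_divide_right) (simp add: inverse_eq_divide algebra_simps)
    thus "(inverse (of_nat (Suc n)) - inverse (1 - z + of_nat n)) -
             (inverse (of_nat (Suc n)) - inverse (z + 1 + of_nat n)) =
             1 / (z + of_nat (Suc n)) + 1 / (z - of_nat (Suc n))"
      by (simp add: inverse_eq_divide add_ac)
  qed
  finally show ?thesis .
qed

text \<open>For odd k the exponent is even, so the series of the polygamma function at 1 - z
  consists of the powers of z - (n + 1) with the correct sign.\<close>

lemma even_power_partial_fractions:
  fixes z :: complex
  assumes z: "z \<notin> \<int>" and k: "odd k"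
  shows "(\<lambda>n. 1 / (z + of_nat (Suc n)) ^ Suc k + 1 / (z - of_nat (Suc n)) ^ Suc k) sums
           ((Polygamma k z + Polygamma k (1 - z)) / fact k - 1 / z ^ Suc k)"
proof -
  have z': "z \<noteq> 0" "1 - z \<noteq> 0" "z + 1 \<noteq> 0"
    using assms by auto (metis Ints_1 Ints_minus add.inverse_inverse add_eq_0_iff2)
  have "k > 0" using k by (auto intro: Nat.gr0I)
  have s: "(\<lambda>n. inverse ((w + of_nat n) ^ Suc k)) sums (Polygamma k w / fact k)"
    if "w \<noteq> 0" for w :: complex
    using Polygamma_LIMSEQ[OF that \<open>k > 0\<close>] k by simp
  have "(\<lambda>n. inverse ((z + 1 + of_nat n) ^ Suc k) + inverse ((1 - z + of_nat n) ^ Suc k)) sums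
          (Polygamma k (z + 1) / fact k + Polygamma k (1 - z) / fact k)"
    by (intro sums_add s z')
  also have "Polygamma k (z + 1) / fact k + Polygamma k (1 - z) / fact k =
               (Polygamma k z + Polygamma k (1 - z)) / fact k - 1 / z ^ Suc k"
    using Polygamma_plus1[OF z'(1), of k] k by (simp add: field_simps)
  also have "(\<lambda>n. inverse ((z + 1 + of_nat n) ^ Suc k) + inverse ((1 - z + of_nat n) ^ Suc k)) =
      (\<lambda>n. 1 / (z + of_nat (Suc n)) ^ Suc k + 1 / (z - of_nat (Suc n)) ^ Suc k)"
  proof
    fix n
    have "(1 - z + of_nat n) ^ Suc k = (z - of_nat (Suc n)) ^ Suc k"
      by (subst power_minus_even [symmetric]) (use k in \<open>auto simp: algebra_simps\<close>)
    thus "inverse ((z + 1 + of_nat n) ^ Suc k) + inverse ((1 - z + of_nat n) ^ Suc k) =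
        1 / (z + of_nat (Suc n)) ^ Suc k + 1 / (z - of_nat (Suc n)) ^ Suc k"
      by (simp only: inverse_eq_divide of_nat_Suc add_ac)
  qed
  finally show ?thesis .
qed

text \<open>The intervals from -N to N are cofinal among the finite sets of integers. This turns
  unconditional sums over a lattice row into the paired series of the partial fraction
  expansions.\<close>

lemma has_sum_int_imp_sums:
  fixes f :: "int \<Rightarrow> 'a :: real_normed_vector"
  assumes "(f has_sum S) UNIV"
  shows "(\<lambda>n. f (int (Suc n)) + f (- int (Suc n))) sums (S - f 0)"
proof -
  let ?F = "\<lambda>N. {- int N..int N}"
  have "filterlim ?F (finite_subsets_at_top UNIV) sequentially"
    unfolding filterlim_finite_subsets_at_top
  proof safe
    fix Y :: "int set" assume "finite Y"
    then obtain B where B: "\<And>y. y \<in> Y \<Longrightarrow> \<bar>y\<bar> \<le> B"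
      by (metis abs_le_iff bdd_above_finite bdd_above.E finite_imageI image_eqI)
    have "\<forall>\<^sub>F N in sequentially. N \<ge> nat B" by (rule eventually_ge_at_top)
    thus "\<forall>\<^sub>F N in sequentially. finite (?F N) \<and> Y \<subseteq> ?F N \<and> ?F N \<subseteq> UNIV"
      by eventually_elim (use B in \<open>force simp: abs_le_iff\<close>)
  qed
  with assms have lim: "(\<lambda>N. sum f (?F N)) \<longlonglongrightarrow> S"
    unfolding has_sum_def by (rule filterlim_compose)
  have eq: "sum f (?F N) = f 0 + (\<Sum>n<N. f (int (Suc n)) + f (- int (Suc n)))" for N
  proof (induction N)
    case (Suc N)
    have "?F (Suc N) = insert (int (Suc N)) (insert (- int (Suc N)) (?F N))" by auto
    thus ?case using Suc by (simp add: add_ac)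
  qed auto
  have "(\<lambda>N. sum f (?F N) - f 0) \<longlonglongrightarrow> S - f 0"
    by (intro tendsto_intros lim)
  thus ?thesis unfolding sums_def eq by simp
qed

lemma half_notin_Ints: "(1 / 2 :: complex) \<notin> \<int>"
proof
  assume "(1 / 2 :: complex) \<in> \<int>"
  then obtain n :: int where "(1 / 2 :: complex) = of_int n" by (auto elim: Ints_cases)
  hence "1 = 2 * (of_int n :: complex)" by (simp add: field_simps)
  hence "1 = 2 * n" by (metis of_int_eq_iff of_int_mult of_int_numeral of_int_1)
  thus False by presburger
qed

text \<open>The odd terms are the partial fraction expansion at $1/2$.\<close>

lemma inverse_fourth_powers_sums: "(\<lambda>n. 1 / of_nat (Suc n) ^ 4) sums (of_real (pi ^ 4) / 90 :: complex)"
proof -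
  let ?f = "\<lambda>n. 1 / of_nat (Suc n) ^ 4 :: complex"
  have summ: "summable ?f"
    using Polygamma_converges'[of "1 :: complex" 4] by (simp add: inverse_eq_divide add_ac)
  define S where "S = suminf ?f"
  have S: "?f sums S" using summ by (simp add: S_def summable_sums)
  have e: "exp (2 * pi * \<i> * (1/2 :: complex)) = -1" by (simp add: exp_eq_polar)
  have "(\<lambda>n. inverse ((1/2 + of_nat n) ^ Suc 3)) sums ((-1) ^ Suc 3 * Polygamma 3 (1/2 :: complex) / fact 3)"
    by (rule Polygamma_LIMSEQ) auto
  \<comment> \<open>At z = 1/2 both terms on the left of the reflection formula agree, and X = -1
    makes the right side 2 pi^4.\<close>
  moreover have "Polygamma 3 (1/2 :: complex) = pi ^ 4"
    using Polygamma_reflection_complex(2)[OF half_notin_Ints] unfolding e by simp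
  ultimately have "(\<lambda>n. inverse ((1/2 + of_nat n) ^ 4)) sums (of_real pi ^ 4 / 6 :: complex)"
    by (simp add: eval_nat_numeral)
  hence "(\<lambda>n. inverse ((1/2 + of_nat n) ^ 4) / 16) sums (of_real pi ^ 4 / 6 / 16 :: complex)"
    by (rule sums_divide)
  also have "(\<lambda>n. inverse ((1/2 + of_nat n) ^ 4) / 16) = (\<lambda>n. ?f (2 * n))"
  proof
    fix n
    have "(1/2 + of_nat n :: complex) = of_nat (Suc (2 * n)) / 2" by (simp add: field_simps)
    hence "(1/2 + of_nat n :: complex) ^ 4 = of_nat (Suc (2 * n)) ^ 4 / 16"
      by (simp only: power_divide) simp
    thus "inverse ((1/2 + of_nat n) ^ 4) / 16 = ?f (2 * n)"
      by (simp only:) simp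
  qed
  finally have odd: "(\<lambda>n. ?f (2 * n)) sums (of_real pi ^ 4 / 96)" by simp
  have "(\<lambda>n. ?f n / 16) sums (S / 16)" using S by (rule sums_divide)
  also have "(\<lambda>n. ?f n / 16) = (\<lambda>n. ?f (2 * n + 1))"
  proof
    fix n
    have "(of_nat (Suc (2 * n + 1)) :: complex) = of_nat (Suc n) * 2" by (simp add: algebra_simps)
    thus "?f n / 16 = ?f (2 * n + 1)" by (simp add: power_mult_distrib del: of_nat_Suc)
  qed
  finally have even: "(\<lambda>n. ?f (2 * n + 1)) sums (S / 16)" .
  have "(\<lambda>n. \<Sum>k\<in>{n*2..<n*2+2}. ?f k) sums S"
    by (rule sums_group[OF S]) auto
  also have "(\<lambda>n. \<Sum>k\<in>{n*2..<n*2+2}. ?f k) = (\<lambda>n. ?f (2 * n) + ?f (2 * n + 1))"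
  proof
    fix n :: nat
    have "{n*2..<n*2+2} = {2*n, 2*n+1}" by auto
    thus "(\<Sum>k\<in>{n*2..<n*2+2}. ?f k) = ?f (2 * n) + ?f (2 * n + 1)" by simp
  qed
  finally have "S = of_real pi ^ 4 / 96 + S / 16"
    using sums_unique2 sums_add[OF odd even] by blast
  hence "S = of_real (pi ^ 4) / 90" by (simp add: field_simps)
  thus ?thesis using S by (simp only:)
qed

section \<open>Lattice sums\<close>

definition lattice_size :: "int \<times> int \<Rightarrow> real" where
  "lattice_size p = max \<bar>of_int (fst p)\<bar> \<bar>of_int (snd p)\<bar>"

lemma lattice_size_pos: "p \<noteq> (0, 0) \<Longrightarrow> lattice_size p > 0"
  by (cases p) (auto simp: lattice_size_def max_def)

text \<open>The imaginary part controls a, and then the triangle inequality controls b. The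
  coefficients are real rather than integral because the bound is also needed for lattice points
  shifted by a half period.\<close>

lemma norm_lattice_ge:
  fixes \<tau> :: complex
  assumes "Im \<tau> > 0"
  obtains c :: real where "c > 0" "\<And>a b. c * max \<bar>a\<bar> \<bar>b\<bar> \<le> norm (of_real a * \<tau> + of_real b)"
proof
  define y where "y = Im \<tau>"
  have y: "y > 0" using assms by (simp add: y_def)
  have pos: "1 + y + norm \<tau> > 0" using y norm_ge_zero[of \<tau>] by linarith
  show "y / (1 + y + norm \<tau>) > 0" using y pos by simp
  fix a b :: real
  define N where "N = norm (a * \<tau> + b)"
  have "\<bar>Im (a * \<tau> + b)\<bar> \<le> N" unfolding N_def by (rule abs_Im_le_cmod)
  hence a: "y * \<bar>a\<bar> \<le> N" using y by (simp add: y_def abs_mult mult.commute)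
  have "norm (of_real b :: complex) \<le> N + norm (of_real a * \<tau>)"
    unfolding N_def using norm_triangle_ineq4[of "a * \<tau> + b" "a * \<tau>"] by simp
  hence "\<bar>b\<bar> \<le> N + \<bar>a\<bar> * norm \<tau>" by (simp add: norm_mult)
  hence "y * \<bar>b\<bar> \<le> y * N + (y * \<bar>a\<bar>) * norm \<tau>"
    using y mult_left_mono[of "\<bar>b\<bar>" "N + \<bar>a\<bar> * norm \<tau>" y] by (simp add: algebra_simps)
  also have "\<dots> \<le> y * N + N * norm \<tau>"
    using a by (intro add_left_mono mult_right_mono) auto
  finally have b: "y * \<bar>b\<bar> \<le> y * N + N * norm \<tau>" .
  have N: "N \<ge> 0" by (simp add: N_def)
  have "y * \<bar>a\<bar> \<le> N * (1 + y + norm \<tau>)" "y * \<bar>b\<bar> \<le> N * (1 + y + norm \<tau>)"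
    using a b y N mult_nonneg_nonneg[OF N norm_ge_zero[of \<tau>]] mult_nonneg_nonneg[OF N less_imp_le[OF y]]
    unfolding distrib_left mult_1_right mult.commute[of N y] by linarith+
  hence "y * max \<bar>a\<bar> \<bar>b\<bar> \<le> N * (1 + y + norm \<tau>)"
    by (auto simp: max_def)
  thus "y / (1 + y + norm \<tau>) * max \<bar>a\<bar> \<bar>b\<bar> \<le> norm (a * \<tau> + b)"
    using pos by (simp add: N_def field_simps)
qed

lemma summable_on_int_of_abs:
  fixes f :: "nat \<Rightarrow> real"
  assumes "summable f" "\<And>n. f n \<ge> 0"
  shows "(\<lambda>m::int. f (nat \<bar>m\<bar>)) summable_on UNIV"
proof -
  have f: "f summable_on UNIV" using assms by (simp add: summable_on_UNIV_nonneg_real_iff)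
  hence f': "(\<lambda>n. f (Suc n)) summable_on UNIV"
    using assms by (subst summable_on_UNIV_nonneg_real_iff) (auto simp: summable_Suc_iff)
  have 1: "(\<lambda>m::int. f (nat \<bar>m\<bar>)) summable_on range int"
    by (subst summable_on_reindex) (use f in \<open>auto simp: inj_on_def o_def\<close>)
  have 2: "(\<lambda>m::int. f (nat \<bar>m\<bar>)) summable_on range (\<lambda>n. - int (Suc n))"
    by (subst summable_on_reindex) (use f' in \<open>auto simp: inj_on_def o_def nat_add_distrib\<close>)
  have "range int \<union> range (\<lambda>n. - int (Suc n)) = UNIV"
  proof (intro set_eqI iffI UNIV_I)
    fix m :: int
    show "m \<in> range int \<union> range (\<lambda>n. - int (Suc n))"
      by (cases m rule: int_cases) auto
  qed
  moreover have "range int \<inter> range (\<lambda>n. - int (Suc n)) = {}" by auto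
  ultimately show ?thesis using summable_on_Un_disjoint[OF 1 2] by simp
qed

text \<open>The exponent 3 is split evenly: with M the size of (m, n), both (1 + |m|)^(-3/2) and (1
  + |n|)^(-3/2) are at least (2M)^(-3/2), so their product is at least 1/(8 M^3). The product is
  summable because 3/2 > 1. At the origin the summand is 1/0 = 0.\<close>

lemma summable_on_lattice_size:
  "(\<lambda>p. 1 / lattice_size p ^ 3) summable_on UNIV"
proof -
  define u where "u = (\<lambda>m::int. (1 + \<bar>of_int m\<bar>) powr (-3/2) :: real)"
  have "summable (\<lambda>n. of_nat n powr (-3/2) :: real)"
    by (simp add: summable_real_powr_iff)
  hence "summable (\<lambda>n. (1 + real n) powr (-3/2))"
    by (subst (asm) summable_Suc_iff [symmetric]) (simp add: add_ac)
  hence "(\<lambda>m::int. (1 + real (nat \<bar>m\<bar>)) powr (-3/2)) summable_on UNIV"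
    by (intro summable_on_int_of_abs[of "\<lambda>n. (1 + real n) powr (-3/2)"]) auto
  hence u: "u summable_on UNIV" by (simp add: u_def)
  have "(\<lambda>p. u (fst p) * u (snd p)) summable_on (UNIV \<times> UNIV)"
  proof (rule summable_on_SigmaI)
    show "((\<lambda>y. u (fst (x, y)) * u (snd (x, y))) has_sum (u x * infsum u UNIV)) UNIV" for x
      using u by (auto intro!: has_sum_cmult_right)
    show "(\<lambda>x. u x * infsum u UNIV) summable_on UNIV"
      using u by (rule summable_on_cmult_left)
  qed (auto simp: u_def)
  hence "(\<lambda>p. 8 * (u (fst p) * u (snd p))) summable_on (UNIV \<times> UNIV)"
    by (rule summable_on_cmult_right)
  thus ?thesis unfolding UNIV_Times_UNIV
  proof (rule summable_on_comparison_test)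
    fix p :: "int \<times> int"
    show "1 / lattice_size p ^ 3 \<le> 8 * (u (fst p) * u (snd p))"
    proof (cases "p = (0, 0)")
      case True
      thus ?thesis by (simp add: lattice_size_def u_def)
    next
      case False
      define M where "M = lattice_size p"
      have "fst p \<noteq> 0 \<or> snd p \<noteq> 0" using False by (cases p) auto
      hence M1: "M \<ge> 1" unfolding M_def lattice_size_def by (auto simp: le_max_iff_disj)
      have le: "u m \<ge> (2 * M) powr (-3/2)" if "\<bar>of_int m\<bar> \<le> M" for m
        unfolding u_def using M1 that by (intro powr_mono2') auto
      have "1 / M ^ 3 = 8 * ((2 * M) powr (-3/2) * (2 * M) powr (-3/2))"
      proof -
        have "(2 * M) powr (-3/2) * (2 * M) powr (-3/2) = (2 * M) powr (-3)"
          by (simp flip: powr_add)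
        also have "\<dots> = inverse ((2 * M) ^ 3)"
          using M1 by (subst powr_minus) (simp add: powr_numeral)
        also have "\<dots> = 1 / (8 * M ^ 3)" by (simp add: power_mult_distrib inverse_eq_divide)
        finally show ?thesis by simp
      qed
      also have "\<dots> \<le> 8 * (u (fst p) * u (snd p))"
        by (intro mult_left_mono mult_mono le) (auto simp: M_def lattice_size_def u_def)
      finally show ?thesis by (simp add: M_def)
    qed
  qed (auto simp: lattice_size_def)
qed

lemma summable_on_lattice_comparison:
  fixes f :: "int \<times> int \<Rightarrow> complex"
  assumes "\<And>p. p \<noteq> (0, 0) \<Longrightarrow> norm (f p) \<le> K / lattice_size p ^ 3"
  shows "f summable_on UNIV - {(0, 0)}"
proof -
  have "(\<lambda>p. K * (1 / lattice_size p ^ 3)) summable_on UNIV - {(0, 0)}"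
    by (intro summable_on_cmult_right summable_on_subset_banach[OF summable_on_lattice_size]) auto
  hence "(\<lambda>p. norm (f p)) summable_on UNIV - {(0, 0)}"
    by (rule summable_on_comparison_test) (use assms in auto)
  thus ?thesis by (rule abs_summable_summable)
qed

lemma mult_upper_notin_Ints:
  assumes "Im \<tau> > 0" "r \<noteq> 0"
  shows "of_real r * \<tau> + of_real s \<notin> \<int>"
proof
  assume "of_real r * \<tau> + of_real s \<in> \<int>"
  then obtain n where "of_real r * \<tau> + of_real s = of_int n" by (auto elim: Ints_cases)
  hence "Im (of_real r * \<tau> + of_real s) = Im (of_int n)" by (rule arg_cong)
  thus False using assms by simp
qed

text \<open>For |X| < 1 these are the sums of n X^n and n^3 X^n. The closed forms also make sense
  for |X| > 1, which occurs in the rows with negative index; \<open>lambert_inverse\<close> folds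
  those rows back.\<close>

definition lambert1 :: "complex \<Rightarrow> complex" where
  "lambert1 X = X / (1 - X) ^ 2"

definition lambert3 :: "complex \<Rightarrow> complex" where
  "lambert3 X = X * (1 + 4 * X + X ^ 2) / (1 - X) ^ 4"

lemma lambert_inverse:
  assumes "X \<noteq> 0" "X \<noteq> 1"
  shows "lambert1 (inverse X) = lambert1 X" "lambert3 (inverse X) = lambert3 X"
proof -
  have 1: "1 - inverse X = - (1 - X) / X" using assms by (simp add: field_simps)
  have e: "(- (1 - X) / X) ^ 2 = (1 - X) ^ 2 / X ^ 2" "(- (1 - X) / X) ^ 4 = (1 - X) ^ 4 / X ^ 4"
    by (simp_all only: power_divide power_minus_even even_numeral)
  have "1 + 4 * inverse X + inverse X ^ 2 = (1 + 4 * X + X ^ 2) / X ^ 2"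
    using assms by (simp add: field_simps power2_eq_square)
  moreover have "inverse X * (t / X ^ 2) / (D / X ^ 4) = X * t / D" for t D
    using assms by (simp add: eval_nat_numeral)
  moreover have "inverse X / (D / X ^ 2) = X / D" for D
    using assms by (simp add: eval_nat_numeral)
  ultimately show "lambert1 (inverse X) = lambert1 X" "lambert3 (inverse X) = lambert3 X"
    unfolding lambert1_def lambert3_def 1 e by (simp_all only:)
qed

lemma inverse_square_partial_fractions:
  assumes "z \<notin> \<int>"
  shows "(\<lambda>n. 1 / (z + of_nat (Suc n)) ^ 2 + 1 / (z - of_nat (Suc n)) ^ 2) sums
           (- 4 * pi ^ 2 * lambert1 (exp (2 * pi * \<i> * z)) - 1 / z ^ 2)"
  using even_power_partial_fractions[OF assms, of 1] Polygamma_reflection_complex(1)[OF assms]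
  by (simp add: numeral_2_eq_2 lambert1_def)

lemma inverse_fourth_power_partial_fractions:
  assumes "z \<notin> \<int>"
  shows "(\<lambda>n. 1 / (z + of_nat (Suc n)) ^ 4 + 1 / (z - of_nat (Suc n)) ^ 4) sums
           (8 / 3 * pi ^ 4 * lambert3 (exp (2 * pi * \<i> * z)) - 1 / z ^ 4)"
proof -
  have "odd (3 :: nat)" by simp
  moreover have "(Polygamma 3 z + Polygamma 3 (1 - z)) / fact 3 = 8 / 3 * pi ^ 4 * lambert3 (exp (2 * pi * \<i> * z))"
    unfolding Polygamma_reflection_complex(2)[OF assms] lambert3_def by (simp add: fact_numeral)
  ultimately show ?thesis
    using even_power_partial_fractions[OF assms, of 3] by (simp only:) simp
qed

text \<open>Since \<open>1 / 0 = 0\<close>, the summand of \<open>weierstrass_zeta\<close> at \<open>(0, 0)\<close> is \<open>1 / z\<close>, so that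
  $\zeta$ is the sum over all of $\mathbb{Z}^2$, which is evaluated row by row.\<close>

lemma weierstrass_zeta_sums:
  fixes \<tau> z :: complex and c :: real
  assumes \<tau>: "Im \<tau> > 0" and c: "c > 0"
    and far: "\<And>p. p \<noteq> (0, 0) \<Longrightarrow> c * lattice_size p \<le> norm (z - lattice_pt \<tau> p)"
    and z: "\<And>m :: int. z - of_int m * \<tau> \<notin> \<int>"
  shows "(\<lambda>k. pi * (cot (pi * (z + of_nat (Suc k) * \<tau>)) + cot (pi * (z - of_nat (Suc k) * \<tau>)))
              - 8 * pi ^ 2 * z * lambert1 (exp (2 * pi * \<i> * (of_nat (Suc k) * \<tau>))))
         sums (weierstrass_zeta \<tau> z - pi * cot (pi * z) - z * pi ^ 2 / 3)"
proof -
  define T where "T = (\<lambda>p. 1 / (z - lattice_pt \<tau> p) + 1 / lattice_pt \<tau> p + z / lattice_pt \<tau> p ^ 2)"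
  obtain d :: real where d: "d > 0"
      "\<And>a b. d * max \<bar>a\<bar> \<bar>b\<bar> \<le> norm (of_real a * \<tau> + of_real b)"
    by (rule norm_lattice_ge[OF \<tau>], rule that)
  have d': "d * lattice_size p \<le> norm (lattice_pt \<tau> p)" for p
    using d(2)[of "of_int (fst p)" "of_int (snd p)"]
    by (simp add: lattice_size_def lattice_pt_def case_prod_beta)
  have "T summable_on UNIV - {(0, 0)}"
  proof (rule summable_on_lattice_comparison)
    fix p :: "int \<times> int" assume p: "p \<noteq> (0, 0)"
    define \<omega> where "\<omega> = lattice_pt \<tau> p"
    define M where "M = lattice_size p"
    have M: "M > 0" using lattice_size_pos[OF p] by (simp add: M_def)
    have 1: "d * M \<le> norm \<omega>" "c * M \<le> norm (z - \<omega>)"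
      using d'[of p] far[OF p] by (simp_all add: M_def \<omega>_def)
    have nz: "\<omega> \<noteq> 0" "z - \<omega> \<noteq> 0"
      using 1 mult_pos_pos[OF d(1) M] mult_pos_pos[OF c M] by auto
    \<comment> \<open>The correction terms cancel the expansion of 1/(z - \<omega>) through second
      order; what remains decays like the inverse cube of the size.\<close>
    have "T p = z ^ 2 / (\<omega> ^ 2 * (z - \<omega>))"
      using nz unfolding T_def \<omega>_def [symmetric]
      by (simp add: divide_simps) (simp add: algebra_simps power2_eq_square)
    hence "norm (T p) = norm z ^ 2 / (norm \<omega> ^ 2 * norm (z - \<omega>))"
      by (simp add: norm_divide norm_mult norm_power)
    also have "\<dots> \<le> norm z ^ 2 / ((d * M) ^ 2 * (c * M))"
      using 1 M d(1) c by (intro divide_left_mono mult_mono power_mono mult_pos_pos) (use nz in auto)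
    also have "\<dots> = norm z ^ 2 / (d ^ 2 * c) / M ^ 3"
      by (simp add: power_mult_distrib power2_eq_square power3_eq_cube mult_ac)
    finally show "norm (T p) \<le> norm z ^ 2 / (d ^ 2 * c) / lattice_size p ^ 3"
      by (simp add: M_def)
  qed
  hence "(T has_sum infsum T (UNIV - {(0, 0)})) (UNIV - {(0, 0)})" by simp
  from has_sum_insert[OF _ this, of "(0, 0)"]
  have T: "(T has_sum weierstrass_zeta \<tau> z) (UNIV \<times> UNIV)"
    by (simp add: insert_Diff_if weierstrass_zeta_def T_def lattice_pt_def)
  define R where "R = (\<lambda>m. infsum (\<lambda>n. T (m, n)) UNIV)"
  have row: "((\<lambda>n. T (m, n)) has_sum R m) UNIV" for m
  proof -
    have "(\<lambda>(m, n). T (m, n)) summable_on UNIV \<times> UNIV"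
      using has_sum_imp_summable[OF T] by simp
    from summable_on_SigmaD1[OF this UNIV_I] show ?thesis by (simp add: R_def)
  qed
  have R: "(R has_sum weierstrass_zeta \<tau> z) UNIV"
    by (rule has_sum_SigmaD[OF T]) (use row in auto)
  \<comment> \<open>In this row the terms 1/n cancel in pairs and the terms z/n^2 add up to 2 z
    zeta(2).\<close>
  have R0: "R 0 = pi * cot (pi * z) + z * pi ^ 2 / 3"
  proof -
    have "z \<notin> \<int>" using z[of 0] by simp
    note c = cot_partial_fractions[OF this]
    have "(\<lambda>n. complex_of_real (1 / of_nat ((n + 1) ^ 2))) sums of_real (pi ^ 2 / 6)"
      using inverse_squares_sums by (rule sums_of_real)
    hence "(\<lambda>n. 1 / of_nat (Suc n) ^ 2) sums (of_real pi ^ 2 / 6 :: complex)"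
      by (simp add: add_ac)
    hence "(\<lambda>n. 2 * z * (1 / of_nat (Suc n) ^ 2)) sums (2 * z * (of_real pi ^ 2 / 6))"
      by (rule sums_mult)
    from sums_add[OF c this]
    have "(\<lambda>n. T (0, int (Suc n)) + T (0, - int (Suc n))) sums
            (pi * cot (pi * z) - 1 / z + 2 * z * (of_real pi ^ 2 / 6))"
      unfolding T_def lattice_pt_def
      by (rule back_subst[of "\<lambda>f. f sums _"]) (auto simp: fun_eq_iff simp del: of_nat_Suc)
    hence "R 0 - T (0, 0) = pi * cot (pi * z) - 1 / z + 2 * z * (of_real pi ^ 2 / 6)"
      using has_sum_int_imp_sums[OF row[of 0]] sums_unique2 by blast
    thus ?thesis by (simp add: T_def lattice_pt_def)
  qed
  have Rm: "R m = pi * cot (pi * (z - of_int m * \<tau>)) + pi * cot (pi * (of_int m * \<tau>))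
                    - 4 * pi ^ 2 * z * lambert1 (exp (2 * pi * \<i> * (of_int m * \<tau>)))"
    if "m \<noteq> 0" for m
  proof -
    define w where "w = of_int m * \<tau>"
    have w: "w \<notin> \<int>" using mult_upper_notin_Ints[OF \<tau>, of "of_int m" 0] that by (simp add: w_def)
    have zw: "z - w \<notin> \<int>" using z[of m] by (simp add: w_def)
    have "(\<lambda>n. (1 / (z - w + of_nat (Suc n)) + 1 / (z - w - of_nat (Suc n)))
              + (1 / (w + of_nat (Suc n)) + 1 / (w - of_nat (Suc n)))
              + z * (1 / (w + of_nat (Suc n)) ^ 2 + 1 / (w - of_nat (Suc n)) ^ 2)) sums
            ((pi * cot (pi * (z - w)) - 1 / (z - w)) + (pi * cot (pi * w) - 1 / w)
              + z * (- 4 * pi ^ 2 * lambert1 (exp (2 * pi * \<i> * w)) - 1 / w ^ 2))"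
      by (intro sums_add sums_mult cot_partial_fractions inverse_square_partial_fractions w zw)
    hence "(\<lambda>n. T (m, int (Suc n)) + T (m, - int (Suc n))) sums
            ((pi * cot (pi * (z - w)) - 1 / (z - w)) + (pi * cot (pi * w) - 1 / w)
              + z * (- 4 * pi ^ 2 * lambert1 (exp (2 * pi * \<i> * w)) - 1 / w ^ 2))"
      unfolding T_def lattice_pt_def
      by (rule back_subst[of "\<lambda>f. f sums _"])
         (auto simp: fun_eq_iff w_def algebra_simps simp del: of_nat_Suc)
    hence "R m - T (m, 0) = (pi * cot (pi * (z - w)) - 1 / (z - w)) + (pi * cot (pi * w) - 1 / w)
              + z * (- 4 * pi ^ 2 * lambert1 (exp (2 * pi * \<i> * w)) - 1 / w ^ 2)"
      using has_sum_int_imp_sums[OF row[of m]] sums_unique2 by blast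
    moreover have "T (m, 0) = 1 / (z - w) + 1 / w + z / w ^ 2"
      by (simp add: T_def lattice_pt_def w_def)
    ultimately show ?thesis unfolding w_def [symmetric] by (simp add: algebra_simps)
  qed
  \<comment> \<open>The terms cot(pi w) of the two rows cancel because cot is odd, while the
    \<open>lambert1\<close> terms coincide and double.\<close>
  have "R (int (Suc k)) + R (- int (Suc k)) =
          pi * (cot (pi * (z + of_nat (Suc k) * \<tau>)) + cot (pi * (z - of_nat (Suc k) * \<tau>)))
              - 8 * pi ^ 2 * z * lambert1 (exp (2 * pi * \<i> * (of_nat (Suc k) * \<tau>)))" for k
  proof -
    define w where "w = of_nat (Suc k) * \<tau>"
    have w: "w \<notin> \<int>" using mult_upper_notin_Ints[OF \<tau>, of "of_nat (Suc k)" 0] by (simp add: w_def)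
    define X where "X = exp (2 * pi * \<i> * w)"
    have X: "exp (2 * pi * \<i> * (- w)) = inverse X" by (simp add: X_def exp_minus)
    have "lambert1 (inverse X) = lambert1 X"
      by (rule lambert_inverse) (use exp_2pi_i_neq_1[OF w] in \<open>auto simp: X_def\<close>)
    moreover have "cot (pi * (- w)) = - cot (pi * w)" by (simp add: cot_def)
    moreover have "R (int (Suc k)) = pi * cot (pi * (z - w)) + pi * cot (pi * w) - 4 * pi ^ 2 * z * lambert1 X"
      by (subst Rm) (simp_all add: w_def X_def)
    moreover have "R (- int (Suc k)) = pi * cot (pi * (z + w)) + pi * cot (pi * (- w))
                     - 4 * pi ^ 2 * z * lambert1 (inverse X)"
      unfolding X [symmetric] by (subst Rm) (simp_all add: w_def del: of_nat_Suc)
    ultimately show ?thesis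
      unfolding w_def [symmetric] X_def [symmetric] by (simp only:) (simp add: algebra_simps)
  qed
  with has_sum_int_imp_sums[OF R] show ?thesis by (simp add: R0 diff_diff_eq)
qed

text \<open>The value is (E_4 - 1)/240 for the normalised Eisenstein series E_4, where g2/12 =
  (pi^4/9) E_4. Row zero contributes 2 zeta(4) = pi^4/45 to g2/60, and the rows m and -m contribute
  equally.\<close>

lemma g2_sums:
  assumes \<tau>: "Im \<tau> > 0"
  shows "(\<lambda>k. lambert3 (exp (2 * pi * \<i> * (of_nat (Suc k) * \<tau>)))) sums
           ((9 / pi ^ 4 * (g2 \<tau> / 12) - 1) / 240)"
proof -
  define T where "T = (\<lambda>p. 1 / lattice_pt \<tau> p ^ 4)"
  obtain d :: real where d: "d > 0"
      "\<And>a b. d * max \<bar>a\<bar> \<bar>b\<bar> \<le> norm (of_real a * \<tau> + of_real b)"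
    by (rule norm_lattice_ge[OF \<tau>], rule that)
  have d': "d * lattice_size p \<le> norm (lattice_pt \<tau> p)" for p
    using d(2)[of "of_int (fst p)" "of_int (snd p)"]
    by (simp add: lattice_size_def lattice_pt_def case_prod_beta)
  have "T summable_on UNIV - {(0, 0)}"
  proof (rule summable_on_lattice_comparison)
    fix p :: "int \<times> int" assume p: "p \<noteq> (0, 0)"
    define \<omega> where "\<omega> = lattice_pt \<tau> p"
    define M where "M = lattice_size p"
    have "M \<ge> 1"
      using p by (cases p) (auto simp: M_def lattice_size_def le_max_iff_disj)
    have 1: "d * M \<le> norm \<omega>" using d'[of p] by (simp add: M_def \<omega>_def)
    have nz: "\<omega> \<noteq> 0" using 1 mult_pos_pos[OF d(1), of M] \<open>M \<ge> 1\<close> by auto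
    have "norm (T p) = 1 / norm \<omega> ^ 4" by (simp add: T_def \<omega>_def norm_divide norm_power)
    also have "\<dots> \<le> 1 / (d * M) ^ 4"
      using 1 \<open>M \<ge> 1\<close> d(1) nz by (intro divide_left_mono power_mono mult_pos_pos) auto
    also have "\<dots> = 1 / d ^ 4 / M ^ 4" by (simp add: power_mult_distrib)
    also have "\<dots> \<le> 1 / d ^ 4 / M ^ 3"
      using \<open>M \<ge> 1\<close> d(1) by (intro divide_left_mono power_increasing mult_pos_pos) auto
    finally show "norm (T p) \<le> 1 / d ^ 4 / lattice_size p ^ 3" by (simp add: M_def)
  qed
  hence "(T has_sum infsum T (UNIV - {(0, 0)})) (UNIV - {(0, 0)})" by simp
  from has_sum_insert[OF _ this, of "(0, 0)"]
  have T: "(T has_sum (g2 \<tau> / 60)) (UNIV \<times> UNIV)"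
    by (simp add: insert_Diff_if g2_def T_def lattice_pt_def)
  define R where "R = (\<lambda>m. infsum (\<lambda>n. T (m, n)) UNIV)"
  have row: "((\<lambda>n. T (m, n)) has_sum R m) UNIV" for m
  proof -
    have "(\<lambda>(m, n). T (m, n)) summable_on UNIV \<times> UNIV"
      using has_sum_imp_summable[OF T] by simp
    from summable_on_SigmaD1[OF this UNIV_I] show ?thesis by (simp add: R_def)
  qed
  have R: "(R has_sum (g2 \<tau> / 60)) UNIV"
    by (rule has_sum_SigmaD[OF T]) (use row in auto)
  have R0: "R 0 = pi ^ 4 / 45"
  proof -
    have "(\<lambda>n. 2 * (1 / of_nat (Suc n) ^ 4)) sums (2 * (of_real (pi ^ 4) / 90 :: complex))"
      by (intro sums_mult inverse_fourth_powers_sums)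
    hence "(\<lambda>n. T (0, int (Suc n)) + T (0, - int (Suc n))) sums (2 * (of_real (pi ^ 4) / 90))"
      unfolding T_def lattice_pt_def
      by (rule back_subst[of "\<lambda>f. f sums _"]) (auto simp: fun_eq_iff simp del: of_nat_Suc)
    hence "R 0 - T (0, 0) = 2 * (of_real (pi ^ 4) / 90)"
      using has_sum_int_imp_sums[OF row[of 0]] sums_unique2 by blast
    thus ?thesis by (simp add: T_def lattice_pt_def)
  qed
  have Rm: "R m = 8 / 3 * pi ^ 4 * lambert3 (exp (2 * pi * \<i> * (of_int m * \<tau>)))"
    if "m \<noteq> 0" for m
  proof -
    define w where "w = of_int m * \<tau>"
    have w: "w \<notin> \<int>" using mult_upper_notin_Ints[OF \<tau>, of "of_int m" 0] that by (simp add: w_def)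
    have "(\<lambda>n. T (m, int (Suc n)) + T (m, - int (Suc n))) sums
            (8 / 3 * pi ^ 4 * lambert3 (exp (2 * pi * \<i> * w)) - 1 / w ^ 4)"
      using inverse_fourth_power_partial_fractions[OF w] unfolding T_def lattice_pt_def
      by (rule back_subst[of "\<lambda>f. f sums _"])
         (auto simp: fun_eq_iff w_def simp del: of_nat_Suc)
    hence "R m - T (m, 0) = 8 / 3 * pi ^ 4 * lambert3 (exp (2 * pi * \<i> * w)) - 1 / w ^ 4"
      using has_sum_int_imp_sums[OF row[of m]] sums_unique2 by blast
    thus ?thesis by (simp add: T_def lattice_pt_def w_def)
  qed
  have RR: "R (int (Suc k)) + R (- int (Suc k)) =
          16 / 3 * pi ^ 4 * lambert3 (exp (2 * pi * \<i> * (of_nat (Suc k) * \<tau>)))" for k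
  proof -
    define w where "w = of_nat (Suc k) * \<tau>"
    have w: "w \<notin> \<int>" using mult_upper_notin_Ints[OF \<tau>, of "of_nat (Suc k)" 0] by (simp add: w_def)
    define X where "X = exp (2 * pi * \<i> * w)"
    have X: "exp (2 * pi * \<i> * (- w)) = inverse X" by (simp add: X_def exp_minus)
    have "lambert3 (inverse X) = lambert3 X"
      by (rule lambert_inverse) (use exp_2pi_i_neq_1[OF w] in \<open>auto simp: X_def\<close>)
    moreover have "R (int (Suc k)) = 8 / 3 * pi ^ 4 * lambert3 X"
      by (subst Rm) (simp_all add: w_def X_def)
    moreover have "R (- int (Suc k)) = 8 / 3 * pi ^ 4 * lambert3 (inverse X)"
      unfolding X [symmetric] by (subst Rm) (simp_all add: w_def del: of_nat_Suc)
    ultimately show ?thesis unfolding w_def [symmetric] X_def [symmetric] by simp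
  qed
  have "(\<lambda>k. 16 / 3 * pi ^ 4 * lambert3 (exp (2 * pi * \<i> * (of_nat (Suc k) * \<tau>)))) sums
          (g2 \<tau> / 60 - pi ^ 4 / 45)"
    using has_sum_int_imp_sums[OF R] unfolding RR R0 .
  from sums_mult[OF this, of "3 / (16 * pi ^ 4)"]
  have "(\<lambda>k. lambert3 (exp (2 * pi * \<i> * (of_nat (Suc k) * \<tau>)))) sums
          (3 / (16 * pi ^ 4) * (g2 \<tau> / 60 - pi ^ 4 / 45))"
    by (simp add: field_simps)
  also have "3 / (16 * pi ^ 4) * (g2 \<tau> / 60 - pi ^ 4 / 45) = (9 / pi ^ 4 * (g2 \<tau> / 12) - 1) / 240"
    by (simp add: field_simps)
  finally show ?thesis .
qed

section \<open>Legendre's relation and modular transformations\<close>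

text \<open>At z = 1/2 the cotangents in \<open>weierstrass_zeta_sums\<close> cancel, by symmetry
  about 1/2, and only the Lambert terms survive. The value is (1 - E_2)/24 with eta1 = (pi^2/3)
  E_2.\<close>

lemma eta1_sums:
  assumes \<tau>: "Im \<tau> > 0"
  shows "(\<lambda>k. lambert1 (exp (2 * pi * \<i> * (of_nat (Suc k) * \<tau>)))) sums
           ((1 - 3 / pi ^ 2 * eta1 \<tau>) / 24)"
proof -
  obtain d :: real where d: "d > 0"
      "\<And>a b. d * max \<bar>a\<bar> \<bar>b\<bar> \<le> norm (of_real a * \<tau> + of_real b)"
    by (rule norm_lattice_ge[OF \<tau>], rule that)
  have far: "d / 2 * lattice_size p \<le> norm (1 / 2 - lattice_pt \<tau> p)" for p
  proof -
    obtain m n where p: "p = (m, n)" by (cases p)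
    \<comment> \<open>Equality holds at n = 1; this factor 2 is the reason for the constant
      \<open>d / 2\<close>.\<close>
    have "\<bar>real_of_int n\<bar> \<le> 2 * \<bar>real_of_int n - 1 / 2\<bar>"
      by (cases "n \<ge> 1") auto
    hence "lattice_size p \<le> 2 * max \<bar>real_of_int m\<bar> \<bar>real_of_int n - 1 / 2\<bar>"
      by (auto simp: lattice_size_def p max_def)
    hence "d / 2 * lattice_size p \<le> d / 2 * (2 * max \<bar>real_of_int m\<bar> \<bar>real_of_int n - 1 / 2\<bar>)"
      using d(1) by (intro mult_left_mono) auto
    also have "\<dots> \<le> norm (of_real (of_int m) * \<tau> + of_real (real_of_int n - 1 / 2))"
      using d(2)[of "of_int m" "of_int n - 1 / 2"] by simp
    also have "of_real (of_int m) * \<tau> + of_real (real_of_int n - 1 / 2) = - (1 / 2 - lattice_pt \<tau> p)"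
      by (simp add: p lattice_pt_def)
    finally show ?thesis by (simp only: norm_minus_cancel)
  qed
  have z: "1 / 2 - of_int m * \<tau> \<notin> \<int>" for m
  proof (cases "m = 0")
    case False
    thus ?thesis using mult_upper_notin_Ints[OF \<tau>, of "- of_int m" "1 / 2"] by simp
  qed (simp add: half_notin_Ints)
  have cot0: "cot (pi * (1 / 2 + w)) + cot (pi * (1 / 2 - w)) = 0" for w :: complex
  proof -
    have *: "cos (pi * (1 / 2 + x)) = - sin (pi * x)" "sin (pi * (1 / 2 + x)) = cos (pi * x)"
      for x :: complex
      using cos_add[of "of_real (pi / 2)" "pi * x"] sin_add[of "of_real (pi / 2)" "pi * x"]
      by (simp_all only: cos_of_real sin_of_real cos_pi_half sin_pi_half)
         (simp_all add: algebra_simps)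
    show ?thesis using *[of w] *[of "-w"] by (simp add: cot_def)
  qed
  have "cot (pi * (1 / 2) :: complex) = 0"
    using cot0[of 0] by simp
  with weierstrass_zeta_sums[OF \<tau> _ far z] d(1)
  have "(\<lambda>k. - 4 * pi ^ 2 * lambert1 (exp (2 * pi * \<i> * (of_nat (Suc k) * \<tau>)))) sums
          (weierstrass_zeta \<tau> (1 / 2) - pi ^ 2 / 6)"
    unfolding cot0 by simp
  from sums_mult[OF this, of "-1 / (4 * pi ^ 2)"]
  have "(\<lambda>k. lambert1 (exp (2 * pi * \<i> * (of_nat (Suc k) * \<tau>)))) sums
          (-1 / (4 * pi ^ 2) * (weierstrass_zeta \<tau> (1 / 2) - pi ^ 2 / 6))"
    by simp
  also have "-1 / (4 * pi ^ 2) * (weierstrass_zeta \<tau> (1 / 2) - pi ^ 2 / 6) =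
               (1 - 3 / pi ^ 2 * eta1 \<tau>) / 24"
    by (simp add: eta1_def field_simps)
  finally show ?thesis .
qed

lemma norm_exp_2pi_i: "norm (exp (2 * pi * \<i> * \<tau>)) = exp (- 2 * pi * Im \<tau>)"
  by simp

text \<open>At z = \<tau>/2 the Lambert terms are \<tau> times those at z = 1/2, and the cotangents
  telescope, since \<tau>/2 + (k+1)\<tau> and (k+1)\<tau> - \<tau>/2 are neighbouring half-odd
  multiples of \<tau>. The limit -i of the cotangent far up in the half plane is the source of -2 pi
  i.\<close>

theorem legendre_relation:
  assumes \<tau>: "Im \<tau> > 0"
  shows "eta2 \<tau> = \<tau> * eta1 \<tau> - 2 * pi * \<i>"
proof -
  obtain d :: real where d: "d > 0"
      "\<And>a b. d * max \<bar>a\<bar> \<bar>b\<bar> \<le> norm (of_real a * \<tau> + of_real b)"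
    by (rule norm_lattice_ge[OF \<tau>], rule that)
  have far: "d / 2 * lattice_size p \<le> norm (\<tau> / 2 - lattice_pt \<tau> p)" for p
  proof -
    obtain m n where p: "p = (m, n)" by (cases p)
    have "\<bar>real_of_int m\<bar> \<le> 2 * \<bar>real_of_int m - 1 / 2\<bar>"
      by (cases "m \<ge> 1") auto
    hence "lattice_size p \<le> 2 * max \<bar>real_of_int m - 1 / 2\<bar> \<bar>real_of_int n\<bar>"
      by (auto simp: lattice_size_def p max_def)
    hence "d / 2 * lattice_size p \<le> d / 2 * (2 * max \<bar>real_of_int m - 1 / 2\<bar> \<bar>real_of_int n\<bar>)"
      using d(1) by (intro mult_left_mono) auto
    also have "\<dots> \<le> norm (of_real (of_int m - 1 / 2) * \<tau> + of_real (real_of_int n))"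
      using d(2)[of "of_int m - 1 / 2" "of_int n"] by simp
    also have "of_real (of_int m - 1 / 2) * \<tau> + of_real (real_of_int n) = - (\<tau> / 2 - lattice_pt \<tau> p)"
      by (simp add: p lattice_pt_def algebra_simps)
    finally show ?thesis by (simp only: norm_minus_cancel)
  qed
  have z: "\<tau> / 2 - of_int m * \<tau> \<notin> \<int>" for m
  proof -
    have "1 / 2 - real_of_int m \<noteq> 0"
      by (metis eq_iff_diff_eq_0 half_notin_Ints Ints_of_int of_real_divide of_real_numeral of_real_1 of_real_of_int_eq)
    thus ?thesis
      using mult_upper_notin_Ints[OF \<tau>, of "1 / 2 - of_int m" 0] by (simp add: algebra_simps)
  qed
  define a where "a = (\<lambda>k. cot (pi * ((of_nat k + 1 / 2) * \<tau>)))"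
  have a_lim: "a \<longlonglongrightarrow> -\<i>"
  proof -
    define X where "X = (\<lambda>k. exp (pi * \<i> * \<tau>) * exp (2 * pi * \<i> * \<tau>) ^ k)"
    have X: "exp (2 * pi * \<i> * ((of_nat k + 1 / 2) * \<tau>)) = X k" for k
      unfolding X_def by (simp add: exp_of_nat_mult [symmetric] exp_add [symmetric] algebra_simps)
    have "norm (exp (2 * pi * \<i> * \<tau>)) < 1" using \<tau> by (simp add: norm_exp_2pi_i)
    hence "X \<longlonglongrightarrow> exp (pi * \<i> * \<tau>) * 0"
      unfolding X_def by (intro tendsto_intros LIMSEQ_power_zero) auto
    hence "(\<lambda>k. -\<i> - 2 * \<i> * (X k / (1 - X k))) \<longlonglongrightarrow> -\<i> - 2 * \<i> * (0 / (1 - 0))"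
      by (intro tendsto_intros) auto
    moreover have "a = (\<lambda>k. -\<i> - 2 * \<i> * (X k / (1 - X k)))"
    proof
      fix k
      have "(of_nat k + 1 / 2) * \<tau> \<notin> \<int>"
        using mult_upper_notin_Ints[OF \<tau>, of "of_nat k + 1 / 2" 0]
        by (simp add: algebra_simps add_eq_0_iff2)
      from cot_conv_exp[OF this] show "a k = -\<i> - 2 * \<i> * (X k / (1 - X k))" unfolding a_def X .
    qed
    ultimately show ?thesis by simp
  qed
  have a: "cot (pi * (\<tau> / 2 + of_nat (Suc k) * \<tau>)) + cot (pi * (\<tau> / 2 - of_nat (Suc k) * \<tau>)) =
             a (Suc k) - a k" for k
  proof -
    have "pi * (\<tau> / 2 - of_nat (Suc k) * \<tau>) = - (pi * ((of_nat k + 1 / 2) * \<tau>))"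
      by (simp add: algebra_simps)
    hence "cot (pi * (\<tau> / 2 - of_nat (Suc k) * \<tau>)) = - a k"
      unfolding a_def by (simp only: cot_def sin_minus cos_minus divide_minus_right)
    moreover have "\<tau> / 2 + of_nat (Suc k) * \<tau> = (of_nat (Suc k) + 1 / 2) * \<tau>"
      by (simp add: algebra_simps)
    ultimately show ?thesis unfolding a_def by (simp only:) simp
  qed
  have "(\<lambda>k. pi * (a (Suc k) - a k) - 4 * pi ^ 2 * \<tau> * lambert1 (exp (2 * pi * \<i> * (of_nat (Suc k) * \<tau>))))
         sums (pi * (-\<i> - a 0) - 4 * pi ^ 2 * \<tau> * ((1 - 3 / pi ^ 2 * eta1 \<tau>) / 24))"
    by (intro sums_diff sums_mult telescope_sums a_lim eta1_sums \<tau>)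
  moreover have "(\<lambda>k. pi * (a (Suc k) - a k) - 4 * pi ^ 2 * \<tau> * lambert1 (exp (2 * pi * \<i> * (of_nat (Suc k) * \<tau>))))
         sums (weierstrass_zeta \<tau> (\<tau> / 2) - pi * cot (pi * (\<tau> / 2)) - \<tau> / 2 * pi ^ 2 / 3)"
    using weierstrass_zeta_sums[OF \<tau> _ far z] d(1) unfolding a by (simp add: mult_ac)
  ultimately have "pi * (-\<i> - a 0) - 4 * pi ^ 2 * \<tau> * ((1 - 3 / pi ^ 2 * eta1 \<tau>) / 24) =
      weierstrass_zeta \<tau> (\<tau> / 2) - pi * cot (pi * (\<tau> / 2)) - \<tau> / 2 * pi ^ 2 / 3"
    by (rule sums_unique2)
  moreover have "a 0 = cot (pi * (\<tau> / 2))" by (simp add: a_def)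
  ultimately have *: "weierstrass_zeta \<tau> (\<tau> / 2) = pi * (-\<i> - a 0) -
      4 * pi ^ 2 * \<tau> * ((1 - 3 / pi ^ 2 * eta1 \<tau>) / 24) + pi * a 0 + \<tau> / 2 * pi ^ 2 / 3"
    by (simp only:) (simp only: algebra_simps)
  show ?thesis unfolding eta2_def * by (simp add: field_simps)
qed

section \<open>Transformation under -1/\<tau> and \<tau> + 1\<close>

lemma lattice_pt_inverse:
  assumes "\<tau> \<noteq> 0"
  shows "lattice_pt (-1 / \<tau>) (m, n) = lattice_pt \<tau> (n, -m) / \<tau>"
  using assms by (simp add: lattice_pt_def field_simps)

lemma infsum_lattice_rotate:
  "(\<Sum>\<^sub>\<infinity>p\<in>UNIV - {(0, 0)}. h (case p of (m, n) \<Rightarrow> (n, -m))) = (\<Sum>\<^sub>\<infinity>p\<in>UNIV - {(0::int, 0::int)}. h p)"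
  by (rule infsum_reindex_bij_witness[of _ "\<lambda>(m, n). (-n, m)" "\<lambda>(m, n). (n, -m)"]) auto

lemma g2_S:
  assumes "Im \<tau> > 0"
  shows "g2 (-1 / \<tau>) = \<tau> ^ 4 * g2 \<tau>"
proof -
  have nz: "\<tau> \<noteq> 0" using assms by auto
  have *: "1 / (\<omega> / \<tau>) ^ 4 = \<tau> ^ 4 * (1 / \<omega> ^ 4)" for \<omega>
    by (simp add: power_divide)
  have "(\<Sum>\<^sub>\<infinity>p\<in>UNIV - {(0, 0)}. 1 / lattice_pt (-1 / \<tau>) p ^ 4) =
        (\<Sum>\<^sub>\<infinity>p\<in>UNIV - {(0, 0)}. \<tau> ^ 4 * (1 / lattice_pt \<tau> (case p of (m, n) \<Rightarrow> (n, -m)) ^ 4))"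
    by (intro infsum_cong) (auto simp only: lattice_pt_inverse[OF nz] * split: prod.splits)
  also have "\<dots> = (\<Sum>\<^sub>\<infinity>p\<in>UNIV - {(0, 0)}. \<tau> ^ 4 * (1 / lattice_pt \<tau> p ^ 4))"
    by (rule infsum_lattice_rotate)
  also have "\<dots> = \<tau> ^ 4 * (\<Sum>\<^sub>\<infinity>p\<in>UNIV - {(0, 0)}. (1 / lattice_pt \<tau> p ^ 4))"
    by (rule infsum_cmult_right')
  finally show ?thesis by (simp add: g2_def)
qed

text \<open>The lattices of -1/\<tau> and \<tau> are homothetic with ratio \<tau>, which carries the
  half period 1/2 to \<tau>/2. Hence eta1(-1/\<tau>) = \<tau> eta2(\<tau>), and Legendre's relation
  eliminates eta2.\<close>

lemma eta1_S:
  assumes "Im \<tau> > 0"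
  shows "eta1 (-1 / \<tau>) = \<tau> ^ 2 * eta1 \<tau> - 2 * pi * \<i> * \<tau>"
proof -
  have nz: "\<tau> \<noteq> 0" using assms by auto
  let ?T = "\<lambda>p. 1 / (\<tau> / 2 - lattice_pt \<tau> p) + 1 / lattice_pt \<tau> p + \<tau> / 2 / lattice_pt \<tau> p ^ 2"
  have *: "1 / (1 / 2 - \<omega> / \<tau>) + 1 / (\<omega> / \<tau>) + 1 / 2 / (\<omega> / \<tau>) ^ 2 =
           \<tau> * (1 / (\<tau> / 2 - \<omega>) + 1 / \<omega> + \<tau> / 2 / \<omega> ^ 2)" for \<omega>
  proof -
    have "1 / (1 / 2 - \<omega> / \<tau>) = \<tau> * (1 / (\<tau> / 2 - \<omega>))"
    proof -
      have "1 / 2 - \<omega> / \<tau> = (\<tau> / 2 - \<omega>) / \<tau>" using nz by (simp add: field_simps)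
      thus ?thesis by simp
    qed
    thus ?thesis by (simp add: algebra_simps power2_eq_square)
  qed
  have "(\<Sum>\<^sub>\<infinity>p\<in>UNIV - {(0, 0)}. 1 / (1 / 2 - lattice_pt (-1 / \<tau>) p) + 1 / lattice_pt (-1 / \<tau>) p
            + 1 / 2 / lattice_pt (-1 / \<tau>) p ^ 2) =
        (\<Sum>\<^sub>\<infinity>p\<in>UNIV - {(0, 0)}. \<tau> * ?T (case p of (m, n) \<Rightarrow> (n, -m)))"
    by (intro infsum_cong) (auto simp only: lattice_pt_inverse[OF nz] * split: prod.splits)
  also have "\<dots> = (\<Sum>\<^sub>\<infinity>p\<in>UNIV - {(0, 0)}. \<tau> * ?T p)"
    by (rule infsum_lattice_rotate)
  also have "\<dots> = \<tau> * (\<Sum>\<^sub>\<infinity>p\<in>UNIV - {(0, 0)}. ?T p)"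
    by (rule infsum_cmult_right')
  finally have "weierstrass_zeta (-1 / \<tau>) (1 / 2) = \<tau> * weierstrass_zeta \<tau> (\<tau> / 2)"
    unfolding weierstrass_zeta_def using nz by (simp add: distrib_left)
  hence "eta1 (-1 / \<tau>) = \<tau> * eta2 \<tau>" by (simp add: eta1_def eta2_def)
  thus ?thesis by (simp add: legendre_relation[OF assms] algebra_simps power2_eq_square)
qed

lemma exp_2pi_i_of_nat_shift:
  "exp (2 * pi * \<i> * (of_nat n * (\<tau> + 1))) = exp (2 * pi * \<i> * (of_nat n * \<tau>))"
proof -
  have "2 * pi * \<i> * (of_nat n * (\<tau> + 1)) = 2 * pi * \<i> * (of_nat n * \<tau>) + (2 * of_nat n * pi) * \<i>"
    by (simp add: algebra_simps)
  moreover have "exp ((2 * of_nat n * pi) * \<i>) = 1" by (rule exp_integer_2pi) simp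
  ultimately show ?thesis by (simp only: exp_add) simp
qed

text \<open>Periodicity is read off from the expansion in exp(2 pi i \<tau>), so no reindexing of
  the lattice sum is needed.\<close>

lemma eta1_T:
  assumes "Im \<tau> > 0"
  shows "eta1 (\<tau> + 1) = eta1 \<tau>"
  using sums_unique2[OF eta1_sums[OF assms]] eta1_sums[of "\<tau> + 1"] assms
  unfolding exp_2pi_i_of_nat_shift by fastforce

lemma g2_T:
  assumes "Im \<tau> > 0"
  shows "g2 (\<tau> + 1) = g2 \<tau>"
  using sums_unique2[OF g2_sums[OF assms]] g2_sums[of "\<tau> + 1"] assms
  unfolding exp_2pi_i_of_nat_shift by fastforce

section \<open>Fourier expansions\<close>

text \<open>Each further factor n comes from termwise differentiation, which preserves convergence
  inside the unit disc.\<close>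

lemma summable_power_mult_geometric:
  fixes x :: "'a :: {real_normed_field, banach}"
  assumes "norm x < 1"
  shows "summable (\<lambda>n. of_nat n ^ k * x ^ n)"
  using assms
proof (induction k arbitrary: x)
  case (Suc k)
  have "summable (\<lambda>n. diffs (\<lambda>n. of_nat n ^ k) n * x ^ n)"
    by (rule termdiff_converges[of _ 1]) (use Suc in auto)
  hence "summable (\<lambda>n. of_nat (Suc n) ^ Suc k * x ^ n)"
    by (simp add: diffs_def)
  from summable_mult[OF this, of x]
  have "summable (\<lambda>n. of_nat (Suc n) ^ Suc k * x ^ Suc n)"
    by (simp only: power_Suc mult_ac)
  thus ?case by (subst (asm) summable_Suc_iff)
qed simp

text \<open>Write S k for the sum of n^k X^n. Shifting n to n + 1 and expanding (n + 1)^k binomially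
  expresses (1 - X) S k by S 0, ..., S (k - 1).\<close>

lemma lambert_sums:
  assumes "norm X < 1"
  shows "(\<lambda>n. of_nat n ^ 1 * X ^ n) sums lambert1 X"
    and "(\<lambda>n. of_nat n ^ 3 * X ^ n) sums lambert3 X"
proof -
  define S where "S = (\<lambda>k. \<Sum>n. of_nat n ^ k * X ^ n)"
  have S: "(\<lambda>n. of_nat n ^ k * X ^ n) sums S k" for k
    using summable_power_mult_geometric[OF assms, of k] by (simp add: S_def summable_sums)
  have X1: "1 - X \<noteq> 0" using assms by auto
  have S0: "S 0 = 1 / (1 - X)"
    using S[of 0] geometric_sums[OF assms] by (simp add: sums_unique2)
  have shift: "(\<lambda>n. of_nat (Suc n) ^ Suc k * X ^ Suc n) sums S (Suc k)" for k
    using S[of "Suc k"] by (subst sums_Suc_iff) simp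
  have "(\<lambda>n. X * (of_nat n ^ 1 * X ^ n + of_nat n ^ 0 * X ^ n)) sums (X * (S 1 + S 0))"
    by (intro sums_mult sums_add S)
  also have "(\<lambda>n. X * (of_nat n ^ 1 * X ^ n + of_nat n ^ 0 * X ^ n)) =
             (\<lambda>n. of_nat (Suc n) ^ Suc 0 * X ^ Suc n)"
    by (simp add: fun_eq_iff algebra_simps)
  finally have "S 1 = X * (S 1 + S 0)" using shift[of 0] sums_unique2 by fastforce
  hence "(1 - X) * S 1 = X * S 0" by (simp add: algebra_simps)
  hence "S 1 = X * S 0 / (1 - X)" using X1 by (metis nonzero_mult_div_cancel_left)
  hence S1: "S 1 = X / (1 - X) ^ 2" by (simp add: S0 power2_eq_square)
  have "(\<lambda>n. X * (of_nat n ^ 2 * X ^ n + 2 * (of_nat n ^ 1 * X ^ n) + of_nat n ^ 0 * X ^ n)) sums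
          (X * (S 2 + 2 * S 1 + S 0))"
    by (intro sums_mult sums_add S)
  also have "(\<lambda>n. X * (of_nat n ^ 2 * X ^ n + 2 * (of_nat n ^ 1 * X ^ n) + of_nat n ^ 0 * X ^ n)) =
             (\<lambda>n. of_nat (Suc n) ^ Suc 1 * X ^ Suc n)"
    by (simp add: fun_eq_iff algebra_simps power2_eq_square)
  finally have "S 2 = X * (S 2 + 2 * S 1 + S 0)"
    using shift[of 1] sums_unique2 unfolding Suc_1 by blast
  hence "(1 - X) * S 2 = X * (2 * S 1 + S 0)" by (simp add: algebra_simps)
  hence S2: "S 2 = X * (2 * S 1 + S 0) / (1 - X)" using X1 by (metis nonzero_mult_div_cancel_left)
  have "(\<lambda>n. X * (of_nat n ^ 3 * X ^ n + 3 * (of_nat n ^ 2 * X ^ n) + 3 * (of_nat n ^ 1 * X ^ n)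
              + of_nat n ^ 0 * X ^ n)) sums (X * (S 3 + 3 * S 2 + 3 * S 1 + S 0))"
    by (intro sums_mult sums_add S)
  also have "(\<lambda>n. X * (of_nat n ^ 3 * X ^ n + 3 * (of_nat n ^ 2 * X ^ n) + 3 * (of_nat n ^ 1 * X ^ n)
              + of_nat n ^ 0 * X ^ n)) = (\<lambda>n. of_nat (Suc n) ^ Suc 2 * X ^ Suc n)"
    by (simp add: fun_eq_iff algebra_simps power2_eq_square power3_eq_cube)
  finally have "S 3 = X * (S 3 + 3 * S 2 + 3 * S 1 + S 0)"
    using shift[of 2] sums_unique2 by fastforce
  hence "(1 - X) * S 3 = X * (3 * S 2 + 3 * S 1 + S 0)" by (simp add: algebra_simps)
  hence S3: "S 3 = X * (3 * S 2 + 3 * S 1 + S 0) / (1 - X)" using X1 by (metis nonzero_mult_div_cancel_left)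
  show "(\<lambda>n. of_nat n ^ 1 * X ^ n) sums lambert1 X"
    using S[of 1] unfolding S1 lambert1_def .
  have "X * (3 * (X * (2 * ((1 - Y) / Y ^ 2) + 1 / Y) / Y) + 3 * ((1 - Y) / Y ^ 2) + 1 / Y) / Y =
        X * (1 + 4 * (1 - Y) + (1 - Y) ^ 2) / Y ^ 4" if "Y \<noteq> 0" "X = 1 - Y" for Y
    using that(1) unfolding that(2)
    by (simp add: divide_simps) (simp add: algebra_simps eval_nat_numeral)
  from this[of "1 - X"] X1 have "S 3 = lambert3 X"
    unfolding S3 S2 S1 S0 lambert3_def by simp
  thus "(\<lambda>n. of_nat n ^ 3 * X ^ n) sums lambert3 X"
    using S[of 3] by simp
qed

definition divisor_sum :: "nat \<Rightarrow> nat \<Rightarrow> nat" where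
  "divisor_sum k n = (\<Sum>d | d dvd n. d ^ k)"

lemma divisor_sum_le:
  assumes "n > 0"
  shows "divisor_sum k n \<le> n ^ Suc k"
proof -
  have "divisor_sum k n \<le> (\<Sum>d | d dvd n. n ^ k)"
    unfolding divisor_sum_def using assms by (intro sum_mono power_mono) (auto dest: dvd_imp_le)
  also have "\<dots> = card {d. d dvd n} * n ^ k" by simp
  also have "{d. d dvd n} \<subseteq> {1..n}" using assms by (auto dest: dvd_imp_le intro: Nat.gr0I)
  hence "card {d. d dvd n} \<le> n" using card_mono[of "{1..n}"] by simp
  hence "card {d. d dvd n} * n ^ k \<le> n * n ^ k" by simp
  finally show ?thesis by simp
qed

text \<open>The part without constant term of the q-expansion of E_2 (k = 1) and of E_4 (k = 3), up
  to the factors -24 and 240.\<close>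

definition eis_series :: "nat \<Rightarrow> complex \<Rightarrow> complex" where
  "eis_series k q = (\<Sum>n. of_nat (divisor_sum k (Suc n)) * q ^ Suc n)"

text \<open>Both series are sums of d^k q^(md) over m, d \<ge> 1: collected by m they give the
  Lambert series, collected by n = md the divisor sums. Absolute convergence permits the
  exchange.\<close>

lemma lambert_series_regroup:
  fixes q :: complex
  assumes q: "norm q < 1" and k: "k > 0"
    and L: "\<And>X. norm X < 1 \<Longrightarrow> (\<lambda>n. of_nat n ^ k * X ^ n) sums L X"
  shows "(\<lambda>m. L (q ^ Suc m)) sums eis_series k q"
proof -
  define r where "r = norm q"
  have r: "0 \<le> r" "r < 1" using q by (auto simp: r_def)
  define f where "f = (\<lambda>(m, d). of_nat d ^ k * q ^ (m * d))"
  define A where "A = ({1..} :: nat set)"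
  have A: "A = Suc ` UNIV" by (auto simp: A_def image_iff) (metis Suc_le_D)
  define h where "h = (\<lambda>d. of_nat d ^ k * r ^ d :: real)"
  have h: "h summable_on A"
  proof -
    have "summable h" unfolding h_def by (rule summable_power_mult_geometric) (use r in auto)
    hence "h summable_on UNIV" using r by (simp add: summable_on_UNIV_nonneg_real_iff h_def)
    thus ?thesis by (rule summable_on_subset_banach) auto
  qed
  have g: "(\<lambda>m. r ^ (m - 1)) summable_on A"
  proof -
    have "summable (\<lambda>n. r ^ n)" using r by (intro summable_geometric) auto
    hence "(\<lambda>n. r ^ n) summable_on UNIV" using r by (simp add: summable_on_UNIV_nonneg_real_iff)
    thus ?thesis unfolding A by (subst summable_on_reindex) (auto simp: o_def)
  qed
  have "(\<lambda>p. r ^ (fst p - 1) * h (snd p)) summable_on (A \<times> A)"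
  proof (rule summable_on_SigmaI)
    show "((\<lambda>y. r ^ (fst (x, y) - 1) * h (snd (x, y))) has_sum (r ^ (x - 1) * infsum h A)) A" for x
      using h by (auto intro!: has_sum_cmult_right)
    show "(\<lambda>x. r ^ (x - 1) * infsum h A) summable_on A"
      using g by (rule summable_on_cmult_left)
  qed (use r in \<open>auto simp: h_def\<close>)
  hence "(\<lambda>p. norm (f p)) summable_on (A \<times> A)"
  proof (rule summable_on_comparison_test)
    fix p assume "p \<in> A \<times> A"
    then obtain m d where p: "p = (m, d)" "m \<ge> 1" "d \<ge> 1" by (auto simp: A_def)
    \<comment> \<open>This replaces the mixed exponent by a sum, so that the majorant is a product
      of two convergent single series.\<close>
    have "m - 1 + d \<le> m * d"
    proof -
      obtain m' where "m = Suc m'" using p(2) by (cases m) auto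
      thus ?thesis using p(3) by simp
    qed
    hence "r ^ (m * d) \<le> r ^ (m - 1 + d)" using r by (intro power_decreasing) auto
    thus "norm (f p) \<le> r ^ (fst p - 1) * h (snd p)"
      using mult_left_mono[of "r ^ (m * d)" "r ^ (m - 1 + d)" "of_nat d ^ k"]
      by (simp add: p f_def h_def norm_mult norm_power r_def power_add mult_ac)
  qed auto
  hence "f summable_on (A \<times> A)" by (rule abs_summable_summable)
  then obtain S where S: "(f has_sum S) (A \<times> A)" by (auto simp: summable_on_def)

  have to_sums: "(\<lambda>n. u (Suc n)) sums S" if "(u has_sum S) A" for u :: "nat \<Rightarrow> complex"
    using that unfolding A by (subst (asm) has_sum_reindex) (auto simp: o_def intro: has_sum_imp_sums)

  have "((\<lambda>m. L (q ^ m)) has_sum S) A"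
  proof (rule has_sum_SigmaD[OF S])
    fix m assume m: "m \<in> A"
    have "norm (q ^ m) < 1"
      using q m power_Suc_less_one[of "norm q" "m - 1"] by (auto simp: A_def norm_power power_less_one_iff)
    note L = L[OF this]
    have "summable (\<lambda>n. norm (of_nat n ^ k * (q ^ m) ^ n))"
      using summable_power_mult_geometric[of "norm (q ^ m)" k] \<open>norm (q ^ m) < 1\<close>
      by (simp add: norm_mult norm_power)
    hence "((\<lambda>n. of_nat n ^ k * (q ^ m) ^ n) has_sum L (q ^ m)) UNIV"
      using L by (rule norm_summable_imp_has_sum)
    \<comment> \<open>The index 0 may be dropped because \<open>0 ^ k = 0\<close> for
      \<open>k > 0\<close>.\<close>
    also have "?this \<longleftrightarrow> ((\<lambda>d. f (m, d)) has_sum L (q ^ m)) A"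
      by (rule has_sum_cong_neutral) (use k in \<open>auto simp: A_def f_def power_mult not_le\<close>)
    finally show "((\<lambda>d. f (m, d)) has_sum L (q ^ m)) A" .
  qed
  hence 1: "(\<lambda>m. L (q ^ Suc m)) sums S" by (rule to_sums)

  have "((\<lambda>(n, d). of_nat d ^ k * q ^ n) has_sum S) (Sigma A (\<lambda>n. {d. d dvd n}))"
    using S
    by (subst has_sum_reindex_bij_witness[of _ "\<lambda>(m, d). (m * d, d)" "\<lambda>(n, d). (n div d, d)" "A \<times> A"])
       (auto simp: A_def f_def intro!: Suc_leI Nat.gr0I dest: dvd_imp_le)
  hence "((\<lambda>n. of_nat (divisor_sum k n) * q ^ n) has_sum S) A"
  proof (rule has_sum_SigmaD)
    fix n assume "n \<in> A"
    hence "finite {d. d dvd n}" by (auto simp: A_def)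
    from has_sum_finite[OF this, of "\<lambda>d. of_nat d ^ k * q ^ n"]
    show "((\<lambda>d. case (n, d) of (n, d) \<Rightarrow> of_nat d ^ k * q ^ n) has_sum of_nat (divisor_sum k n) * q ^ n) {d. d dvd n}"
      by (simp add: divisor_sum_def sum_distrib_right)
  qed
  hence "(\<lambda>n. of_nat (divisor_sum k (Suc n)) * q ^ Suc n) sums S" by (rule to_sums)
  hence "eis_series k q = S" unfolding eis_series_def by (simp only: sums_iff)
  thus ?thesis using 1 by simp
qed

lemma summable_eis_series:
  fixes q :: "'a :: {real_normed_field, banach}"
  assumes "norm q < 1"
  shows "summable (\<lambda>n. of_nat (divisor_sum k (Suc n)) * q ^ n)"
proof (rule summable_comparison_test')
  have "summable (\<lambda>n. real n ^ Suc k * norm q ^ n)"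
    by (rule summable_power_mult_geometric) (use assms in auto)
  hence s: "summable (\<lambda>n. real (Suc n) ^ Suc k * norm q ^ Suc n)"
    by (subst summable_Suc_iff)
  show "summable (\<lambda>n. real (Suc n) ^ Suc k * norm q ^ n)"
  proof (cases "q = 0")
    case True
    thus ?thesis by (intro summable_finite[of "{0}"]) auto
  next
    case False
    have "summable (\<lambda>n. norm q * (real (Suc n) ^ Suc k * norm q ^ n))"
      using s by (simp only: power_Suc[of "norm q"] mult.left_commute)
    thus ?thesis using False by (subst (asm) summable_cmult_iff) auto
  qed
  show "norm (of_nat (divisor_sum k (Suc n)) * q ^ n) \<le> real (Suc n) ^ Suc k * norm q ^ n" for n
    unfolding norm_mult norm_of_nat norm_power
    by (intro mult_right_mono) (use divisor_sum_le[of "Suc n" k] in \<open>auto simp flip: of_nat_power simp del: of_nat_Suc power_Suc\<close>)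
qed

lemma eis_series_holomorphic: "eis_series k holomorphic_on ball 0 1"
proof -
  define F where "F = (\<lambda>q::complex. \<Sum>n. of_nat (divisor_sum k (Suc n)) * q ^ n)"
  have "F holomorphic_on ball 0 1"
    by (rule power_series_holomorphic[of 0 1 "\<lambda>n. of_nat (divisor_sum k (Suc n))"])
       (use summable_eis_series in \<open>auto simp: F_def summable_sums\<close>)
  hence "(\<lambda>q. q * F q) holomorphic_on ball 0 1" by (intro holomorphic_intros)
  thus ?thesis
  proof (rule holomorphic_transform)
    fix q :: complex assume "q \<in> ball 0 1"
    hence "summable (\<lambda>n. of_nat (divisor_sum k (Suc n)) * q ^ n)" by (intro summable_eis_series) auto
    from suminf_mult[OF this, of q] show "q * F q = eis_series k q"
      by (simp add: F_def eis_series_def mult_ac)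
  qed
qed

section \<open>Eisenstein series near q = 0\<close>

lemma norm_power_diff_le:
  fixes x y :: complex
  assumes "norm x \<le> r" "norm y \<le> r"
  shows "norm (x ^ Suc n - y ^ Suc n) \<le> of_nat (Suc n) * r ^ n * norm (x - y)"
proof -
  have "x ^ Suc n - y ^ Suc n = (x - y) * (\<Sum>p<Suc n. x ^ p * y ^ (n - p))"
    by (rule diff_power_eq_sum)
  also have "norm \<dots> \<le> norm (x - y) * (\<Sum>p<Suc n. r ^ n)"
    unfolding norm_mult
  proof (intro mult_left_mono order.trans[OF norm_sum] sum_mono)
    fix p assume "p \<in> {..<Suc n}"
    hence "r ^ p * r ^ (n - p) = r ^ n" by (simp flip: power_add)
    moreover have "norm (x ^ p * y ^ (n - p)) \<le> r ^ p * r ^ (n - p)"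
      unfolding norm_mult norm_power using assms order.trans[OF norm_ge_zero assms(1)]
      by (intro mult_mono power_mono) auto
    ultimately show "norm (x ^ p * y ^ (n - p)) \<le> r ^ n" by simp
  qed auto
  finally show ?thesis by (simp add: mult_ac)
qed

text \<open>Successive ratios are at most (3/2)^5 = 243/32 < 8, starting from 2^5 = 32.\<close>

lemma power5_le: "real (Suc (Suc n)) ^ 5 \<le> 32 * 8 ^ n"
proof (induction n)
  case (Suc n)
  have "real (Suc (Suc (Suc n))) \<le> 3 / 2 * real (Suc (Suc n))" by simp
  hence "real (Suc (Suc (Suc n))) ^ 5 \<le> (3 / 2 * real (Suc (Suc n))) ^ 5"
    by (intro power_mono) auto
  also have "\<dots> = 243 / 32 * real (Suc (Suc n)) ^ 5"
    unfolding power_mult_distrib by (simp add: power_divide)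
  also have "\<dots> \<le> 8 * (32 * 8 ^ n)" using Suc.IH by (intro mult_mono) auto
  finally show ?case by simp
qed simp

text \<open>On this disc the series is a small perturbation of q. It yields size bounds,
  injectivity, and a nonzero derivative. The coefficient of degree n + 2 is at most (n+2)^4, and the
  difference of powers supplies one more factor n + 2, hence the fifth power. With
  \<open>power5_le\<close> the tail is geometric with ratio 8/100, and 32/100 divided by 92/100 is
  below 1/2.\<close>

lemma eis_series_lipschitz:
  assumes "norm x \<le> 1 / 100" "norm y \<le> 1 / 100" "k \<le> 3"
  shows "norm (eis_series k x - eis_series k y - (x - y)) \<le> norm (x - y) / 2"
proof -
  let ?a = "\<lambda>n. of_nat (divisor_sum k (Suc n)) :: complex"
  define r where "r = (1 / 100 :: real)"
  have sums: "(\<lambda>n. ?a n * z ^ Suc n) sums eis_series k z" if "norm z \<le> 1 / 100" for z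
    using summable_mult[OF summable_eis_series[of z k], of z] that
    unfolding eis_series_def by (simp add: summable_sums mult_ac)
  have "(\<lambda>n. ?a n * x ^ Suc n - ?a n * y ^ Suc n) sums (eis_series k x - eis_series k y)"
    by (intro sums_diff sums assms)
  hence "(\<lambda>n. ?a (Suc n) * x ^ Suc (Suc n) - ?a (Suc n) * y ^ Suc (Suc n)) sums
           (eis_series k x - eis_series k y - (x - y))"
    by (subst sums_Suc_iff) (simp add: divisor_sum_def)
  moreover have "(\<lambda>n. 32 * r * norm (x - y) * (8 / 100) ^ n) sums (32 * r * norm (x - y) * (1 / (1 - 8 / 100)))"
    by (intro sums_mult geometric_sums) auto
  moreover have "norm (?a (Suc n) * x ^ Suc (Suc n) - ?a (Suc n) * y ^ Suc (Suc n))
                   \<le> 32 * r * norm (x - y) * (8 / 100) ^ n" for n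
  proof -
    have "norm (?a (Suc n) * x ^ Suc (Suc n) - ?a (Suc n) * y ^ Suc (Suc n)) =
            real (divisor_sum k (Suc (Suc n))) * norm (x ^ Suc (Suc n) - y ^ Suc (Suc n))"
      by (simp only: right_diff_distrib [symmetric] norm_mult norm_of_nat)
    also have "\<dots> \<le> real (Suc (Suc n)) ^ 4 * (real (Suc (Suc n)) * r ^ Suc n * norm (x - y))"
    proof (intro mult_mono norm_power_diff_le)
      have "divisor_sum k (Suc (Suc n)) \<le> Suc (Suc n) ^ Suc k" by (rule divisor_sum_le) simp
      also have "\<dots> \<le> Suc (Suc n) ^ 4" using assms(3) by (intro power_increasing) auto
      finally show "real (divisor_sum k (Suc (Suc n))) \<le> real (Suc (Suc n)) ^ 4"
        by (metis of_nat_le_iff of_nat_power)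
    qed (use assms in \<open>auto simp: r_def\<close>)
    also have "\<dots> = real (Suc (Suc n)) ^ 5 * r ^ Suc n * norm (x - y)"
      by (simp add: eval_nat_numeral)
    also have "\<dots> \<le> 32 * 8 ^ n * r ^ Suc n * norm (x - y)"
      by (intro mult_right_mono power5_le) (auto simp: r_def)
    also have "\<dots> = 32 * r * norm (x - y) * (8 / 100) ^ n"
    proof -
      have "(8 / 100 :: real) ^ n = 8 ^ n * r ^ n"
        unfolding power_mult_distrib [symmetric] by (simp add: r_def)
      thus ?thesis by (simp only: power_Suc mult_ac)
    qed
    finally show ?thesis .
  qed
  ultimately have "norm (eis_series k x - eis_series k y - (x - y)) \<le> 32 * r * norm (x - y) * (1 / (1 - 8 / 100))"
    by (metis (no_types, lifting) norm_suminf_le sums_iff sums_unique)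
  also have "\<dots> \<le> norm (x - y) / 2" by (simp add: r_def)
  finally show ?thesis .
qed

definition nome :: "complex \<Rightarrow> complex" where
  "nome \<tau> = exp (2 * pi * \<i> * \<tau>)"

lemma norm_nome: "norm (nome \<tau>) = exp (- 2 * pi * Im \<tau>)"
  by (simp add: nome_def)

lemma norm_nome_less_1: "Im \<tau> > 0 \<Longrightarrow> norm (nome \<tau>) < 1"
  by (simp add: norm_nome)

lemma exp_eq_nome_power: "exp (2 * pi * \<i> * (of_nat n * \<tau>)) = nome \<tau> ^ n"
  by (simp add: nome_def exp_of_nat_mult [symmetric] mult_ac)

theorem eta1_fourier:
  assumes "Im \<tau> > 0"
  shows "eta1 \<tau> = pi ^ 2 / 3 * (1 - 24 * eis_series 1 (nome \<tau>))"
proof -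
  have "(\<lambda>m. lambert1 (nome \<tau> ^ Suc m)) sums eis_series 1 (nome \<tau>)"
    by (rule lambert_series_regroup) (use lambert_sums norm_nome_less_1[OF assms] in auto)
  with eta1_sums[OF assms] have "eis_series 1 (nome \<tau>) = (1 - 3 / pi ^ 2 * eta1 \<tau>) / 24"
    unfolding exp_eq_nome_power using sums_unique2 by blast
  thus ?thesis by (simp add: field_simps)
qed

theorem g2_fourier:
  assumes "Im \<tau> > 0"
  shows "g2 \<tau> / 12 = pi ^ 4 / 9 * (1 + 240 * eis_series 3 (nome \<tau>))"
proof -
  have "(\<lambda>m. lambert3 (nome \<tau> ^ Suc m)) sums eis_series 3 (nome \<tau>)"
    by (rule lambert_series_regroup) (use lambert_sums norm_nome_less_1[OF assms] in auto)
  with g2_sums[OF assms] have "eis_series 3 (nome \<tau>) = (9 / pi ^ 4 * (g2 \<tau> / 12) - 1) / 240"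
    unfolding exp_eq_nome_power using sums_unique2 by blast
  thus ?thesis by (simp add: field_simps)
qed

section \<open>Zero counting under homotopy\<close>

text \<open>The general Rouche theorem weights the zeros in an open set by winding numbers. For a
  circle these are 1 inside and 0 outside, so the zeros between the radii r and R drop out.\<close>

lemma Rouche_disc:
  fixes f g :: "complex \<Rightarrow> complex"
  assumes r: "0 < r" "r < R"
    and holo: "f holomorphic_on ball z R" "g holomorphic_on ball z R"
    and fin: "finite {p \<in> ball z R. f p = 0}" "finite {p \<in> ball z R. f p + g p = 0}"
    and less: "\<And>w. w \<in> sphere z r \<Longrightarrow> norm (g w) < norm (f w)"
  shows "(\<Sum>p | p \<in> ball z r \<and> f p + g p = 0. zorder (\<lambda>w. f w + g w) p) =
         (\<Sum>p | p \<in> ball z r \<and> f p = 0. zorder f p)"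
proof -
  have wn: "winding_number (circlepath z r) p = (if p \<in> ball z r then 1 else 0)"
    if "p \<notin> sphere z r" for p
  proof (cases "p \<in> ball z r")
    case True
    thus ?thesis by (simp add: winding_number_circlepath dist_norm norm_minus_commute)
  next
    case False
    hence "p \<notin> cball z r" using that by auto
    thus ?thesis
      using False r winding_number_zero_outside[of "circlepath z r" "cball z r" p] by simp
  qed
  have red: "(\<Sum>p\<in>{p \<in> ball z R. h p = 0}. winding_number (circlepath z r) p * zorder h p) =
             of_int (\<Sum>p | p \<in> ball z r \<and> h p = 0. zorder h p)"
    if "finite {p \<in> ball z R. h p = 0}" "\<And>w. w \<in> sphere z r \<Longrightarrow> h w \<noteq> 0" for h
  proof -
    have "(\<Sum>p\<in>{p \<in> ball z R. h p = 0}. winding_number (circlepath z r) p * zorder h p) =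
          (\<Sum>p\<in>{p. p \<in> ball z r \<and> h p = 0}. winding_number (circlepath z r) p * zorder h p)"
    proof (rule sum.mono_neutral_right[OF that(1)])
      show "{p. p \<in> ball z r \<and> h p = 0} \<subseteq> {p \<in> ball z R. h p = 0}" using r by auto
      show "\<forall>i\<in>{p \<in> ball z R. h p = 0} - {p. p \<in> ball z r \<and> h p = 0}.
              winding_number (circlepath z r) i * zorder h i = 0"
      proof
        fix p assume p: "p \<in> {p \<in> ball z R. h p = 0} - {p. p \<in> ball z r \<and> h p = 0}"
        hence "p \<notin> sphere z r" "p \<notin> ball z r" using that(2) by blast+
        thus "winding_number (circlepath z r) p * zorder h p = 0" using wn by simp
      qed
    qed
    also have "\<dots> = (\<Sum>p\<in>{p. p \<in> ball z r \<and> h p = 0}. of_int (zorder h p))"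
      by (intro sum.cong refl) (use wn that(2) in auto)
    finally show ?thesis by simp
  qed
  have nz: "f w \<noteq> 0" "f w + g w \<noteq> 0" if "w \<in> sphere z r" for w
  proof -
    show "f w \<noteq> 0" using less[OF that] by auto
    show "f w + g w \<noteq> 0" using less[OF that] by (metis add_eq_0_iff norm_minus_cancel order_less_irrefl)
  qed
  have "(\<Sum>p\<in>{p \<in> ball z R. f p + g p = 0}. winding_number (circlepath z r) p * zorder (\<lambda>p. f p + g p) p)
      = (\<Sum>p\<in>{p \<in> ball z R. f p = 0}. winding_number (circlepath z r) p * zorder f p)"
  proof (rule Rouche_theorem)
    show "\<forall>w. w \<notin> ball z R \<longrightarrow> winding_number (circlepath z r) w = 0"
      using wn r by auto
  qed (use assms in auto)
  hence "(of_int (\<Sum>p | p \<in> ball z r \<and> f p + g p = 0. zorder (\<lambda>w. f w + g w) p) :: complex) =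
         of_int (\<Sum>p | p \<in> ball z r \<and> f p = 0. zorder f p)"
    using red[of f] red[of "\<lambda>w. f w + g w"] fin nz by simp
  thus ?thesis by (simp only: of_int_eq_iff)
qed

text \<open>Enclose each zero of the function at s in a small disc. On the rest of K the function is
  bounded away from 0, so for t near s no zero arises there, and Rouche's theorem preserves the
  count in every disc. Only circles are used as contours, so U may have any shape.\<close>

lemma zorder_sum_locally_constant:
  fixes a b :: "complex \<Rightarrow> complex"
  assumes W: "open W" "connected W" and holo: "a holomorphic_on W" "b holomorphic_on W"
    and UK: "open U" "U \<subseteq> K" "compact K" "K \<subseteq> W" "K - U \<noteq> {}"
    and s: "s \<in> T" and nz: "\<And>t z. t \<in> T \<Longrightarrow> z \<in> K - U \<Longrightarrow> b z - of_real t * a z \<noteq> 0"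
  defines "N \<equiv> \<lambda>t. \<Sum>p | p \<in> U \<and> b p - of_real t * a p = 0. zorder (\<lambda>z. b z - of_real t * a z) p"
  shows "eventually (\<lambda>t. N s = N t) (at s within T)"
proof -
  define f where "f = (\<lambda>t z. b z - of_real t * a z)"
  have holo_f: "f t holomorphic_on W" for t
    unfolding f_def by (intro holomorphic_intros holo)
  \<comment> \<open>A point of K - U is not a zero, so the function does not vanish identically and
    its zeros in the compact set K are finite in number.\<close>
  have finK: "finite {p \<in> K. f t p = 0}" if "t \<in> T" for t
  proof (cases "f t constant_on W")
    case True
    from UK obtain w where "w \<in> K - U" by auto
    hence "f t w \<noteq> 0" "w \<in> W" using nz[OF that] UK by (auto simp: f_def)
    hence "{p \<in> K. f t p = 0} = {}" using True UK unfolding constant_on_def by fastforce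
    thus ?thesis by (simp only: finite.emptyI)
  next
    case False
    thus ?thesis using holomorphic_compact_finite_zeros[OF holo_f W UK(3,4)] by blast
  qed
  define Z where "Z = {p \<in> U. f s p = 0}"
  have ZK: "Z = {p \<in> K. f s p = 0}" using UK nz[OF s] by (auto simp: Z_def f_def)
  have Z: "finite Z" "Z \<subseteq> U" using finK[OF s] by (simp add: ZK) (auto simp: Z_def)
  have "\<exists>e>0. cball z e \<subseteq> U \<and> (\<forall>w\<in>Z. w \<noteq> z \<longrightarrow> e < dist z w)" if z: "z \<in> Z" for z
  proof -
    obtain e1 where e1: "e1 > 0" "cball z e1 \<subseteq> U"
      using UK(1) subsetD[OF Z(2) z] unfolding open_contains_cball by metis
    obtain e2 where e2: "e2 > 0" "\<forall>w\<in>Z. w \<noteq> z \<longrightarrow> e2 \<le> dist z w"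
      using finite_set_avoid[OF Z(1), of z] by metis
    show ?thesis
      using e1 e2 by (intro exI[of _ "min e1 (e2 / 2)"]) (auto simp: min_def)
  qed
  then obtain e where e: "\<And>z. z \<in> Z \<Longrightarrow> e z > 0" "\<And>z. z \<in> Z \<Longrightarrow> cball z (e z) \<subseteq> U"
      "\<And>z w. z \<in> Z \<Longrightarrow> w \<in> Z \<Longrightarrow> w \<noteq> z \<Longrightarrow> e z < dist z w"
    by metis
  define d where "d = Min (insert 1 (e ` Z))"
  have d: "d > 0" "\<And>z. z \<in> Z \<Longrightarrow> d \<le> e z" using Z(1) e(1) by (auto simp: d_def)
  \<comment> \<open>Halving leaves room for the larger ball that \<open>Rouche_disc\<close>
    requires, and it keeps the discs of radius r disjoint.\<close>
  define r where "r = d / 2"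
  have r: "0 < r" "r < d" using d by (auto simp: r_def)
  have sub: "cball z d \<subseteq> U" if "z \<in> Z" for z
    using e(2)[OF that] d(2)[OF that] by force
  have far: "dist z w > 2 * r" if "z \<in> Z" "w \<in> Z" "w \<noteq> z" for z w
    using e(3)[OF that] d(2)[OF that(1)] by (simp add: r_def)
  define K' where "K' = K - (\<Union>z\<in>Z. ball z r)"
  have K': "compact K'" unfolding K'_def by (intro compact_diff UK open_UN ballI open_ball)
  have K'W: "K' \<subseteq> W" using UK by (auto simp: K'_def)
  have sphere: "sphere z r \<subseteq> K'" if z: "z \<in> Z" for z
  proof
    fix w assume w: "w \<in> sphere z r"
    hence "w \<in> cball z d" using r by auto
    hence "w \<in> K" using sub[OF z] UK by auto
    moreover have "w \<notin> ball z' r" if z': "z' \<in> Z" for z'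
    proof
      assume "w \<in> ball z' r"
      hence "dist z z' < 2 * r" "z' \<noteq> z"
        using w dist_triangle[of z z' w] by (auto simp: dist_commute)
      thus False using far[OF z z'] by simp
    qed
    ultimately show "w \<in> K'" by (auto simp: K'_def)
  qed
  have nz': "f s z \<noteq> 0" if "z \<in> K'" for z
    using that r by (auto simp: K'_def ZK)
  obtain m where m: "m > 0" "\<And>z. z \<in> K' \<Longrightarrow> m \<le> norm (f s z)"
  proof (cases "K' = {}")
    case False
    have "continuous_on K' (\<lambda>z. norm (f s z))"
      by (intro continuous_intros holomorphic_on_imp_continuous_on
          holomorphic_on_subset[OF holo_f K'W])
    from continuous_attains_inf[OF K' False this] obtain w
      where "w \<in> K'" "\<And>z. z \<in> K' \<Longrightarrow> norm (f s w) \<le> norm (f s z)" by blast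
    thus ?thesis using that[of "norm (f s w)"] nz' by auto
  qed (use that[of 1] in auto)
  have "bounded (a ` K)"
    by (intro compact_imp_bounded compact_continuous_image holomorphic_on_imp_continuous_on
        holomorphic_on_subset[OF holo(1)] UK)
  then obtain B where B: "B > 0" "\<And>z. z \<in> K \<Longrightarrow> norm (a z) \<le> B"
    unfolding bounded_pos by auto
  have close: "norm (of_real (s - t) * a z) < norm (f s z)" if "z \<in> K'" "\<bar>t - s\<bar> < m / B" for t z
  proof -
    have "norm (of_real (s - t) * a z) = \<bar>t - s\<bar> * norm (a z)"
      by (simp only: norm_mult norm_of_real abs_minus_commute)
    also have "\<dots> \<le> \<bar>t - s\<bar> * B" using B(2)[of z] that by (intro mult_left_mono) (auto simp: K'_def)
    also have "\<dots> < m" using that(2) B(1) by (simp add: field_simps)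
    also have "\<dots> \<le> norm (f s z)" using m(2) that by blast
    finally show ?thesis .
  qed
  have ft: "f t = (\<lambda>z. f s z + of_real (s - t) * a z)" for t
    by (auto simp: f_def algebra_simps)
  have "N s = N t" if t: "t \<in> T" "\<bar>t - s\<bar> < m / B" for t
  proof -
    have "f t z \<noteq> 0" if "z \<in> K'" for z
    proof
      assume "f t z = 0"
      hence "f s z = - (of_real (s - t) * a z)" unfolding ft[of t] by (simp only: add_eq_0_iff2)
      hence "norm (f s z) = norm (of_real (s - t) * a z)" by (simp only: norm_minus_cancel)
      thus False using close[OF that t(2)] by simp
    qed
    hence split: "{p. p \<in> U \<and> f t p = 0} = (\<Union>z\<in>Z. {p. p \<in> ball z r \<and> f t p = 0})"
      using UK(2) sub r by (fastforce simp: K'_def)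
    have disc: "(\<Sum>p | p \<in> ball z r \<and> f t p = 0. zorder (f t) p) = zorder (f s) z" if z: "z \<in> Z" for z
    proof -
      have bU: "ball z d \<subseteq> U" using sub[OF z] ball_subset_cball by blast
      have fin: "finite {p \<in> ball z d. f u p = 0}" if "u \<in> T" for u
        by (rule finite_subset[OF _ finK[OF that]]) (use bU UK in auto)
      have "(\<Sum>p | p \<in> ball z r \<and> f t p = 0. zorder (f t) p) =
            (\<Sum>p | p \<in> ball z r \<and> f s p = 0. zorder (f s) p)"
        unfolding ft[of t]
      proof (rule Rouche_disc[OF r])
        show "f s holomorphic_on ball z d" "(\<lambda>p. of_real (s - t) * a p) holomorphic_on ball z d"
          using bU UK by (auto intro!: holomorphic_intros holomorphic_on_subset[OF holo_f]
              holomorphic_on_subset[OF holo(1)])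
        show "finite {p \<in> ball z d. f s p = 0}" by (rule fin[OF s])
        show "finite {p \<in> ball z d. f s p + of_real (s - t) * a p = 0}"
          using fin[OF t(1)] unfolding ft[of t] .
        show "norm (of_real (s - t) * a w) < norm (f s w)" if "w \<in> sphere z r" for w
          using close[OF _ t(2)] sphere[OF z] that by blast
      qed
      also have "{p. p \<in> ball z r \<and> f s p = 0} = {z}"
      proof -
        have "p = z" if "p \<in> ball z r" "f s p = 0" for p
        proof (rule ccontr)
          assume "p \<noteq> z"
          moreover have "p \<in> U" using that(1) r bU by auto
          hence "p \<in> Z" using that by (simp add: Z_def)
          ultimately have "dist z p > 2 * r" using far[OF z] by blast
          thus False using that(1) r by simp
        qed
        thus ?thesis using z r by (auto simp: Z_def)
      qed
      finally show ?thesis by simp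
    qed
    have "N t = (\<Sum>p\<in>(\<Union>z\<in>Z. {p. p \<in> ball z r \<and> f t p = 0}). zorder (f t) p)"
      unfolding N_def split [symmetric] by (simp add: f_def)
    also have "\<dots> = (\<Sum>z\<in>Z. \<Sum>p | p \<in> ball z r \<and> f t p = 0. zorder (f t) p)"
    proof (rule sum.UNION_disjoint)
      show "\<forall>z\<in>Z. finite {p. p \<in> ball z r \<and> f t p = 0}"
      proof
        fix z assume "z \<in> Z"
        hence "{p. p \<in> ball z r \<and> f t p = 0} \<subseteq> {p \<in> K. f t p = 0}"
          using sub[of z] UK r by fastforce
        thus "finite {p. p \<in> ball z r \<and> f t p = 0}" using finK[OF t(1)] finite_subset by blast
      qed
      show "\<forall>z\<in>Z. \<forall>w\<in>Z. z \<noteq> w \<longrightarrow>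
              {p. p \<in> ball z r \<and> f t p = 0} \<inter> {p. p \<in> ball w r \<and> f t p = 0} = {}"
      proof (intro ballI impI)
        fix z w assume zw: "z \<in> Z" "w \<in> Z" "z \<noteq> w"
        have "ball z r \<inter> ball w r = {}"
          using far[of z w] zw by (intro disjoint_ballI) auto
        thus "{p. p \<in> ball z r \<and> f t p = 0} \<inter> {p. p \<in> ball w r \<and> f t p = 0} = {}" by auto
      qed
    qed (use Z in auto)
    also have "\<dots> = (\<Sum>z\<in>Z. zorder (f s) z)" using disc by simp
    also have "\<dots> = N s" unfolding N_def Z_def f_def by simp
    finally show ?thesis by simp
  qed
  thus ?thesis
    unfolding eventually_at using m(1) B(1)
    by (intro exI[of _ "m / B"]) (auto simp: dist_real_def)
qed

lemma zorder_pos_at_zero: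
  assumes "open W" "connected W" "f holomorphic_on W" "z \<in> W" "f z = 0" "w \<in> W" "f w \<noteq> 0"
  shows "zorder f z > 0"
  using zorder_exist_zero[of f W z] assms by auto

text \<open>The total order is locally constant on an interval, hence equal to its value 1 at t = 0.
  All orders are positive, so a total of 1 leaves room for exactly one zero.\<close>

theorem unique_zero_homotopy:
  fixes a b :: "complex \<Rightarrow> complex"
  assumes W: "open W" "connected W" and holo: "a holomorphic_on W" "b holomorphic_on W"
    and UK: "open U" "U \<subseteq> K" "compact K" "K \<subseteq> W" "K - U \<noteq> {}"
    and t0: "0 \<le> t0"
    and nz: "\<And>t z. 0 \<le> t \<Longrightarrow> t \<le> t0 \<Longrightarrow> z \<in> K - U \<Longrightarrow> b z \<noteq> of_real t * a z"
    and simple: "{z \<in> U. b z = 0} = {\<rho>}" "zorder b \<rho> = 1"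
  shows "\<exists>!z. z \<in> U \<and> b z = of_real t0 * a z"
proof -
  define N where "N = (\<lambda>t. \<Sum>p | p \<in> U \<and> b p - of_real t * a p = 0. zorder (\<lambda>z. b z - of_real t * a z) p)"
  have "N 0 = N t0"
  proof (rule connected_local_const[of "{0..t0}"])
    show "\<forall>t\<in>{0..t0}. eventually (\<lambda>t'. N t = N t') (at t within {0..t0})"
      unfolding N_def
      by (intro ballI zorder_sum_locally_constant[OF W holo UK]) (use nz in auto)
  qed (use t0 in auto)
  moreover have "N 0 = (\<Sum>p\<in>{z \<in> U. b z = 0}. zorder b p)" by (simp add: N_def)
  ultimately have N: "N t0 = 1" using simple by simp
  define f where "f = (\<lambda>z. b z - of_real t0 * a z)"
  define Z where "Z = {p. p \<in> U \<and> f p = 0}"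
  have N': "(\<Sum>p\<in>Z. zorder f p) = 1" using N by (simp add: N_def Z_def f_def)
  obtain w where "w \<in> K - U" using UK by auto
  hence w: "w \<in> W" "f w \<noteq> 0" using UK nz[of t0 w] t0 by (auto simp: f_def)
  have pos: "zorder f z \<ge> 1" if "z \<in> Z" for z
  proof -
    have "f holomorphic_on W" unfolding f_def by (intro holomorphic_intros holo)
    hence "zorder f z > 0"
      by (rule zorder_pos_at_zero[where w = w, OF W]) (use that UK w in \<open>auto simp: Z_def\<close>)
    thus ?thesis by simp
  qed
  \<comment> \<open>A sum over an infinite set is 0 by convention, so the value 1 already excludes
    infinitely many zeros.\<close>
  have fin: "finite Z" using N' by (metis sum.infinite zero_neq_one)
  have "int (card Z) \<le> (\<Sum>p\<in>Z. zorder f p)"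
    using sum_mono[of Z "\<lambda>_. 1" "zorder f"] pos by simp
  moreover have "Z \<noteq> {}" using N' by auto
  ultimately have "card Z = 1" using N' fin by (metis One_nat_def card_gt_0_iff le_antisym of_nat_1 of_nat_le_iff Suc_leI)
  then obtain z where "Z = {z}" by (auto simp: card_1_singleton_iff)
  hence "\<And>p. p \<in> U \<and> b p = of_real t0 * a p \<longleftrightarrow> p = z" by (auto simp: Z_def f_def)
  thus ?thesis by (intro ex1I[of _ z]) auto
qed

section \<open>The twisted quasi-period\<close>

abbreviation g2_norm :: "complex \<Rightarrow> complex" where
  "g2_norm \<tau> \<equiv> g2 \<tau> / 12"

text \<open>The real projective parameter $C = p/q$ is given by homogeneous coordinates, so that
  $C = \infty$ is included.\<close>

definition eta_twist :: "real \<Rightarrow> real \<Rightarrow> complex \<Rightarrow> complex" where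
  "eta_twist p q \<tau> = eta1 \<tau> + 2 * pi * \<i> * of_real q / (of_real p - of_real q * \<tau>)"

definition rot :: "complex \<Rightarrow> complex" where
  "rot \<tau> = 1 - 1 / \<tau>"

lemma twist_denom_nonzero:
  assumes "Im \<tau> > 0" "(p, q) \<noteq> (0, 0)"
  shows "of_real p - of_real q * \<tau> \<noteq> 0"
  using assms by (auto simp: complex_eq_iff)

lemma f_C_eq_0_iff:
  assumes "Im \<tau> > 0"
  shows "f_C C \<tau> = 0 \<longleftrightarrow> eta_twist C 1 \<tau> ^ 2 = g2_norm \<tau>"
proof -
  have nz: "of_real C - \<tau> \<noteq> 0" using twist_denom_nonzero[of \<tau> C 1] assms by simp
  have e: "of_real C * eta1 \<tau> - eta2 \<tau> = (of_real C - \<tau>) * eta_twist C 1 \<tau>"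
    using nz by (simp add: eta_twist_def legendre_relation[OF assms] field_simps)
  have "f_C C \<tau> = 12 * (of_real C - \<tau>) ^ 2 * (eta_twist C 1 \<tau> ^ 2 - g2_norm \<tau>)"
    unfolding f_C_def e by (simp add: power_mult_distrib right_diff_distrib)
  thus ?thesis using nz by simp
qed

lemma Im_rot: "Im (rot \<tau>) = Im \<tau> / norm \<tau> ^ 2"
  by (simp add: rot_def Im_divide cmod_power2)

lemma Re_rot: "Re (rot \<tau>) = 1 - Re \<tau> / norm \<tau> ^ 2"
  by (simp add: rot_def Re_divide cmod_power2)

lemma Im_rot_pos: "Im \<tau> > 0 \<Longrightarrow> Im (rot \<tau>) > 0"
  by (auto simp: Im_rot intro!: divide_pos_pos)

lemma eta1_rot:
  assumes "Im \<tau> > 0"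
  shows "eta1 (rot \<tau>) = \<tau> ^ 2 * eta1 \<tau> - 2 * pi * \<i> * \<tau>"
proof -
  have "Im (-1 / \<tau>) > 0" using Im_rot_pos[OF assms] by (simp add: rot_def)
  moreover have "rot \<tau> = -1 / \<tau> + 1" by (simp add: rot_def)
  ultimately show ?thesis using eta1_T[of "-1 / \<tau>"] eta1_S[OF assms] by simp
qed

lemma g2_rot:
  assumes "Im \<tau> > 0"
  shows "g2_norm (rot \<tau>) = \<tau> ^ 4 * g2_norm \<tau>"
proof -
  have "Im (-1 / \<tau>) > 0" using Im_rot_pos[OF assms] by (simp add: rot_def)
  moreover have "rot \<tau> = -1 / \<tau> + 1" by (simp add: rot_def)
  ultimately show ?thesis using g2_T[of "-1 / \<tau>"] g2_S[OF assms] by simp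
qed

text \<open>The pair (p - q, p) represents 1 - q/p, the image of p/q. The pole term absorbs the
  inhomogeneous part -2 pi i \<tau> in the transformation of eta1, so that the twist behaves like a
  form of weight 2 once C moves along with \<tau>.\<close>

lemma eta_twist_rot:
  assumes "Im \<tau> > 0" "(p, q) \<noteq> (0, 0)"
  shows "eta_twist (p - q) p (rot \<tau>) = \<tau> ^ 2 * eta_twist p q \<tau>"
proof -
  have nz: "of_real p - of_real q * \<tau> \<noteq> 0" "\<tau> \<noteq> 0"
    using twist_denom_nonzero[OF assms] assms by auto
  have "of_real (p - q) - of_real p * rot \<tau> = (of_real p - of_real q * \<tau>) / \<tau>"
    using nz by (simp add: rot_def field_simps)
  hence "eta_twist (p - q) p (rot \<tau>) =
           \<tau> ^ 2 * eta1 \<tau> - 2 * pi * \<i> * \<tau> + 2 * pi * \<i> * of_real p * \<tau> / (of_real p - of_real q * \<tau>)"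
    by (simp add: eta_twist_def eta1_rot[OF assms(1)])
  also have "\<dots> = \<tau> ^ 2 * eta_twist p q \<tau>"
    using nz by (simp add: eta_twist_def divide_simps) (simp add: algebra_simps power2_eq_square)
  finally show ?thesis .
qed

definition crit :: "real \<Rightarrow> real \<Rightarrow> real \<Rightarrow> complex \<Rightarrow> bool" where
  "crit p q t \<tau> \<longleftrightarrow> g2_norm \<tau> = of_real t * eta_twist p q \<tau> ^ 2"

lemma crit_rot:
  assumes "Im \<tau> > 0" "(p, q) \<noteq> (0, 0)"
  shows "crit (p - q) p t (rot \<tau>) \<longleftrightarrow> crit p q t \<tau>"
proof -
  have "\<tau> \<noteq> 0" using assms by auto
  have "crit (p - q) p t (rot \<tau>) \<longleftrightarrow> \<tau> ^ 4 * g2_norm \<tau> = \<tau> ^ 4 * (of_real t * eta_twist p q \<tau> ^ 2)"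
    unfolding crit_def eta_twist_rot[OF assms] g2_rot[OF assms(1)]
    by (simp add: power_mult_distrib mult_ac flip: power_mult)
  also have "\<dots> \<longleftrightarrow> crit p q t \<tau>"
    unfolding crit_def mult_cancel_left using \<open>\<tau> \<noteq> 0\<close> by simp
  finally show ?thesis .
qed

lemma crit_shift:
  assumes "Im \<tau> > 0"
  shows "crit p q t (\<tau> + 1) \<longleftrightarrow> crit (p - q) q t \<tau>"
proof -
  have "of_real p - of_real q * (\<tau> + 1) = of_real (p - q) - of_real q * \<tau>"
    by (simp add: algebra_simps)
  thus ?thesis
    unfolding crit_def eta_twist_def using eta1_T[OF assms] g2_T[OF assms] by (simp only:)
qed

section \<open>Values on the imaginary axis\<close>

lemma eis_series_of_real:
  assumes "\<bar>x\<bar> < 1"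
  obtains e where "eis_series k (of_real x) = of_real e" "x > 0 \<Longrightarrow> e > 0"
proof
  let ?f = "\<lambda>n. real (divisor_sum k (Suc n)) * x ^ Suc n"
  have "summable (\<lambda>n. real (divisor_sum k (Suc n)) * x ^ n)"
    by (rule summable_eis_series) (use assms in auto)
  from summable_mult[OF this, of x] have s: "summable ?f" by (simp add: mult_ac)
  hence "(\<lambda>n. complex_of_real (?f n)) sums of_real (suminf ?f)"
    by (intro sums_of_real summable_sums)
  thus "eis_series k (of_real x) = of_real (suminf ?f)"
    unfolding eis_series_def by (simp add: sums_iff)
  show "suminf ?f > 0" if "x > 0"
  proof (rule suminf_pos[OF s])
    fix n
    have "1 ^ k \<le> divisor_sum k (Suc n)"
      unfolding divisor_sum_def by (rule member_le_sum) auto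
    thus "?f n > 0" using that by (intro mult_pos_pos zero_less_power) auto
  qed
qed

lemma axis_values:
  assumes "Re \<tau> = 0" "Im \<tau> > 0"
  obtains h g where "eta1 \<tau> = of_real h" "g2_norm \<tau> = of_real g" "h < pi ^ 2 / 3" "(pi ^ 2 / 3) ^ 2 < g"
proof -
  define x where "x = exp (- 2 * pi * Im \<tau>)"
  have "2 * pi * \<i> * \<tau> = of_real (- 2 * pi * Im \<tau>)"
    using assms(1) by (simp add: complex_eq_iff)
  hence nome: "nome \<tau> = of_real x" by (simp only: nome_def x_def exp_of_real)
  have x: "x > 0" "\<bar>x\<bar> < 1" using assms by (auto simp: x_def)
  obtain e1 where e1: "eis_series 1 (of_real x) = of_real e1" "e1 > 0"
    using eis_series_of_real[OF x(2)] x(1) by metis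
  obtain e3 where e3: "eis_series 3 (of_real x) = of_real e3" "e3 > 0"
    using eis_series_of_real[OF x(2)] x(1) by metis
  show ?thesis
  proof
    show "eta1 \<tau> = of_real (pi ^ 2 / 3 * (1 - 24 * e1))"
      using eta1_fourier[OF assms(2)] unfolding nome e1 by simp
    show "g2_norm \<tau> = of_real (pi ^ 4 / 9 * (1 + 240 * e3))"
      using g2_fourier[OF assms(2)] unfolding nome e3 by simp
    show "pi ^ 2 / 3 * (1 - 24 * e1) < pi ^ 2 / 3" using e1(2) by simp
    have "(pi ^ 2 / 3) ^ 2 = pi ^ 4 / 9" by (simp add: power_divide flip: power_mult)
    thus "(pi ^ 2 / 3) ^ 2 < pi ^ 4 / 9 * (1 + 240 * e3)" using e3(2) by simp
  qed
qed

text \<open>The inequalities for h and g in \<open>axis_values\<close> bound h only from above, so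
  they give h^2 < g only for h \<ge> 0. For negative h the same bounds at -1/\<tau>, where eta1 is
  h' = -y^2 h + 2 pi y, give the estimate from below. The second inequality is h'^2 < g' divided by
  y^4; it concerns C = 0, where the twist is h - 2 pi / y.\<close>

lemma axis_values_S:
  assumes "Re \<tau> = 0" "Im \<tau> > 0"
  obtains h g where "eta1 \<tau> = of_real h" "g2_norm \<tau> = of_real g" "h ^ 2 < g"
    "(h - 2 * pi / Im \<tau>) ^ 2 < g"
proof -
  define y where "y = Im \<tau>"
  have y: "y > 0" using assms by (simp add: y_def)
  have \<tau>: "\<tau> = \<i> * of_real y" using assms by (simp add: complex_eq_iff y_def)
  have S: "-1 / \<tau> = \<i> * of_real (1 / y)" using y by (simp add: \<tau> field_simps)
  obtain h g where hg: "eta1 \<tau> = of_real h" "g2_norm \<tau> = of_real g" "h < pi ^ 2 / 3" "(pi ^ 2 / 3) ^ 2 < g"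
    by (rule axis_values[OF assms])
  have "Re (-1 / \<tau>) = 0" "Im (-1 / \<tau>) > 0" unfolding S using y by simp_all
  then obtain h' g' where hg': "eta1 (-1 / \<tau>) = of_real h'" "g2_norm (-1 / \<tau>) = of_real g'"
      "h' < pi ^ 2 / 3" "(pi ^ 2 / 3) ^ 2 < g'"
    by (rule axis_values)
  have "complex_of_real h' = of_real (- (y ^ 2) * h + 2 * pi * y)"
    using eta1_S[OF assms(2)] unfolding hg hg' by (simp add: \<tau> power_mult_distrib)
  hence h': "h' = - (y ^ 2) * h + 2 * pi * y" by (simp only: of_real_eq_iff)
  have "complex_of_real g' = of_real (y ^ 4 * g)"
    using g2_S[OF assms(2)] hg(2) hg'(2) by (simp add: \<tau> power_mult_distrib)
  hence g': "g' = y ^ 4 * g" by (simp only: of_real_eq_iff)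
  have less: "v ^ 2 < u" if "0 \<le> v" "v < pi ^ 2 / 3" "(pi ^ 2 / 3) ^ 2 < u" for u v :: real
    using power_strict_mono[OF that(2,1), of 2] that(3) by simp
  have bound: "h ^ 2 < g"
  proof (cases "h \<ge> 0")
    case True
    thus ?thesis using less[OF _ hg(3,4)] by blast
  next
    case False
    have "2 * pi * y > 0" using y by simp
    hence "y ^ 2 * (- h) < pi ^ 2 / 3" using hg'(3) unfolding h' by simp
    moreover have "0 \<le> y ^ 2 * (- h)" using False by (intro mult_nonneg_nonneg) auto
    ultimately have "(y ^ 2 * (- h)) ^ 2 < g'" using less hg'(4) by blast
    hence "y ^ 4 * h ^ 2 < y ^ 4 * g" unfolding g' by (simp add: power_mult_distrib flip: power_mult)
    thus ?thesis using y by simp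
  qed
  have bound': "h' ^ 2 < g'"
  proof (cases "h' \<ge> 0")
    case True
    thus ?thesis using less[OF _ hg'(3,4)] by blast
  next
    case False
    have "- h' < y ^ 2 * (pi ^ 2 / 3)"
    proof -
      have "2 * pi * y > 0" using y by simp
      hence "- h' < y ^ 2 * h" unfolding h' by simp
      also have "\<dots> < y ^ 2 * (pi ^ 2 / 3)" using hg(3) y by simp
      finally show ?thesis .
    qed
    hence "(- h') ^ 2 < (y ^ 2 * (pi ^ 2 / 3)) ^ 2" using False by (intro power_strict_mono) auto
    also have "\<dots> = y ^ 4 * (pi ^ 2 / 3) ^ 2"
      unfolding power_mult_distrib by (simp flip: power_mult)
    also have "\<dots> < g'" unfolding g' using hg(4) y by simp
    finally show ?thesis by simp
  qed
  have "h - 2 * pi / y = - h' / y ^ 2" unfolding h' using y by (simp add: field_simps power2_eq_square)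
  hence "(h - 2 * pi / y) ^ 2 = h' ^ 2 / y ^ 4" by (simp add: power_divide flip: power_mult)
  also have "\<dots> < g" using bound' y unfolding g' by (simp add: field_simps)
  finally show ?thesis using that[OF hg(1,2) bound] by (simp add: y_def)
qed

text \<open>A solution forces the square of the twist to be the positive number g/t, hence a real
  twist. For p and q both nonzero its imaginary part does not vanish. For p = 0 or q = 0 the twist
  is real, and its square is too small by \<open>axis_values_S\<close>.\<close>

lemma not_crit_axis:
  assumes "Re \<tau> = 0" "Im \<tau> > 0" "(p, q) \<noteq> (0, 0)" "0 \<le> t" "t \<le> 1"
  shows "\<not> crit p q t \<tau>"
proof
  assume crit: "crit p q t \<tau>"
  define y where "y = Im \<tau>"
  have y: "y > 0" using assms by (simp add: y_def)
  have \<tau>: "\<tau> = \<i> * of_real y" using assms by (simp add: complex_eq_iff y_def)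
  obtain h g where hg: "eta1 \<tau> = of_real h" "g2_norm \<tau> = of_real g" "h ^ 2 < g" "(h - 2 * pi / Im \<tau>) ^ 2 < g"
    by (rule axis_values_S[OF assms(1,2)])
  have "g > 0" using hg(3) zero_le_power2[of h] by linarith
  have *: False if "eta_twist p q \<tau> = of_real v" "v ^ 2 < g" for v
  proof -
    have "complex_of_real g = of_real (t * v ^ 2)"
      using crit that(1) hg(2) by (simp add: crit_def)
    hence "g = t * v ^ 2" by (simp only: of_real_eq_iff)
    also have "\<dots> \<le> 1 * v ^ 2" using assms by (intro mult_right_mono) auto
    finally show False using that(2) by simp
  qed
  consider "q = 0" | "p = 0" "q \<noteq> 0" | "p \<noteq> 0" "q \<noteq> 0" by blast
  thus False
  proof cases
    case 1
    thus ?thesis using *[of h] hg by (simp add: eta_twist_def)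
  next
    case 2
    have "eta_twist p q \<tau> = of_real (h - 2 * pi / Im \<tau>)"
      using 2 y hg(1) by (simp add: eta_twist_def \<tau> field_simps)
    thus ?thesis using * hg(4) by blast
  next
    case 3
    define D where "D = p ^ 2 + (q * y) ^ 2"
    have D: "D > 0" using 3 by (simp add: D_def sum_power2_gt_zero_iff)
    have nz: "of_real p - of_real q * \<tau> \<noteq> 0" by (rule twist_denom_nonzero) (use assms in auto)
    have "(of_real p - of_real q * \<tau>) * (of_real p + of_real q * \<tau>) = of_real D"
      by (simp add: D_def \<tau> algebra_simps power2_eq_square)
    hence inv: "1 / (of_real p - of_real q * \<tau>) = (of_real p + of_real q * \<tau>) / of_real D"
      using nz D by (simp add: field_simps)
    have "eta_twist p q \<tau> = of_real h + 2 * pi * \<i> * of_real q * (1 / (of_real p - of_real q * \<tau>))"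
      by (simp add: eta_twist_def hg(1))
    also have "Im \<dots> = 2 * pi * q * p / D"
      unfolding inv by (simp add: \<tau>)
    finally have im: "Im (eta_twist p q \<tau>) \<noteq> 0" using 3 D by simp
    have e: "of_real g = of_real t * eta_twist p q \<tau> ^ 2"
      using crit hg(2) by (simp add: crit_def)
    hence "t \<noteq> 0" using \<open>g > 0\<close> by auto
    hence "t > 0" using assms by simp
    have "eta_twist p q \<tau> ^ 2 = of_real (g / t)" using e \<open>t \<noteq> 0\<close> by (simp add: field_simps)
    also have "\<dots> = of_real (sqrt (g / t)) ^ 2"
      using \<open>g > 0\<close> \<open>t > 0\<close> by (simp only: of_real_power [symmetric]) simp
    finally have "eta_twist p q \<tau> = of_real (sqrt (g / t)) \<or> eta_twist p q \<tau> = - of_real (sqrt (g / t))"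
      by (rule power2_eq_iff[THEN iffD1])
    thus False using im by auto
  qed
qed

section \<open>Behaviour at the cusps\<close>

text \<open>The quadratic Taylor bound at 1/2 is 13/8, and its tenth power exceeds 100.\<close>

lemma exp_5_ge: "exp (5 :: real) \<ge> 100"
proof -
  have "(1 + 1 / 2 + (1 / 2) ^ 2 / 2 :: real) \<le> exp (1 / 2)"
    by (rule exp_lower_Taylor_quadratic) simp
  hence "(13 / 8 :: real) \<le> exp (1 / 2)" by (simp add: power2_eq_square)
  hence "(13 / 8 :: real) ^ 10 \<le> exp (1 / 2) ^ 10" by (rule power_mono) simp
  also have "exp (1 / 2 :: real) ^ 10 = exp 5" by (simp flip: exp_of_nat_mult)
  finally show ?thesis by (rule order.trans[rotated]) (simp add: power_divide)
qed

lemma eis_series_0: "eis_series k 0 = 0"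
  by (simp add: eis_series_def)

lemma norm_eis_series_le:
  assumes "norm x \<le> 1 / 100" "k \<le> 3"
  shows "norm (eis_series k x) \<le> 3 / 2 * norm x"
proof -
  have "norm (eis_series k x - x) \<le> norm x / 2"
    using eis_series_lipschitz[of x 0 k] assms by (simp add: eis_series_0)
  moreover have "norm (eis_series k x) \<le> norm (eis_series k x - x) + norm x"
    using norm_triangle_ineq[of "eis_series k x - x" x] by simp
  ultimately show ?thesis by simp
qed

text \<open>The height 17/20 lies just below sqrt 3 / 2, the height of \<open>rho\<close>, and is
  large enough that 2 * 3 * 17/20 > 5. This puts the nome into the disc of
  \<open>eis_series_lipschitz\<close>.\<close>

lemma norm_nome_le:
  assumes "Im \<tau> \<ge> 17 / 20"
  shows "norm (nome \<tau>) < 1 / 100"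
proof -
  have "3 * (17 / 20) \<le> pi * Im \<tau>"
    using assms pi_gt3 by (intro mult_mono) auto
  hence "- 2 * pi * Im \<tau> < - 5" by simp
  hence "norm (nome \<tau>) < exp (- 5)" unfolding norm_nome by simp
  also have "\<dots> = inverse (exp 5)" by (rule exp_minus)
  also have "\<dots> \<le> 1 / 100" using exp_5_ge by (simp add: field_simps)
  finally show ?thesis .
qed

text \<open>The constants are 24 and 240 times the factor 3/2 of
  \<open>norm_eis_series_le\<close>.\<close>

lemma fourier_bounds:
  assumes "Im \<tau> \<ge> 1"
  obtains u v :: complex where "eta1 \<tau> = of_real (pi ^ 2 / 3) * (1 + u)"
    "g2_norm \<tau> = of_real (pi ^ 2 / 3) ^ 2 * (1 + v)"
    "norm u \<le> 36 * norm (nome \<tau>)" "norm v \<le> 360 * norm (nome \<tau>)"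
proof
  have Im: "Im \<tau> > 0" using assms by simp
  have n: "norm (nome \<tau>) \<le> 1 / 100" using norm_nome_le[of \<tau>] assms by simp
  show "eta1 \<tau> = of_real (pi ^ 2 / 3) * (1 + (- 24 * eis_series 1 (nome \<tau>)))"
    using eta1_fourier[OF Im] by simp
  have "of_real (pi ^ 2 / 3) ^ 2 = complex_of_real (pi ^ 4 / 9)" by (simp add: power_divide flip: power_mult)
  thus "g2_norm \<tau> = of_real (pi ^ 2 / 3) ^ 2 * (1 + 240 * eis_series 3 (nome \<tau>))"
    using g2_fourier[OF Im] by (simp only:)
  show "norm (- 24 * eis_series 1 (nome \<tau>)) \<le> 36 * norm (nome \<tau>)"
       "norm (240 * eis_series 3 (nome \<tau>)) \<le> 360 * norm (nome \<tau>)"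
    using norm_eis_series_le[OF n, of 1] norm_eis_series_le[OF n, of 3]
    by (simp_all add: norm_mult)
qed

text \<open>A solution would satisfy |1 + v| \<le> |V + u|^2, where |V|^2 \<le> 1 - 1/(2y) while u
  and v are of the size of the nome, which decays exponentially in y. The lower bound by |p/q| + 1
  ensures |C - x| \<le> y, which turns the gain y/D into at least 1/(2y).\<close>

lemma not_crit_cusp:
  assumes q: "q \<noteq> 0" and t: "0 \<le> t" "t \<le> 1"
    and \<tau>: "0 \<le> Re \<tau>" "Re \<tau> \<le> 1" "Im \<tau> \<ge> 2" "Im \<tau> \<ge> \<bar>p / q\<bar> + 1"
  shows "\<not> crit p q t \<tau>"
proof
  assume crit: "crit p q t \<tau>"
  define x y C s where "x = Re \<tau>" and "y = Im \<tau>" and "C = p / q" and "s = 6 / pi"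
  define w where "w = of_real C - \<tau>"
  define \<epsilon> where "\<epsilon> = norm (nome \<tau>)"
  have y: "y \<ge> 2" "y \<ge> \<bar>C\<bar> + 1" using \<tau> by (auto simp: y_def C_def)
  have w0: "w \<noteq> 0" using y by (auto simp: w_def y_def complex_eq_iff)
  have Im1: "Im \<tau> \<ge> 1" using y by (simp add: y_def)
  define P where "P = complex_of_real (pi ^ 2 / 3)"
  have P: "P \<noteq> 0" by (simp add: P_def)
  obtain u v where u: "eta1 \<tau> = P * (1 + u)" "norm u \<le> 36 * \<epsilon>"
      and v: "g2_norm \<tau> = P ^ 2 * (1 + v)" "norm v \<le> 360 * \<epsilon>"
    unfolding \<epsilon>_def P_def by (rule fourier_bounds[OF Im1])
  \<comment> \<open>The value s = 6/pi is chosen so that P s = 2 pi. Since w has imaginary part -y,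
    adding i s moves it towards the real axis and makes |V| < 1.\<close>
  define V where "V = (w + of_real s * \<i>) / w"
  have "of_real p - of_real q * \<tau> = of_real q * w" using q by (simp add: w_def C_def field_simps)
  hence "eta_twist p q \<tau> = P * (1 + u) + 2 * pi * \<i> / w"
    using q by (simp add: eta_twist_def u)
  also have "2 * pi * \<i> / w = P * (V - 1)"
    using w0 by (simp add: P_def V_def s_def field_simps power2_eq_square)
  finally have tw: "eta_twist p q \<tau> = P * (V + u)" by (simp add: algebra_simps)
  have "P ^ 2 * (1 + v) = P ^ 2 * (of_real t * (V + u) ^ 2)"
    using crit unfolding crit_def v(1) tw by (simp add: power_mult_distrib mult_ac)
  hence eq: "1 + v = of_real t * (V + u) ^ 2" using P by simp

  define D where "D = (C - x) ^ 2 + y ^ 2"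
  have "y ^ 2 > 0" using y by simp
  hence D: "D > 0" by (simp add: D_def add_nonneg_pos)
  have s: "3 / 2 \<le> s" "s \<le> 2"
    using pi_gt3 pi_less_4 by (auto simp: s_def field_simps)
  have "norm V ^ 2 = ((C - x) ^ 2 + (s - y) ^ 2) / D"
    by (simp add: V_def norm_divide power_divide cmod_power2 w_def D_def x_def y_def)
  also have "(C - x) ^ 2 + (s - y) ^ 2 = D - 2 * s * y + s ^ 2"
    by (simp add: D_def power2_eq_square algebra_simps)
  also have "\<dots> \<le> D - 3 * y + 2 ^ 2"
  proof -
    have "3 * y \<le> 2 * s * y" using s y by (intro mult_right_mono) auto
    moreover have "s ^ 2 \<le> 2 ^ 2" using s by (intro power_mono) auto
    ultimately show ?thesis by simp
  qed
  also have "\<dots> \<le> D - y" using y by simp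
  finally have V: "norm V ^ 2 \<le> 1 - y / D"
    using D by (simp add: divide_right_mono diff_divide_distrib)
  have "y / D \<ge> 1 / (2 * y)"
  proof -
    have "\<bar>C - x\<bar> \<le> \<bar>y\<bar>" using y \<tau> by (auto simp: x_def)
    hence "D \<le> 2 * y ^ 2" unfolding D_def using abs_le_square_iff[of "C - x" y] by simp
    hence "y / (2 * y ^ 2) \<le> y / D" using D y by (intro divide_left_mono) auto
    thus ?thesis using y by (simp add: power2_eq_square)
  qed
  hence V': "norm V ^ 2 \<le> 1 - 1 / (2 * y)" using V by simp
  hence "norm V ^ 2 \<le> 1" using y by (smt (verit) divide_nonneg_pos)
  hence V1: "norm V \<le> 1" by (simp add: power_le_one_iff abs_square_le_1)

  have \<epsilon>: "\<epsilon> * y \<le> 1 / 10000"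
  proof -
    have "6 * y \<le> 2 * pi * y" using y pi_gt3 by (intro mult_right_mono) auto
    hence "\<epsilon> \<le> exp (- 6 * y)" unfolding \<epsilon>_def norm_nome y_def by simp
    moreover have "y \<le> exp y" using exp_ge_add_one_self[of y] by linarith
    ultimately have "\<epsilon> * y \<le> exp (- 6 * y) * exp y"
      using y by (intro mult_mono) (auto simp: \<epsilon>_def)
    also have "\<dots> = exp (- 5 * y)" by (simp flip: exp_add)
    also have "\<dots> \<le> exp (- 10)" using y by simp
    also have "\<dots> = inverse (exp 5 * exp 5)" by (simp flip: exp_add exp_minus)
    also have "\<dots> \<le> 1 / 10000"
      using mult_mono[OF exp_5_ge exp_5_ge] by (simp add: field_simps)
    finally show ?thesis .
  qed
  have \<epsilon>0: "\<epsilon> \<ge> 0" by (simp add: \<epsilon>_def)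
  have "\<epsilon> \<le> \<epsilon> * y" using mult_left_mono[of 1 y \<epsilon>] y \<epsilon>0 by simp
  hence "norm u \<le> 1" using u(2) \<epsilon> by simp

  have "1 - norm v \<le> norm (1 + v)" using norm_diff_ineq[of 1 v] by simp
  also have "\<dots> = t * norm (V + u) ^ 2" unfolding eq using t by (simp add: norm_mult norm_power)
  also have "\<dots> \<le> 1 * (norm V + norm u) ^ 2"
    using t by (intro mult_mono power_mono norm_triangle_ineq) auto
  also have "\<dots> = norm V ^ 2 + 2 * norm V * norm u + norm u * norm u"
    by (simp add: power2_eq_square algebra_simps)
  also have "\<dots> \<le> (1 - 1 / (2 * y)) + 2 * 1 * norm u + 1 * norm u"
    using V' V1 \<open>norm u \<le> 1\<close> by (intro add_mono mult_mono) auto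
  finally have "1 / (2 * y) \<le> 3 * norm u + norm v" by simp
  \<comment> \<open>Here 468 = 3 * 36 + 360.\<close>
  also have "\<dots> \<le> 468 * \<epsilon>" using u(2) v(2) by simp
  finally have "1 \<le> 936 * (\<epsilon> * y)" using y by (simp add: field_simps)
  thus False using \<epsilon> by simp
qed

text \<open>For C = \<infinity> the factor V is 1, and the gap 1 - t0 has to beat the exponentially
  small errors instead. They are at most 468/y, which makes 469 sufficient.\<close>

lemma not_crit_cusp_0:
  assumes t: "0 \<le> t" "t \<le> t0" "t0 < 1" and \<tau>: "Im \<tau> \<ge> 2" "Im \<tau> \<ge> 469 / (1 - t0)"
  shows "\<not> crit p 0 t \<tau>"
proof
  assume crit: "crit p 0 t \<tau>"
  define y where "y = Im \<tau>"
  define \<epsilon> where "\<epsilon> = norm (nome \<tau>)"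
  have y: "y \<ge> 2" "y * (1 - t0) \<ge> 469" using \<tau> t by (auto simp: y_def field_simps)
  have Im1: "Im \<tau> \<ge> 1" using y by (simp add: y_def)
  define P where "P = complex_of_real (pi ^ 2 / 3)"
  have P: "P \<noteq> 0" by (simp add: P_def)
  obtain u v where u: "eta1 \<tau> = P * (1 + u)" "norm u \<le> 36 * \<epsilon>"
      and v: "g2_norm \<tau> = P ^ 2 * (1 + v)" "norm v \<le> 360 * \<epsilon>"
    unfolding \<epsilon>_def P_def by (rule fourier_bounds[OF Im1])
  have "P ^ 2 * (1 + v) = P ^ 2 * (of_real t * (1 + u) ^ 2)"
    using crit unfolding crit_def v(1) eta_twist_def u(1) by (simp add: power_mult_distrib mult_ac)
  hence eq: "1 + v = of_real t * (1 + u) ^ 2" using P by simp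
  have "\<epsilon> \<le> 1 / 100" using norm_nome_le[of \<tau>] Im1 by (simp add: \<epsilon>_def)
  hence u1: "norm u \<le> 1" using u(2) by simp
  have "1 - norm v \<le> norm (1 + v)" using norm_diff_ineq[of 1 v] by simp
  also have "\<dots> = t * norm (1 + u) ^ 2" unfolding eq using t by (simp add: norm_mult norm_power)
  also have "\<dots> \<le> t0 * (1 + norm u) ^ 2"
    using t norm_triangle_ineq[of 1 u] by (intro mult_mono power_mono) auto
  also have "\<dots> = t0 * 1 + t0 * (2 * norm u + norm u * norm u)"
    by (simp add: power2_eq_square algebra_simps)
  also have "\<dots> \<le> t0 * 1 + 1 * (2 * norm u + 1 * norm u)"
    using t u1 by (intro add_mono mult_mono) auto
  finally have "1 - t0 \<le> 3 * norm u + norm v" by simp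
  also have "\<dots> \<le> 468 * \<epsilon>" using u(2) v(2) by simp
  finally have le: "1 - t0 \<le> 468 * \<epsilon>" .
  have "y * 1 \<le> y * (2 * pi)" using y pi_gt3 by (intro mult_left_mono) auto
  hence "\<epsilon> \<le> exp (- y)" unfolding \<epsilon>_def norm_nome y_def by (simp add: mult_ac)
  moreover have "y \<le> exp y" using exp_ge_add_one_self[of y] by linarith
  ultimately have "y * \<epsilon> \<le> exp y * exp (- y)"
    using y by (intro mult_mono) (auto simp: \<epsilon>_def)
  hence "y * \<epsilon> \<le> 1" by (simp flip: exp_add)
  moreover have "y * (1 - t0) \<le> y * (468 * \<epsilon>)" using le y by (intro mult_left_mono) auto
  ultimately show False using y(2) by (simp add: mult_ac)
qed

lemma crit_cusp_bound:
  assumes "t0 \<le> 1" "q \<noteq> 0 \<or> t0 < 1"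
  obtains Y where "Y \<ge> 2" "\<And>\<tau> t. 0 \<le> Re \<tau> \<Longrightarrow> Re \<tau> \<le> 1 \<Longrightarrow> Im \<tau> \<ge> Y \<Longrightarrow> 0 \<le> t \<Longrightarrow> t \<le> t0 \<Longrightarrow> \<not> crit p q t \<tau>"
proof (cases "q = 0")
  case True
  show ?thesis
  proof (rule that[of "max 2 (469 / (1 - t0))"])
    fix \<tau> t assume "Im \<tau> \<ge> max 2 (469 / (1 - t0))" "0 \<le> t" "t \<le> t0"
    thus "\<not> crit p q t \<tau>" using True assms not_crit_cusp_0[of t t0 \<tau> p] by simp
  qed simp
next
  case False
  show ?thesis
  proof (rule that[of "max 2 (\<bar>p / q\<bar> + 1)"])
    fix \<tau> t assume "0 \<le> Re \<tau>" "Re \<tau> \<le> 1" "Im \<tau> \<ge> max 2 (\<bar>p / q\<bar> + 1)" "0 \<le> t" "t \<le> t0"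
    thus "\<not> crit p q t \<tau>" using False assms not_crit_cusp[of q t \<tau> p] by simp
  qed simp
qed

section \<open>The ideal triangle\<close>

text \<open>In this form the circle condition is the half plane condition Re (rot \<tau>) \<ge> 0 up
  to the factor |\<tau>|^2, which makes the symmetry under \<open>rot\<close> easy to check.\<close>

lemma mem_F0_iff: "\<tau> \<in> F0 \<longleftrightarrow> Im \<tau> > 0 \<and> 0 \<le> Re \<tau> \<and> Re \<tau> \<le> 1 \<and> Re \<tau> \<le> norm \<tau> ^ 2"
proof -
  have "1 / 2 \<le> norm (\<tau> - 1 / 2) \<longleftrightarrow> (1 / 2) ^ 2 \<le> norm (\<tau> - 1 / 2) ^ 2"
    by (rule power_mono_iff[symmetric]) auto
  also have "\<dots> \<longleftrightarrow> Re \<tau> \<le> norm \<tau> ^ 2"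
    unfolding cmod_power2 by (simp add: power2_eq_square algebra_simps)
  finally show ?thesis by (auto simp: F0_def upper_half_plane_def)
qed

lemma norm_rot: "norm (rot \<tau> - 1) = 1 / norm \<tau>" "\<tau> \<noteq> 0 \<Longrightarrow> norm (rot \<tau>) = norm (\<tau> - 1) / norm \<tau>"
proof -
  show "norm (rot \<tau> - 1) = 1 / norm \<tau>" by (simp add: rot_def norm_divide)
  assume "\<tau> \<noteq> 0"
  hence "rot \<tau> = (\<tau> - 1) / \<tau>" by (simp add: rot_def field_simps)
  thus "norm (rot \<tau>) = norm (\<tau> - 1) / norm \<tau>" by (simp add: norm_divide)
qed

lemma norm_minus_1_square: "norm (\<tau> - 1) ^ 2 = norm \<tau> ^ 2 - 2 * Re \<tau> + 1"
  unfolding cmod_power2 by (simp add: power2_eq_square algebra_simps)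

lemma rot_in_F0:
  assumes "\<tau> \<in> F0"
  shows "rot \<tau> \<in> F0"
proof -
  define N where "N = norm \<tau> ^ 2"
  have \<tau>: "Im \<tau> > 0" "0 \<le> Re \<tau>" "Re \<tau> \<le> 1" "Re \<tau> \<le> N" using assms by (auto simp: mem_F0_iff N_def)
  have nz: "\<tau> \<noteq> 0" using \<tau> by auto
  hence N: "N > 0" by (simp add: N_def)
  have "norm (rot \<tau>) ^ 2 = (N - 2 * Re \<tau> + 1) / N"
    unfolding norm_rot(2)[OF nz] power_divide norm_minus_1_square by (simp add: N_def)
  thus ?thesis
    using \<tau> N Im_rot_pos[OF \<tau>(1)] by (simp add: mem_F0_iff Re_rot field_simps flip: N_def)
qed

text \<open>Each side is carried to the imaginary axis: the line Re \<tau> = 1 by translation, the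
  semicircle by \<open>rot\<close>. The parameter (p, q) moves along and may become 0 or
  \<infinity>, which is why \<open>not_crit_axis\<close> includes those values.\<close>

lemma not_crit_boundary:
  assumes \<tau>: "\<tau> \<in> F0" and pq: "(p, q) \<noteq> (0, 0)" and t: "0 \<le> t" "t \<le> 1"
    and bd: "Re \<tau> = 0 \<or> Re \<tau> = 1 \<or> Re \<tau> = norm \<tau> ^ 2"
  shows "\<not> crit p q t \<tau>"
proof -
  have Im: "Im \<tau> > 0" using \<tau> by (simp add: mem_F0_iff)
  from bd consider "Re \<tau> = 0" | "Re \<tau> = 1" | "Re \<tau> = norm \<tau> ^ 2" by blast
  thus ?thesis
  proof cases
    case 1
    thus ?thesis using not_crit_axis[OF _ Im pq t] by blast
  next
    case 2
    have "\<not> crit (p - q) q t (\<tau> - 1)"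
      by (rule not_crit_axis) (use 2 Im pq t in auto)
    thus ?thesis using crit_shift[of "\<tau> - 1" p q t] Im by simp
  next
    case 3
    have "\<tau> \<noteq> 0" using Im by auto
    hence "\<not> crit (p - q) p t (rot \<tau>)"
      by (intro not_crit_axis) (use 3 Im_rot_pos[OF Im] pq t in \<open>auto simp: Re_rot\<close>)
    thus ?thesis using crit_rot[OF Im pq] by blast
  qed
qed

section \<open>The zero of g2 in the triangle\<close>

definition rho :: complex where
  "rho = Complex (1 / 2) (sqrt 3 / 2)"

lemma rho_square: "rho ^ 2 = rho - 1"
  by (simp add: rho_def complex_eq_iff power2_eq_square)

lemma rho_nonzero: "rho \<noteq> 0"
  by (simp add: rho_def complex_eq_iff)

lemma rot_rho: "rot rho = rho"
  using rho_square rho_nonzero by (simp add: rot_def field_simps power2_eq_square)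

lemma norm_rho: "norm rho = 1"
  by (simp add: rho_def cmod_def power_divide)

lemma rho_in_F0: "rho \<in> F0"
  unfolding mem_F0_iff norm_rho by (simp add: rho_def)

text \<open>At the fixed point of \<open>rot\<close> the weight 4 transformation multiplies the
  value by rho^4 = -rho, which is not 1.\<close>

lemma g2_rho: "g2_norm rho = 0"
proof -
  have "Im rho > 0" using rho_in_F0 by (simp add: mem_F0_iff)
  hence "g2_norm rho = rho ^ 4 * g2_norm rho" using g2_rot[of rho] by (simp add: rot_rho)
  hence "(rho ^ 4 - 1) * g2_norm rho = 0" by (simp add: algebra_simps)
  moreover have "rho ^ 4 = - rho"
  proof -
    have "rho ^ 4 = (rho ^ 2) ^ 2" by (simp flip: power_mult)
    also have "\<dots> = (rho - 1) ^ 2" by (simp only: rho_square)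
    also have "\<dots> = rho ^ 2 - 2 * rho + 1" by (simp add: power2_eq_square algebra_simps)
    also have "\<dots> = - rho" by (simp add: rho_square)
    finally show ?thesis .
  qed
  hence "rho ^ 4 \<noteq> 1" by (simp add: rho_def complex_eq_iff)
  ultimately show ?thesis by simp
qed

text \<open>Outside the unit circles about 0 and 1 the height is at least sqrt 3 / 2; the slightly
  smaller rational bound is what \<open>norm_nome_le\<close> needs.\<close>

lemma Im_ge_of_outside_circles:
  assumes "\<tau> \<in> F0" "norm \<tau> \<ge> 1" "norm (\<tau> - 1) \<ge> 1"
  shows "Im \<tau> \<ge> 17 / 20"
proof (rule ccontr)
  assume "\<not> Im \<tau> \<ge> 17 / 20"
  hence "Im \<tau> ^ 2 < (17 / 20) ^ 2"
    using assms by (intro power_strict_mono) (auto simp: mem_F0_iff)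
  hence y: "Im \<tau> ^ 2 < 3 / 4" by (simp add: power2_eq_square)
  have "1 \<le> norm \<tau> ^ 2" "1 \<le> norm (\<tau> - 1) ^ 2" using assms by (auto intro: one_le_power)
  hence 1: "1 \<le> Re \<tau> ^ 2 + Im \<tau> ^ 2" "1 \<le> (1 - Re \<tau>) ^ 2 + Im \<tau> ^ 2"
    by (simp_all add: cmod_power2 power2_commute)
  have "Re \<tau> ^ 2 \<le> (1 / 2) ^ 2 \<or> (1 - Re \<tau>) ^ 2 \<le> (1 / 2) ^ 2"
    using assms(1) by (cases "Re \<tau> \<le> 1 / 2") (auto simp: mem_F0_iff intro!: power_mono)
  thus False using 1 y by (auto simp: power2_eq_square)
qed

lemma rho_outside_circles: "norm rho \<ge> 1" "norm (rho - 1) \<ge> 1"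
  by (simp_all add: norm_rho flip: rho_square add: norm_power)

text \<open>In this region the nome is so small that \<open>eis_series_lipschitz\<close> makes the
  q-expansion injective. Hence \<tau> and \<open>rho\<close> have the same nome and differ by an
  integer, which the strip forces to be 0.\<close>

lemma g2_zero_outside_circles:
  assumes "\<tau> \<in> F0" "norm \<tau> \<ge> 1" "norm (\<tau> - 1) \<ge> 1" "g2_norm \<tau> = 0"
  shows "\<tau> = rho"
proof -
  have Im: "Im \<tau> > 0" "Im rho > 0" using assms(1) rho_in_F0 by (auto simp: mem_F0_iff)
  have small: "norm (nome \<tau>) \<le> 1 / 100" "norm (nome rho) \<le> 1 / 100"
    using norm_nome_le Im_ge_of_outside_circles assms rho_in_F0 rho_outside_circles
    by (meson less_imp_le)+
  have "1 + 240 * eis_series 3 (nome \<tau>) = 0" "1 + 240 * eis_series 3 (nome rho) = 0"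
    using g2_fourier[OF Im(1)] g2_fourier[OF Im(2)] assms(4) g2_rho by auto
  hence "240 * eis_series 3 (nome \<tau>) = 240 * eis_series 3 (nome rho)"
    by (metis add_left_cancel)
  hence "eis_series 3 (nome \<tau>) = eis_series 3 (nome rho)" by simp
  hence "norm (nome \<tau> - nome rho) \<le> norm (nome \<tau> - nome rho) / 2"
    using eis_series_lipschitz[OF small, of 3] by (simp add: norm_minus_commute)
  hence "nome \<tau> = nome rho" by simp
  then obtain n :: int where "2 * pi * \<i> * \<tau> = 2 * pi * \<i> * rho + (of_int (2 * n) * pi) * \<i>"
    unfolding nome_def by (subst (asm) exp_eq) auto
  hence "2 * pi * \<i> * \<tau> = 2 * pi * \<i> * (rho + of_int n)" by (simp add: algebra_simps)
  hence "\<tau> = rho + of_int n" by simp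
  moreover from this have "0 \<le> 1 / 2 + real_of_int n" "1 / 2 + real_of_int n \<le> 1"
    using assms(1) by (auto simp: mem_F0_iff rho_def)
  hence "n = 0" by linarith
  ultimately show ?thesis by simp
qed

text \<open>With r = |\<tau>| and s = |\<tau> - 1|, the distances from 0 and 1 are (r, s) for
  \<tau>, (s/r, 1/r) for its rotate and (1/s, r/s) for the second rotate. The least of 1, r, s
  decides which of the three points lies outside both unit circles, and \<open>rot\<close> fixes
  \<open>rho\<close>.\<close>

lemma g2_zero_iff:
  assumes "\<tau> \<in> F0"
  shows "g2_norm \<tau> = 0 \<longleftrightarrow> \<tau> = rho"
proof
  assume zero: "g2_norm \<tau> = 0"
  have Im: "Im \<tau> > 0" using assms by (simp add: mem_F0_iff)
  have nz: "\<tau> \<noteq> 0" "\<tau> \<noteq> 1" using Im by auto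
  define r s where "r = norm \<tau>" and "s = norm (\<tau> - 1)"
  have pos: "r > 0" "s > 0" using nz by (auto simp: r_def s_def)
  have inj: "z = rho" if "rot z = rho" "z \<noteq> 0" for z
  proof -
    have "rot z = rot rho" by (simp only: that(1) rot_rho)
    hence "1 / z = 1 / rho" by (simp add: rot_def)
    thus ?thesis using that(2) rho_nonzero by simp
  qed
  have zero': "g2_norm (rot \<tau>) = 0" using g2_rot[OF Im] zero by simp
  hence zero'': "g2_norm (rot (rot \<tau>)) = 0" using g2_rot[OF Im_rot_pos[OF Im]] by simp
  have n1: "norm (rot \<tau>) = s / r" "norm (rot \<tau> - 1) = 1 / r"
    using norm_rot nz by (auto simp: r_def s_def)
  have rnz: "rot \<tau> \<noteq> 0" using Im_rot_pos[OF Im] by auto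
  have n2: "norm (rot (rot \<tau>)) = 1 / s" "norm (rot (rot \<tau>) - 1) = r / s"
    using norm_rot[of "rot \<tau>"] rnz pos by (auto simp: n1)
  consider "r \<ge> 1" "s \<ge> 1" | "r \<le> s" "r \<le> 1" | "s \<le> r" "s \<le> 1" by linarith
  thus "\<tau> = rho"
  proof cases
    case 1
    thus ?thesis using g2_zero_outside_circles assms zero by (simp add: r_def s_def)
  next
    case 2
    have "rot \<tau> = rho"
      by (rule g2_zero_outside_circles) (use 2 pos rot_in_F0 assms zero' in \<open>auto simp: n1\<close>)
    thus ?thesis using inj nz by blast
  next
    case 3
    have "rot (rot \<tau>) = rho"
      by (rule g2_zero_outside_circles) (use 3 pos rot_in_F0 assms zero'' in \<open>auto simp: n2\<close>)
    thus ?thesis using inj nz rnz by blast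
  qed
qed (use g2_rho in auto)

section \<open>Holomorphy and the order of the zero of g2\<close>

lemma nome_holomorphic: "nome holomorphic_on A"
  unfolding nome_def by (intro holomorphic_intros)

lemma nome_in_ball: "\<tau> \<in> upper_half_plane \<Longrightarrow> nome \<tau> \<in> ball 0 1"
  using norm_nome_less_1 by (simp add: upper_half_plane_def)

lemma eis_series_nome_holomorphic: "(\<lambda>\<tau>. eis_series k (nome \<tau>)) holomorphic_on upper_half_plane"
proof -
  have "nome ` upper_half_plane \<subseteq> ball 0 1" using nome_in_ball by blast
  from holomorphic_on_compose_gen[OF nome_holomorphic eis_series_holomorphic this]
  show ?thesis by (simp add: o_def)
qed

lemma eta1_holomorphic: "eta1 holomorphic_on upper_half_plane"
proof (rule holomorphic_transform)
  show "(\<lambda>\<tau>. of_real (pi ^ 2 / 3) * (1 - 24 * eis_series 1 (nome \<tau>))) holomorphic_on upper_half_plane"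
    by (intro holomorphic_intros eis_series_nome_holomorphic)
qed (use eta1_fourier in \<open>auto simp: upper_half_plane_def\<close>)

lemma g2_norm_holomorphic: "(\<lambda>\<tau>. g2_norm \<tau>) holomorphic_on upper_half_plane"
proof (rule holomorphic_transform)
  show "(\<lambda>\<tau>. of_real (pi ^ 4 / 9) * (1 + 240 * eis_series 3 (nome \<tau>))) holomorphic_on upper_half_plane"
    by (intro holomorphic_intros eis_series_nome_holomorphic)
qed (simp only: g2_fourier upper_half_plane_def mem_Collect_eq)

lemma open_upper_half_plane: "open upper_half_plane"
  unfolding upper_half_plane_def by (rule open_halfspace_Im_gt)

lemma connected_upper_half_plane: "connected upper_half_plane"
  unfolding upper_half_plane_def by (intro convex_connected convex_halfspace_Im_gt)

lemma eta_twist_holomorphic: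
  assumes "(p, q) \<noteq> (0, 0)"
  shows "eta_twist p q holomorphic_on upper_half_plane"
  unfolding eta_twist_def
  by (intro holomorphic_intros eta1_holomorphic)
     (use twist_denom_nonzero assms in \<open>auto simp: upper_half_plane_def\<close>)

text \<open>By \<open>eis_series_lipschitz\<close> the difference quotients of
  \<open>eis_series 3\<close> near the nome of \<open>rho\<close> have modulus at least 1/2, so the
  derivative in q is nonzero; that of the nome is nonzero as well.\<close>

lemma zorder_g2_rho: "zorder (\<lambda>\<tau>. g2_norm \<tau>) rho = 1"
proof -
  define q0 where "q0 = nome rho"
  have Im: "Im rho > 0" using rho_in_F0 by (simp add: mem_F0_iff)
  have q0: "norm q0 < 1 / 100"
    unfolding q0_def by (rule norm_nome_le[OF Im_ge_of_outside_circles])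
       (use rho_in_F0 rho_outside_circles in auto)
  obtain D where D: "(eis_series 3 has_field_derivative D) (at q0)"
    using eis_series_holomorphic q0 holomorphic_on_imp_differentiable_at[of "eis_series 3" "ball 0 1" q0]
    by (auto simp: field_differentiable_def)
  have "D \<noteq> 0"
  proof
    assume "D = 0"
    hence "((\<lambda>x. (eis_series 3 x - eis_series 3 q0) / (x - q0)) \<longlongrightarrow> 0) (at q0)"
      using D by (simp add: has_field_derivative_iff)
    hence "((\<lambda>x. norm ((eis_series 3 x - eis_series 3 q0) / (x - q0))) \<longlongrightarrow> 0) (at q0)"
      by (rule tendsto_norm_zero)
    moreover have "\<forall>\<^sub>F x in at q0. norm ((eis_series 3 x - eis_series 3 q0) / (x - q0)) \<ge> 1 / 2"
    proof -
      have "\<forall>\<^sub>F x in at q0. x \<in> ball 0 (1 / 100)"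
        using q0 by (intro eventually_at_in_open') auto
      moreover have "\<forall>\<^sub>F x in at q0. x \<noteq> q0" by (simp add: eventually_at_filter)
      ultimately show ?thesis
      proof eventually_elim
        case (elim x)
        have "norm (eis_series 3 x - eis_series 3 q0 - (x - q0)) \<le> norm (x - q0) / 2"
          using elim q0 by (intro eis_series_lipschitz) auto
        hence "norm (x - q0) / 2 \<le> norm (eis_series 3 x - eis_series 3 q0)"
          using norm_triangle_ineq2[of "x - q0" "x - q0 - (eis_series 3 x - eis_series 3 q0)"]
          by (simp add: norm_minus_commute)
        thus ?case using elim by (simp add: norm_divide field_simps)
      qed
    qed
    ultimately have "1 / 2 \<le> (0 :: real)" by (intro tendsto_lowerbound) auto
    thus False by simp
  qed
  have "((\<lambda>\<tau>. of_real (pi ^ 4 / 9) * (1 + 240 * eis_series 3 (nome \<tau>))) has_field_derivative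
          of_real (pi ^ 4 / 9) * (240 * (D * (q0 * (2 * pi * \<i>))))) (at rho)"
  proof -
    have n: "(nome has_field_derivative q0 * (2 * pi * \<i>)) (at rho)"
      unfolding nome_def q0_def by (auto intro!: derivative_eq_intros)
    show ?thesis
      using DERIV_chain2[OF D[unfolded q0_def] n] by (auto intro!: derivative_eq_intros simp: q0_def)
  qed
  hence "((\<lambda>\<tau>. g2_norm \<tau>) has_field_derivative
          of_real (pi ^ 4 / 9) * (240 * (D * (q0 * (2 * pi * \<i>))))) (at rho)"
    by (rule has_field_derivative_transform_within_open[OF _ open_upper_half_plane])
       (simp_all only: g2_fourier Im upper_half_plane_def mem_Collect_eq)
  hence "deriv (\<lambda>\<tau>. g2_norm \<tau>) rho = of_real (pi ^ 4 / 9) * (240 * (D * (q0 * (2 * pi * \<i>))))"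
    by (rule DERIV_imp_deriv)
  also have "\<dots> \<noteq> 0" using \<open>D \<noteq> 0\<close> by (simp add: q0_def nome_def)
  finally show ?thesis
    by (intro zorder_zero_eqI[OF g2_norm_holomorphic open_upper_half_plane])
       (use Im g2_rho in \<open>auto simp: upper_half_plane_def\<close>)
qed

section \<open>Counting the zeros\<close>

text \<open>Applied with r the distance to a cusp on the real line and y = Im \<tau>. The third
  hypothesis holds in the triangle because r is at most the sum of the coordinate distances, and the
  circle condition bounds the horizontal one by r^2. Thus a Euclidean disc about the cusp, cut by
  the triangle, lands above height Y after rotation.\<close>

lemma horoball_bound:
  fixes r y Y :: real
  assumes "0 < r" "r \<le> 1 / (Y + 1)" "r \<le> r ^ 2 + y" "Y > 0"
  shows "Y \<le> y / r ^ 2"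
proof -
  have "r * (Y + 1) \<le> 1" using assms by (simp add: field_simps)
  hence "r * (r * (Y + 1)) \<le> r * 1" using assms by (intro mult_left_mono) auto
  hence "Y * r ^ 2 \<le> y" using assms(3) by (simp add: power2_eq_square algebra_simps)
  thus ?thesis using assms(1) by (simp add: field_simps)
qed

theorem unique_crit:
  assumes p: "p \<noteq> 0" "p \<noteq> q" and t0: "0 \<le> t0" "t0 \<le> 1" "q \<noteq> 0 \<or> t0 < 1"
  shows "\<exists>!\<tau>. \<tau> \<in> F0 \<and> crit p q t0 \<tau>"
proof -
  have pq: "(p, q) \<noteq> (0, 0)" "(p - q, p) \<noteq> (0, 0)" using p by auto
  obtain Y1 where Y1: "Y1 \<ge> 2"
    "\<And>\<tau> t. 0 \<le> Re \<tau> \<Longrightarrow> Re \<tau> \<le> 1 \<Longrightarrow> Im \<tau> \<ge> Y1 \<Longrightarrow> 0 \<le> t \<Longrightarrow> t \<le> t0 \<Longrightarrow> \<not> crit p q t \<tau>"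
    using crit_cusp_bound[OF t0(2,3)] by metis
  obtain Y2 where Y2: "Y2 \<ge> 2"
    "\<And>\<tau> t. 0 \<le> Re \<tau> \<Longrightarrow> Re \<tau> \<le> 1 \<Longrightarrow> Im \<tau> \<ge> Y2 \<Longrightarrow> 0 \<le> t \<Longrightarrow> t \<le> t0 \<Longrightarrow> \<not> crit (p - q) p t \<tau>"
    using crit_cusp_bound[OF t0(2), of p] p by metis
  obtain Y3 where Y3: "Y3 \<ge> 2"
    "\<And>\<tau> t. 0 \<le> Re \<tau> \<Longrightarrow> Re \<tau> \<le> 1 \<Longrightarrow> Im \<tau> \<ge> Y3 \<Longrightarrow> 0 \<le> t \<Longrightarrow> t \<le> t0 \<Longrightarrow> \<not> crit (p - q - p) (p - q) t \<tau>"
    using crit_cusp_bound[OF t0(2), of "p - q"] p by (metis eq_iff_diff_eq_0)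
  define Y where "Y = max Y1 (max Y2 Y3)"
  have Y: "Y \<ge> 2" "Y \<ge> Y1" "Y \<ge> Y2" "Y \<ge> Y3" using Y1 by (auto simp: Y_def)
  define d where "d = 1 / (Y + 1)"
  have d: "d > 0" "d < 1" using Y by (auto simp: d_def)
  define U where "U = {\<tau>. 0 < Re \<tau> \<and> Re \<tau> < 1 \<and> 0 < Im \<tau> \<and> Im \<tau> < Y \<and> Re \<tau> < norm \<tau> ^ 2
                          \<and> d < norm \<tau> \<and> d < norm (\<tau> - 1)}"
  define K where "K = {\<tau>. 0 \<le> Re \<tau> \<and> Re \<tau> \<le> 1 \<and> 0 \<le> Im \<tau> \<and> Im \<tau> \<le> Y \<and> Re \<tau> \<le> norm \<tau> ^ 2
                          \<and> d \<le> norm \<tau> \<and> d \<le> norm (\<tau> - 1)}"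
  have U: "open U" unfolding U_def
    by (intro open_Collect_conj open_Collect_less continuous_intros)
  have "closed K" unfolding K_def
    by (intro closed_Collect_conj closed_Collect_le continuous_intros)
  moreover have "bounded K"
  proof (rule boundedI)
    fix \<tau> assume "\<tau> \<in> K"
    thus "norm \<tau> \<le> 1 + Y" using cmod_le[of \<tau>] by (auto simp: K_def)
  qed
  ultimately have K: "compact K" by (simp add: compact_eq_bounded_closed)
  have KF: "K \<subseteq> F0"
  proof
    fix \<tau> assume \<tau>: "\<tau> \<in> K"
    \<comment> \<open>K is closed and so only demands Im \<tau> \<ge> 0, but the triangle meets the
      real line only in 0 and 1, and these are cut out by the discs of radius d.\<close>
    have "Im \<tau> \<noteq> 0"
    proof
      assume im: "Im \<tau> = 0"
      hence "Re \<tau> \<le> Re \<tau> * Re \<tau>" using \<tau> unfolding K_def cmod_power2 by (simp add: power2_eq_square)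
      hence "Re \<tau> * (1 - Re \<tau>) \<le> 0" by (simp add: algebra_simps)
      moreover have "Re \<tau> * (1 - Re \<tau>) \<ge> 0" using \<tau> by (simp add: K_def)
      ultimately have "Re \<tau> = 0 \<or> Re \<tau> = 1" by auto
      hence "\<tau> = 0 \<or> \<tau> = 1" using im by (auto simp: complex_eq_iff)
      thus False using \<tau> d by (auto simp: K_def)
    qed
    thus "\<tau> \<in> F0" using \<tau> by (auto simp: K_def mem_F0_iff)
  qed
  have UK: "U \<subseteq> K" by (auto simp: U_def K_def)
  have FH: "F0 \<subseteq> upper_half_plane" by (auto simp: F0_def)

  \<comment> \<open>Excludes solutions in all of F0 - U, not only in K - U: besides the boundary
    condition for the homotopy this transfers uniqueness from U to the whole triangle.\<close>
  have nz: "\<not> crit p q t \<tau>" if \<tau>: "\<tau> \<in> F0" "\<tau> \<notin> U" and t: "0 \<le> t" "t \<le> t0" for t \<tau>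
  proof -
    have F: "Im \<tau> > 0" "0 \<le> Re \<tau>" "Re \<tau> \<le> 1" "Re \<tau> \<le> norm \<tau> ^ 2" using \<tau> by (auto simp: mem_F0_iff)
    have nz: "\<tau> \<noteq> 0" "\<tau> \<noteq> 1" using F by auto
    have F1: "Im (rot \<tau>) > 0" "0 \<le> Re (rot \<tau>)" "Re (rot \<tau>) \<le> 1"
      using rot_in_F0[OF \<tau>(1)] by (auto simp: mem_F0_iff)
    have F2: "0 \<le> Re (rot (rot \<tau>))" "Re (rot (rot \<tau>)) \<le> 1"
      using rot_in_F0[OF rot_in_F0[OF \<tau>(1)]] by (auto simp: mem_F0_iff)
    consider "Re \<tau> = 0 \<or> Re \<tau> = 1 \<or> Re \<tau> = norm \<tau> ^ 2" | "Im \<tau> \<ge> Y" | "norm \<tau> \<le> d" | "norm (\<tau> - 1) \<le> d"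
      using \<tau>(2) F by (auto simp: U_def not_less)
    thus ?thesis
    proof cases
      case 1
      thus ?thesis using not_crit_boundary[OF \<tau>(1) pq(1)] t t0 by simp
    next
      case 2
      thus ?thesis using Y1 Y F t by simp
    next
      case 3
      have "Im (rot \<tau>) \<ge> Y" unfolding Im_rot
        by (rule horoball_bound) (use 3 nz Y F cmod_le[of \<tau>] in \<open>auto simp: d_def\<close>)
      hence "\<not> crit (p - q) p t (rot \<tau>)" using Y2 Y F1 t by simp
      thus ?thesis using crit_rot[OF F(1) pq(1)] by blast
    next
      case 4
      have "norm (\<tau> - 1) \<le> (1 - Re \<tau>) + Im \<tau>" using cmod_le[of "\<tau> - 1"] F by simp
      also have "1 - Re \<tau> \<le> norm (\<tau> - 1) ^ 2" unfolding norm_minus_1_square using F by simp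
      finally have le: "norm (\<tau> - 1) \<le> norm (\<tau> - 1) ^ 2 + Im \<tau>" by simp
      have "Y \<le> Im \<tau> / norm (\<tau> - 1) ^ 2"
        by (rule horoball_bound) (use 4 nz Y le in \<open>auto simp: d_def\<close>)
      also have "\<dots> = Im (rot (rot \<tau>))"
        unfolding Im_rot norm_rot(2)[OF nz(1)] using nz by (simp add: power_divide)
      finally have "\<not> crit (p - q - p) (p - q) t (rot (rot \<tau>))" using Y3 Y F2 t by simp
      hence "\<not> crit (p - q) p t (rot \<tau>)" using crit_rot[OF F1(1) pq(2)] by blast
      thus ?thesis using crit_rot[OF F(1) pq(1)] by blast
    qed
  qed

  have rho: "rho \<in> U"
  proof (rule ccontr)
    assume "rho \<notin> U"
    hence "\<not> crit p q 0 rho" using nz[OF rho_in_F0] t0 by simp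
    thus False using g2_rho by (simp add: crit_def)
  qed
  have "\<exists>!\<tau>. \<tau> \<in> U \<and> g2_norm \<tau> = of_real t0 * eta_twist p q \<tau> ^ 2"
  proof (rule unique_zero_homotopy[OF open_upper_half_plane connected_upper_half_plane _ _ U UK K])
    show "(\<lambda>\<tau>. eta_twist p q \<tau> ^ 2) holomorphic_on upper_half_plane"
      by (intro holomorphic_intros eta_twist_holomorphic pq)
    show "(\<lambda>\<tau>. g2_norm \<tau>) holomorphic_on upper_half_plane" by (rule g2_norm_holomorphic)
    show "K \<subseteq> upper_half_plane" using KF FH by blast
    \<comment> \<open>The point i on the side Re \<tau> = 0 has distance sqrt 2 from 1, so it
      survives both discs and witnesses that K - U is nonempty.\<close>
    have "d \<le> sqrt 2" using d real_sqrt_ge_one[of 2] by linarith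
    hence "\<i> \<in> K" using Y d by (simp add: K_def cmod_def)
    moreover have "\<i> \<notin> U" by (simp add: U_def)
    ultimately show "K - U \<noteq> {}" by blast
    show "g2_norm \<tau> \<noteq> of_real t * eta_twist p q \<tau> ^ 2" if "0 \<le> t" "t \<le> t0" "\<tau> \<in> K - U" for t \<tau>
      using nz[of \<tau> t] that KF by (auto simp: crit_def)
    show "{\<tau> \<in> U. g2_norm \<tau> = 0} = {rho}"
    proof (intro set_eqI iffI)
      fix \<tau> assume "\<tau> \<in> {\<tau> \<in> U. g2_norm \<tau> = 0}"
      thus "\<tau> \<in> {rho}" using g2_zero_iff UK KF by blast
    qed (use rho g2_rho in auto)
    show "zorder (\<lambda>\<tau>. g2_norm \<tau>) rho = 1" by (rule zorder_g2_rho)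
  qed (use t0 in auto)
  moreover have "\<tau> \<in> U \<longleftrightarrow> \<tau> \<in> F0" if "crit p q t0 \<tau>" for \<tau>
    using that nz[of \<tau> t0] t0 UK KF by auto
  ultimately show ?thesis unfolding crit_def by metis
qed

lemma interior_F0I:
  assumes "\<tau> \<in> F0" "\<not> (Re \<tau> = 0 \<or> Re \<tau> = 1 \<or> Re \<tau> = norm \<tau> ^ 2)"
  shows "\<tau> \<in> interior F0"
proof (rule interiorI)
  let ?S = "{\<tau>. 0 < Im \<tau> \<and> 0 < Re \<tau> \<and> Re \<tau> < 1 \<and> Re \<tau> < norm \<tau> ^ 2}"
  show "open ?S" by (intro open_Collect_conj open_Collect_less continuous_intros)
  show "\<tau> \<in> ?S" using assms by (auto simp: mem_F0_iff)
  show "?S \<subseteq> F0" by (auto simp: mem_F0_iff)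
qed

lemma crit_in_interior:
  assumes "\<tau> \<in> F0" "crit p q t \<tau>" "(p, q) \<noteq> (0, 0)" "0 \<le> t" "t \<le> 1"
  shows "\<tau> \<in> interior F0"
  using interior_F0I not_crit_boundary assms by blast

section \<open>The line Re \<tau> = 1/2 and the case C = \<infinity>\<close>

text \<open>On this line the nome is the negative number -\<epsilon>, so eta1 lies above its limit
  and G below, opposite to the imaginary axis. The constant is 432 = 2 * 36 + 360, together with
  \<epsilon> \<le> 1/y.\<close>

lemma half_line_values:
  assumes "y \<ge> 2"
  obtains \<alpha> \<beta> :: real where "eta1 (Complex (1 / 2) y) = of_real (pi ^ 2 / 3 * (1 + \<alpha>))"
    "g2_norm (Complex (1 / 2) y) = of_real ((pi ^ 2 / 3) ^ 2 * (1 - \<beta>))"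
    "\<alpha> > 0" "\<beta> > 0" "\<beta> < 1" "2 * \<alpha> + \<beta> \<le> 432 / y"
proof -
  define \<epsilon> where "\<epsilon> = exp (- 2 * pi * y)"
  have \<epsilon>: "\<epsilon> > 0" by (simp add: \<epsilon>_def)
  have Im: "Im (Complex (1 / 2) y) > 0" using assms by simp
  have "2 * pi * \<i> * Complex (1 / 2) y = of_real (- 2 * pi * y) + \<i> * of_real pi"
    by (simp add: complex_eq_iff)
  hence nome: "nome (Complex (1 / 2) y) = of_real (- \<epsilon>)"
    unfolding nome_def by (simp only: exp_add exp_of_real) (simp add: \<epsilon>_def)
  have "6 * y \<le> 2 * pi * y" using assms pi_gt3 by (intro mult_right_mono) auto
  hence "- 2 * pi * y \<le> - 10" "- 2 * pi * y \<le> - y" using assms by linarith+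
  hence exp_le: "\<epsilon> \<le> exp (- 10)" "\<epsilon> \<le> exp (- y)" unfolding \<epsilon>_def by (simp_all only: exp_le_cancel_iff)
  have "exp (- 10 :: real) = inverse (exp 5 * exp 5)" by (simp flip: exp_add exp_minus)
  also have "\<dots> \<le> 1 / 10000" using mult_mono[OF exp_5_ge exp_5_ge] by (simp add: field_simps)
  finally have \<epsilon>_small: "\<epsilon> \<le> 1 / 10000" using exp_le by simp
  have "y \<le> exp y" using exp_ge_add_one_self[of y] by linarith
  hence "y * \<epsilon> \<le> exp y * exp (- y)"
    using exp_le assms \<epsilon> by (intro mult_mono) auto
  hence \<epsilon>y: "\<epsilon> \<le> 1 / y" using assms by (simp add: field_simps flip: exp_add)
  have e: "\<exists>e. eis_series k (of_real (- \<epsilon>)) = of_real (- e) \<and> \<epsilon> / 2 \<le> e \<and> e \<le> 3 / 2 * \<epsilon>"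
    if "k \<le> 3" for k
  proof -
    obtain e where e: "eis_series k (of_real (- \<epsilon>)) = of_real e"
      using eis_series_of_real[of "- \<epsilon>" k] \<epsilon> \<epsilon>_small by auto
    have "norm (eis_series k (of_real (- \<epsilon>)) - of_real (- \<epsilon>)) \<le> norm (complex_of_real (- \<epsilon>)) / 2"
      using eis_series_lipschitz[of "of_real (- \<epsilon>)" 0 k] that \<epsilon> \<epsilon>_small by (simp add: eis_series_0)
    also have "eis_series k (of_real (- \<epsilon>)) - of_real (- \<epsilon>) = of_real (e + \<epsilon>)" unfolding e by simp
    finally have "\<bar>e + \<epsilon>\<bar> \<le> \<epsilon> / 2" using \<epsilon> by (simp only: norm_of_real)
    hence "\<epsilon> / 2 \<le> - e" "- e \<le> 3 / 2 * \<epsilon>" by linarith+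
    thus ?thesis using e by (intro exI[of _ "- e"]) auto
  qed
  obtain e1 where e1: "eis_series 1 (of_real (- \<epsilon>)) = of_real (- e1)" "\<epsilon> / 2 \<le> e1" "e1 \<le> 3 / 2 * \<epsilon>"
    using e[of 1] by auto
  obtain e3 where e3: "eis_series 3 (of_real (- \<epsilon>)) = of_real (- e3)" "\<epsilon> / 2 \<le> e3" "e3 \<le> 3 / 2 * \<epsilon>"
    using e[of 3] by auto
  show ?thesis
  proof (rule that[of "24 * e1" "240 * e3"])
    show "eta1 (Complex (1 / 2) y) = of_real (pi ^ 2 / 3 * (1 + 24 * e1))"
      using eta1_fourier[OF Im] unfolding nome e1(1) by simp
    have "(pi ^ 2 / 3) ^ 2 = pi ^ 4 / 9" by (simp add: power_divide flip: power_mult)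
    thus "g2_norm (Complex (1 / 2) y) = of_real ((pi ^ 2 / 3) ^ 2 * (1 - 240 * e3))"
      using g2_fourier[OF Im] unfolding nome e3(1) by (simp only:) simp
    have "2 * (24 * e1) + 240 * e3 \<le> 432 * \<epsilon>" using e1 e3 by simp
    also have "\<dots> \<le> 432 * (1 / y)" using \<epsilon>y by (intro mult_left_mono) auto
    finally show "2 * (24 * e1) + 240 * e3 \<le> 432 / y" by simp
  qed (use e1 e3 \<epsilon> \<epsilon>_small in auto)
qed

text \<open>The quotient r = G/eta1^2 is real and continuous on the line Re \<tau> = 1/2, stays
  below 1 and tends to 1. By the intermediate value theorem it takes every value in [r(Y), 1) above
  height Y, so t1 = r(Y) serves.\<close>

lemma high_zero_near_1:
  fixes Y :: real
  assumes Y: "Y \<ge> 2"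
  obtains t1 where "0 \<le> t1" "t1 < 1"
    "\<And>t. t1 \<le> t \<Longrightarrow> t < 1 \<Longrightarrow> \<exists>y\<ge>Y. crit p 0 t (Complex (1 / 2) y)"
proof -
  define r where "r = (\<lambda>y. Re (g2_norm (Complex (1 / 2) y)) / Re (eta1 (Complex (1 / 2) y)) ^ 2)"
  have r: "crit p 0 (r y) (Complex (1 / 2) y) \<and> 0 \<le> r y \<and> r y < 1 \<and> 1 - 432 / y \<le> r y
             \<and> Re (eta1 (Complex (1 / 2) y)) \<noteq> 0" if y: "y \<ge> 2" for y
  proof -
    obtain \<alpha> \<beta> where ab: "eta1 (Complex (1 / 2) y) = of_real (pi ^ 2 / 3 * (1 + \<alpha>))"
      "g2_norm (Complex (1 / 2) y) = of_real ((pi ^ 2 / 3) ^ 2 * (1 - \<beta>))"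
      "\<alpha> > 0" "\<beta> > 0" "\<beta> < 1" "2 * \<alpha> + \<beta> \<le> 432 / y"
      by (rule half_line_values[OF y])
    have P: "pi ^ 2 / 3 > (0 :: real)" by simp
    have "r y = (pi ^ 2 / 3) ^ 2 * (1 - \<beta>) / (pi ^ 2 / 3 * (1 + \<alpha>)) ^ 2"
      unfolding r_def ab(1,2) Re_complex_of_real ..
    also have "\<dots> = (1 - \<beta>) / (1 + \<alpha>) ^ 2"
      unfolding power_mult_distrib using P by (intro mult_divide_mult_cancel_left) auto
    finally have ry: "r y = (1 - \<beta>) / (1 + \<alpha>) ^ 2" .
    have sq: "(1 + \<alpha>) ^ 2 > 1" using ab(3) by (intro one_less_power) auto
    have "1 - 432 / y \<le> 1 - 2 * \<alpha> - \<beta>" using ab(6) by simp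
    also have "\<dots> \<le> (1 - \<beta>) / (1 + \<alpha>) ^ 2"
    proof -
      have "(1 - 2 * \<alpha> - \<beta>) * (1 + \<alpha>) ^ 2 = 1 - \<beta> - (\<beta> * (2 * \<alpha> + \<alpha> ^ 2) + 3 * \<alpha> ^ 2 + 2 * \<alpha> ^ 3)"
        by (simp add: power2_eq_square power3_eq_cube algebra_simps)
      also have "\<dots> \<le> 1 - \<beta>"
      proof -
        have "0 \<le> \<beta> * (2 * \<alpha> + \<alpha> ^ 2) + 3 * \<alpha> ^ 2 + 2 * \<alpha> ^ 3"
          using ab(3,4) by (intro add_nonneg_nonneg mult_nonneg_nonneg) auto
        thus ?thesis by linarith
      qed
      finally have "(1 - 2 * \<alpha> - \<beta>) * (1 + \<alpha>) ^ 2 \<le> 1 - \<beta>" .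
      moreover have "(1 + \<alpha>) ^ 2 > 0" using sq by linarith
      ultimately show ?thesis by (simp only: pos_le_divide_eq)
    qed
    finally have low: "1 - 432 / y \<le> r y" by (simp only: ry)
    have "(1 + \<alpha>) ^ 2 > 0" "1 - \<beta> < (1 + \<alpha>) ^ 2" using sq ab(4) by linarith+
    hence "r y < 1" unfolding ry by (simp only: divide_less_eq_1_pos)
    moreover have "0 \<le> r y" unfolding ry using ab(5) by simp
    moreover have "crit p 0 (r y) (Complex (1 / 2) y)"
    proof -
      have "(pi ^ 2 / 3) ^ 2 * (1 - \<beta>) = r y * (pi ^ 2 / 3 * (1 + \<alpha>)) ^ 2"
        unfolding ry power_mult_distrib using ab(3) by simp
      hence "complex_of_real ((pi ^ 2 / 3) ^ 2 * (1 - \<beta>)) =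
               of_real (r y) * of_real (pi ^ 2 / 3 * (1 + \<alpha>)) ^ 2"
        by (simp only: of_real_mult of_real_power)
      thus ?thesis unfolding crit_def eta_twist_def ab(1,2) by simp
    qed
    moreover have "pi ^ 2 / 3 * (1 + \<alpha>) \<noteq> 0" using P ab(3) by simp
    hence "Re (eta1 (Complex (1 / 2) y)) \<noteq> 0" unfolding ab(1) Re_complex_of_real .
    ultimately show ?thesis using low by blast
  qed
  have cont: "continuous_on {2..} r"
  proof -
    have line: "continuous_on {2..} (\<lambda>y. Complex (1 / 2) y)"
      by (intro continuous_intros)
    have sub: "(\<lambda>y. Complex (1 / 2) y) ` {2..} \<subseteq> upper_half_plane"
      by (auto simp: upper_half_plane_def)
    have eta1: "continuous_on {2..} (\<lambda>y. eta1 (Complex (1 / 2) y))"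
      by (rule continuous_on_compose2[OF holomorphic_on_imp_continuous_on[OF eta1_holomorphic] line sub])
    have "continuous_on {2..} (\<lambda>y. g2_norm (Complex (1 / 2) y))"
      by (rule continuous_on_compose2[OF holomorphic_on_imp_continuous_on[OF g2_norm_holomorphic] line sub])
    hence "continuous_on {2..} (\<lambda>y. Re (g2_norm (Complex (1 / 2) y)))" by (rule continuous_on_Re)
    thus ?thesis unfolding r_def
      by (rule continuous_on_divide) (intro continuous_on_power continuous_on_Re eta1, use r in auto)
  qed
  show ?thesis
  proof (rule that[of "r Y"])
    fix t assume t: "r Y \<le> t" "t < 1"
    \<comment> \<open>At this height 1 - 432/y \<ge> t, so that r has already reached t.\<close>
    define y where "y = max Y (432 / (1 - t))"
    have y: "y \<ge> Y" "y \<ge> 2" using Y by (auto simp: y_def)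
    have "432 / y \<le> 1 - t"
    proof -
      have "432 / (1 - t) \<le> y" by (simp add: y_def)
      thus ?thesis using t y by (simp add: field_simps)
    qed
    hence "t \<le> r y" using r[OF y(2)] by linarith
    moreover have "continuous_on {Y..y} r" by (rule continuous_on_subset[OF cont]) (use Y in auto)
    ultimately obtain x where "Y \<le> x" "x \<le> y" "r x = t"
      using IVT'[of r Y t y] t y by auto
    thus "\<exists>y\<ge>Y. crit p 0 t (Complex (1 / 2) y)" using r[of x] Y by auto
  qed (use r[OF Y] in auto)
qed

text \<open>For t < 1 close to 1 the unique solution is the high one on the line Re \<tau> = 1/2, so
  a disc about \<tau> contains none; Hurwitz' theorem extends this to t = 1.\<close>

theorem not_crit_infinity:
  assumes \<tau>: "\<tau> \<in> F0"
  shows "\<not> crit p 0 1 \<tau>"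
proof
  assume "crit p 0 1 \<tau>"
  \<comment> \<open>For q = 0 the twist is eta1 for every p; the choice p = 1 meets the hypotheses
    of \<open>unique_crit\<close>.\<close>
  hence crit: "crit 1 0 1 \<tau>" by (simp add: crit_def eta_twist_def)
  define f where "f = (\<lambda>t z. g2_norm z - of_real t * eta1 z ^ 2)"
  have crit_f: "crit 1 0 t z \<longleftrightarrow> f t z = 0" for t z by (simp add: crit_def eta_twist_def f_def)
  have "\<tau> \<in> interior F0" using crit_in_interior[OF \<tau> crit] by simp
  then obtain e where e: "e > 0" "ball \<tau> e \<subseteq> F0" by (auto simp: mem_interior)
  have FH: "F0 \<subseteq> upper_half_plane" by (auto simp: F0_def)
  have holo: "f t holomorphic_on upper_half_plane" for t
    unfolding f_def by (intro holomorphic_intros g2_norm_holomorphic eta1_holomorphic)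
  have sub: "ball \<tau> e \<subseteq> upper_half_plane" using e FH by blast
  \<comment> \<open>Every point of the disc lies below this height, so the high zero is outside the
    disc.\<close>
  define Y where "Y = max 2 (Im \<tau> + e)"
  obtain t1 where t1: "0 \<le> t1" "t1 < 1"
    "\<And>t. t1 \<le> t \<Longrightarrow> t < 1 \<Longrightarrow> \<exists>y\<ge>Y. crit 1 0 t (Complex (1 / 2) y)"
    by (rule high_zero_near_1[of Y 1]) (auto simp: Y_def)
  have nz: "f t z \<noteq> 0" if t: "t1 \<le> t" "t < 1" and z: "z \<in> ball \<tau> e" for t z
  proof
    assume "f t z = 0"
    hence z_crit: "z \<in> F0" "crit 1 0 t z" using z e by (auto simp: crit_f)
    obtain y where y: "y \<ge> Y" "crit 1 0 t (Complex (1 / 2) y)" using t1(3)[OF t] by blast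
    have "y > 1" using y by (simp add: Y_def)
    hence "y ^ 2 > 1" by (intro one_less_power) auto
    hence "Complex (1 / 2) y \<in> F0"
      using \<open>y > 1\<close> unfolding mem_F0_iff cmod_power2 by (simp add: power2_eq_square)
    moreover have "\<exists>!\<tau>. \<tau> \<in> F0 \<and> crit 1 0 t \<tau>"
      by (rule unique_crit) (use t t1 in auto)
    ultimately have "z = Complex (1 / 2) y" using z_crit y(2) by blast
    moreover have "\<bar>Im (z - \<tau>)\<bar> < e"
      using z abs_Im_le_cmod[of "z - \<tau>"] by (simp add: dist_norm norm_minus_commute)
    ultimately show False using y(1) by (auto simp: Y_def)
  qed
  define t where "t = (\<lambda>n. 1 - (1 - t1) / real (Suc n))"
  have t: "t1 \<le> t n" "t n < 1" for n
  proof -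
    have "(1 - t1) / real (Suc n) \<le> (1 - t1) / 1" using t1 by (intro divide_left_mono) auto
    thus "t1 \<le> t n" "t n < 1" using t1 by (auto simp: t_def)
  qed
  have "t \<longlonglongrightarrow> 1 - (1 - t1) * 0"
    unfolding t_def divide_inverse by (intro tendsto_intros LIMSEQ_inverse_real_of_nat)
  hence t_lim: "t \<longlonglongrightarrow> 1" by simp
  have "f 1 \<tau> \<noteq> 0"
  proof (rule Hurwitz_no_zeros[of "ball \<tau> e" "\<lambda>n. f (t n)" "f 1"])
    show "f (t n) holomorphic_on ball \<tau> e" for n by (rule holomorphic_on_subset[OF holo sub])
    show "f 1 holomorphic_on ball \<tau> e" by (rule holomorphic_on_subset[OF holo sub])
    show "uniform_limit K (\<lambda>n. f (t n)) (f 1) sequentially" if K: "compact K" "K \<subseteq> ball \<tau> e" for K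
    proof -
      have "continuous_on K (\<lambda>z. eta1 z ^ 2)"
        using K sub by (intro continuous_intros continuous_on_subset[OF
              holomorphic_on_imp_continuous_on[OF eta1_holomorphic]]) auto
      hence "bounded ((\<lambda>z. eta1 z ^ 2) ` K)"
        by (intro compact_imp_bounded compact_continuous_image K)
      then obtain B where B: "B > 0" "\<And>z. z \<in> K \<Longrightarrow> norm (eta1 z ^ 2) \<le> B"
        unfolding bounded_pos by auto
      show ?thesis
      proof (rule uniform_limitI)
        fix \<epsilon> :: real assume "\<epsilon> > 0"
        hence "\<forall>\<^sub>F n in sequentially. dist (t n) 1 < \<epsilon> / B" using t_lim B(1) by (intro tendstoD) auto
        thus "\<forall>\<^sub>F n in sequentially. \<forall>z\<in>K. dist (f (t n) z) (f 1 z) < \<epsilon>"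
        proof eventually_elim
          case (elim n)
          show ?case
          proof
            fix z assume z: "z \<in> K"
            have "f (t n) z - f 1 z = of_real (1 - t n) * eta1 z ^ 2"
              by (simp add: f_def algebra_simps)
            hence "dist (f (t n) z) (f 1 z) = \<bar>1 - t n\<bar> * norm (eta1 z ^ 2)"
              by (simp only: dist_norm norm_mult norm_of_real)
            also have "\<dots> \<le> \<bar>1 - t n\<bar> * B" using B(2)[OF z] by (intro mult_left_mono) auto
            also have "\<dots> < \<epsilon>" using elim B(1) by (simp add: dist_real_def field_simps abs_minus_commute)
            finally show "dist (f (t n) z) (f 1 z) < \<epsilon>" .
          qed
        qed
      qed
    qed
    show "\<not> f 1 constant_on ball \<tau> e"
    proof
      assume "f 1 constant_on ball \<tau> e"
      hence const: "f 1 z = f 1 \<tau>" if "z \<in> ball \<tau> e" for z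
      proof -
        obtain c where c: "\<And>w. w \<in> ball \<tau> e \<Longrightarrow> f 1 w = c"
          using \<open>f 1 constant_on ball \<tau> e\<close> unfolding constant_on_def by blast
        show ?thesis using c[OF that] c[of \<tau>] e(1) by simp
      qed
      \<comment> \<open>A constant on the disc would be the value 0 at \<tau>, hence 0 on the whole
        half plane, contrary to the inequality on the imaginary axis.\<close>
      have "f 1 \<i> = 0"
      proof (rule analytic_continuation_open[of "ball \<tau> e" upper_half_plane "f 1" "\<lambda>_. 0"])
        show "f 1 z = 0" if "z \<in> ball \<tau> e" for z using const[OF that] crit crit_f by simp
      qed (use e sub holo open_upper_half_plane connected_upper_half_plane in
            \<open>auto simp: upper_half_plane_def\<close>)
      moreover have "\<not> crit 1 0 1 \<i>" by (rule not_crit_axis) auto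
      ultimately show False by (simp add: crit_f)
    qed
  qed (use nz t e in auto)
  thus False using crit crit_f by simp
qed

theorem theorem3p1:
  shows "(\<forall>C::real. C \<notin> {0, 1} \<longrightarrow>
            (\<exists>!\<tau>. \<tau> \<in> F0 \<and> f_C C \<tau> = 0) \<and>
            (\<forall>\<tau>. \<tau> \<in> F0 \<and> f_C C \<tau> = 0 \<longrightarrow> \<tau> \<in> interior F0)) \<and>
         (\<forall>C::real. C \<in> {0, 1} \<longrightarrow> \<not> (\<exists>\<tau>\<in>F0. f_C C \<tau> = 0))"
proof -
  have iff: "f_C C \<tau> = 0 \<longleftrightarrow> crit C 1 1 \<tau>" if "\<tau> \<in> F0" for C \<tau>
    using f_C_eq_0_iff[of \<tau> C] that by (auto simp: mem_F0_iff crit_def)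
  have 1: "(\<exists>!\<tau>. \<tau> \<in> F0 \<and> f_C C \<tau> = 0) \<and> (\<forall>\<tau>. \<tau> \<in> F0 \<and> f_C C \<tau> = 0 \<longrightarrow> \<tau> \<in> interior F0)"
    if C: "C \<notin> {0, 1}" for C
  proof
    have "\<exists>!\<tau>. \<tau> \<in> F0 \<and> crit C 1 1 \<tau>" by (rule unique_crit) (use C in auto)
    thus "\<exists>!\<tau>. \<tau> \<in> F0 \<and> f_C C \<tau> = 0" using iff by (metis (no_types, lifting))
    show "\<forall>\<tau>. \<tau> \<in> F0 \<and> f_C C \<tau> = 0 \<longrightarrow> \<tau> \<in> interior F0"
      using iff crit_in_interior[of _ C 1 1] by auto
  qed
  \<comment> \<open>One rotation takes (0, 1) to (-1, 0), which is C = \<infinity>; below, one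
    rotation takes (1, 1) to (0, 1).\<close>
  have 0: "\<not> crit 0 1 1 \<tau>" if "\<tau> \<in> F0" for \<tau>
    using not_crit_infinity[OF rot_in_F0[OF that], of "0 - 1"] crit_rot[of \<tau> 0 1 1] that
    by (auto simp: mem_F0_iff)
  have "\<not> crit 1 1 1 \<tau>" if "\<tau> \<in> F0" for \<tau>
    using 0[OF rot_in_F0[OF that]] crit_rot[of \<tau> 1 1 1] that by (auto simp: mem_F0_iff)
  with 0 1 iff show ?thesis by auto
qed

end
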